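(* For every $q\in(2,\infty)$ there exist constants $c_q>0$ and $C_q>0$ such that for all $\theta\in[1,\infty]$ and all integers $n\ge 2$: $$c_q\,n^{-1/2}\log^{1/2}n\;\le\; d_n\big(B^1_{1,\theta}[0,1],L_q[0,1]\big)\;\le\; C_q\,n^{-1/2}\log^{1/2}n\qquad\text{if }1\le\theta\le 2,$$ $$c_q\,n^{-1/2}\log^{1-1/\theta}n\;\le\; d_n\big(B^1_{1,\theta}[0,1],L_q[0,1]\big)\;\le\; C_q\,n^{-1/2}\log^{1-1/\theta}n\qquad\text{if }2\le\theta\le \infty$$ (with $1/\infty=0$).
   Context: For a normed space $X$ and $K\subset X$, the Kolmogorov $n$-width is $d_n(K,X)=\inf_{Q_n}\sup_{x\in K}\inf_{y\in Q_n}\|x-y\|_X$, the infimum over all linear subspaces $Q_n\subset X$ of dimension at most $n$. For a segment $I\subset\mathbb R$, $r>0$, $p,\theta\in[1,\infty]$ and $s=1+\lfloor r\rfloor$, let $\omega_s(f,t)_p=\sup_{0<h\le t}\|\Delta_h^s(f,\cdot)\|_{L_p(I\cap(I-sh))}$ be the modulus of smoothness of order $s$ ($\Delta_h^s$ the $s$-th forward difference with step $h$). The Besov seminorm is $|f|_{B^r_{p,\theta}(I)}=\left(\int_0^\infty (t^{-r}\omega_s(f,t)_p)^\theta\,\frac{dt}{t}\right)^{1/\theta}$ for $1\le\theta<\infty$ and $\sup_{t>0}t^{-r}\omega_s(f,t)_p$ for $\theta=\infty$. The Besov space $\mathcal B^r_{p,\theta}(I)$ consists of $f\in L_p(I)$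 with finite norm $\|f\|_{L_p(I)}+|f|_{B^r_{p,\theta}(I)}$, and the Besov class $B^r_{p,\theta}(I)$ is its unit ball. Here $r=1$, $p=1$, $I=[0,1]$, and $B^1_{1,\theta}[0,1]$ is regarded as a subset of $L_q[0,1]$. *)

theory Defs
  imports "HOL-Analysis.Analysis"
begin

definition Lp_mem :: "real \<Rightarrow> real set \<Rightarrow> (real \<Rightarrow> real) \<Rightarrow> bool" where
  "Lp_mem p S f \<longleftrightarrow> set_borel_measurable lebesgue S f \<and>
                     set_integrable lebesgue S (\<lambda>x. \<bar>f x\<bar> powr p)"

definition Lp_enorm :: "real \<Rightarrow> real set \<Rightarrow> (real \<Rightarrow> real) \<Rightarrow> ennreal" where
  "Lp_enorm p S f =
     (if Lp_mem p S f then ennreal ((LINT x:S|lebesgue. \<bar>f x\<bar> powr p) powr (1 / p)) else \<infinity>)"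

text \<open>Real power on ennreal for positive exponents (infinity stays infinity).\<close>
definition enn_powr :: "ennreal \<Rightarrow> real \<Rightarrow> ennreal" where
  "enn_powr x a = (if x = \<infinity> then \<infinity> else ennreal (enn2real x powr a))"

definition fwd_diff :: "nat \<Rightarrow> real \<Rightarrow> (real \<Rightarrow> real) \<Rightarrow> real \<Rightarrow> real" where
  "fwd_diff s h f x = (\<Sum>k=0..s. (-1) ^ (s - k) * real (s choose k) * f (x + real k * h))"

definition modulus :: "nat \<Rightarrow> real \<Rightarrow> real \<Rightarrow> real \<Rightarrow> (real \<Rightarrow> real) \<Rightarrow> real \<Rightarrow> ennreal" where
  "modulus s p a b f t =
     (SUP h\<in>{0<..t}. Lp_enorm p {x. x \<in> {a..b} \<and> x + real s * h \<in> {a..b}} (fwd_diff s h f))"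

definition besov_semi :: "real \<Rightarrow> real \<Rightarrow> ereal \<Rightarrow> real \<Rightarrow> real \<Rightarrow> (real \<Rightarrow> real) \<Rightarrow> ennreal" where
  "besov_semi r p \<theta> a b f =
     (let s = nat \<lfloor>r\<rfloor> + 1 in
      if \<theta> = \<infinity> then (SUP t\<in>{0<..}. ennreal (t powr (- r)) * modulus s p a b f t)
      else enn_powr
        (\<integral>\<^sup>+ t. indicator {0<..} t *
             enn_powr (ennreal (t powr (- r)) * modulus s p a b f t) (real_of_ereal \<theta>) *
             ennreal (1 / t) \<partial>lborel)
        (1 / real_of_ereal \<theta>))"

definition besov_class :: "real \<Rightarrow> real \<Rightarrow> ereal \<Rightarrow> real \<Rightarrow> real \<Rightarrow> (real \<Rightarrow> real) set" where
  "besov_class r p \<theta> a b =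
     {f. Lp_mem p {a..b} f \<and> Lp_enorm p {a..b} f + besov_semi r p \<theta> a b f \<le> 1}"

text \<open>Kolmogorov n-width of K in L_q[a,b]; subspaces of dimension at most n are exactly
  the spans of n elements g 0, ..., g (n-1) of L_q[a,b].\<close>
definition kolmogorov_width :: "nat \<Rightarrow> (real \<Rightarrow> real) set \<Rightarrow> real \<Rightarrow> real \<Rightarrow> real \<Rightarrow> ennreal" where
  "kolmogorov_width n K q a b =
     (INF g\<in>{g :: nat \<Rightarrow> real \<Rightarrow> real. \<forall>i<n. Lp_mem q {a..b} (g i)}.
        SUP f\<in>K. INF c :: nat \<Rightarrow> real. Lp_enorm q {a..b} (\<lambda>x. f x - (\<Sum>i<n. c i * g i x)))"

definition inv_theta :: "ereal \<Rightarrow> real" where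
  "inv_theta \<theta> = (if \<theta> = \<infinity> then 0 else 1 / real_of_ereal \<theta>)"

end

theory Submission
  imports Defs
begin

text \<open>
  Write a function on the unit interval through its dyadic averages and let the slope at a dyadic
  interval be the half-difference of the averages over its two halves minus half of the same
  quantity for the parent interval.  Slopes of positive level l are combinations of second
  differences of averages, so their l_1 norm b_l is at most 2^l times the modulus of smoothness at
  scale 2^(-l-1), and the Besov norm bounds the l_theta norm of the sequence b_l.

  Upper bound.  One may enlarge q to an even integer 2m with m a power of two.  The two-point
  inequality turns the martingale of dyadic averages into the square function estimate
  \<^emph>\<open>squared L_q norm at most a constant times the sum of squared L_q norms of the slopes\<close>.  On each of
  about log n levels the slopes, a vector of the l_1 ball of dimension 2^l, are approximated from a
  random subspace of dimension n / log n with normalised l_q error (log n / n)^(1/2) b_l; the finer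
  levels are dropped.

  Lower bound.  Averaging over the cells of a fine dyadic level replaces L_q by a finite-dimensional
  space.  If every function of a test family is close to an n-dimensional subspace, then a matrix
  of rank at most n has a large trace and a small Hilbert-Schmidt norm.  For theta at most 2 the
  test functions are single hats on all levels between log n and (q/2) log n, tested against Haar
  functionals; for theta at least 2 they are sums of nested hats over all these levels, tested
  against the average over their central cell.
\<close>

section \<open>Moments on dyadic trees\<close>

text \<open>A vector of slopes on level l with l_1 norm b has normalised l_q norm at most 2^(-l/q)
  b, which falls to n^(-1/2) b only at l = (q/2) log_2 n. Between log_2 n and that level, an empty
  range unless q > 2, an n-dimensional space reaches order n^(-1/2) b on a single level and no
  better. So about log n levels matter equally, and the power of log n records how their errors
  combine. With n / log n dimensions per level the error is (log n / n)^(1/2) times the l_2 norm of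
  the b_l, which is bounded for \<theta> \<le> 2 and of order at most (log n)^(1/2 - 1/\<theta>) for
  \<theta> \<ge> 2. Adding the norms of the levels instead of their squares would lose a factor (log
  n)^(1/2) at \<theta> = 2; hence the square function. From below, levels coarser than log n are
  useless, since an operator of rank n can reproduce their cells. On the finer ones a single hat of
  fixed height fits into every class, whereas L nested hats have Besov norm of order at most
  L^(1/\<theta>), height L and an L_2 norm that does not grow with L.\<close>

lemma sum_lessThan_double:
  fixes F :: "nat \<Rightarrow> real"
  shows "(\<Sum>j<2*N. F j) = (\<Sum>j<N. F (2*j) + F (2*j+1))"
  by (induction N) (auto simp: algebra_simps)

lemma sum_geometric_tail_le:
  fixes \<rho> :: real
  assumes "0 \<le> \<rho>" "\<rho> < 1"
  shows "(\<Sum>l\<in>{a..<b}. \<rho>^l) \<le> \<rho>^a / (1 - \<rho>)"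
proof (cases "a \<le> b")
  case True
  then have "(1 - \<rho>) * (\<Sum>l\<in>{a..<b}. \<rho>^l) = \<rho>^a - \<rho>^b"
  proof (induction b rule: dec_induct)
    case (step i)
    have "(1 - \<rho>) * (\<Sum>l\<in>{a..<Suc i}. \<rho>^l) = (1 - \<rho>) * (\<Sum>l\<in>{a..<i}. \<rho>^l) + (1 - \<rho>) * \<rho>^i"
      using step.hyps by (simp add: distrib_left)
    also have "\<dots> = \<rho>^a - \<rho>^Suc i" unfolding step.IH by (simp add: left_diff_distrib)
    finally show ?case .
  qed simp
  also have "\<dots> \<le> \<rho>^a" using assms by simp
  finally show ?thesis using assms by (simp add: field_simps)
qed (use assms in simp)

text \<open>Squaring turns the pair a+d, a-d into (a^2+d^2) + 2ad, (a^2+d^2) - 2ad and halves the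
  exponent, so powers of two admit an induction on \<open>s\<close>. The constant 2m-1 is the
  optimal one in Bonami's hypercontractive inequality for one random sign, and the induction
  reproduces it exactly.\<close>

lemma two_point_inequality:
  fixes a d :: real
  assumes "m = 2^s"
  shows "((a+d)^(2*m) + (a-d)^(2*m)) / 2 \<le> (a\<^sup>2 + (2 * real m - 1) * d\<^sup>2)^m"
  using assms
proof (induction s arbitrary: a d m)
  case 0
  then show ?case by (simp add: power2_eq_square algebra_simps)
next
  case (Suc s)
  define k :: nat where "k = 2^s"
  have k: "k \<ge> 1" "m = 2*k" using Suc.prems by (simp_all add: k_def)
  have "((a+d)^(2*m) + (a-d)^(2*m)) / 2
      = (((a\<^sup>2+d\<^sup>2) + 2*a*d)^(2*k) + ((a\<^sup>2+d\<^sup>2) - 2*a*d)^(2*k)) / 2"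
    unfolding k(2) power_mult[of "a+d" 2 "2*k"] power_mult[of "a-d" 2 "2*k"]
    by (simp add: power2_eq_square algebra_simps)
  also have "\<dots> \<le> ((a\<^sup>2+d\<^sup>2)\<^sup>2 + (2 * real k - 1) * (2*a*d)\<^sup>2)^k"
    by (rule Suc.IH) (simp add: k_def)
  also have "\<dots> \<le> ((a\<^sup>2 + (2 * real m - 1) * d\<^sup>2)\<^sup>2)^k"
  proof (rule power_mono)
    have kr: "real k \<ge> 1" using k by simp
    \<comment> \<open>The mixed terms cancel because 2(4k-1) = 2 + 4(2k-1); only a nonnegative
      multiple of d^4 is left.\<close>
    have "(a\<^sup>2 + (2 * real m - 1) * d\<^sup>2)\<^sup>2 - ((a\<^sup>2+d\<^sup>2)\<^sup>2 + (2 * real k - 1) * (2*a*d)\<^sup>2)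
        = ((4 * real k - 1)\<^sup>2 - 1) * d^4"
      unfolding k(2) by (simp add: power2_eq_square power4_eq_xxxx algebra_simps)
    moreover have "(4 * real k - 1)\<^sup>2 \<ge> 1"
      using kr by (intro one_le_power) auto
    ultimately show "(a\<^sup>2+d\<^sup>2)\<^sup>2 + (2 * real k - 1) * (2*a*d)\<^sup>2 \<le> (a\<^sup>2 + (2 * real m - 1) * d\<^sup>2)\<^sup>2"
      by (smt (verit) mult_nonneg_nonneg zero_le_even_power even_numeral)
    show "0 \<le> (a\<^sup>2+d\<^sup>2)\<^sup>2 + (2 * real k - 1) * (2*a*d)\<^sup>2"
      using kr by simp
  qed
  also have "\<dots> = (a\<^sup>2 + (2 * real m - 1) * d\<^sup>2)^m"
    by (simp add: k(2) power_mult)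
  finally show ?case .
qed

lemma convex_on_power_nonneg: "convex_on {0::real..} (\<lambda>x. x^m)"
  using convex_power_even[of m] convex_power_odd[of m] convex_on_subset[of UNIV "\<lambda>x::real. x^m" "{0..}"]
  by (cases "even m") auto

lemma convex_power_real:
  fixes x y u v :: real
  assumes "0 \<le> x" "0 \<le> y" "0 \<le> u" "0 \<le> v" "u + v = 1"
  shows "(u * x + v * y)^m \<le> u * x^m + v * y^m"
proof -
  have "u = 1 - v" using assms(5) by simp
  moreover have "((1 - v) * x + v * y)^m \<le> (1 - v) * x^m + v * y^m"
    using convex_onD[OF convex_on_power_nonneg, of v x y m] assms by simp
  ultimately show ?thesis by (simp only:)
qed

text \<open>The triangle inequality of the l_m norm, with norms replaced by bounds so that only m-th
  powers occur. Convexity of x^m is applied to f/A and g/B with weights A/(A+B) and B/(A+B); a zero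
  bound forces its summands to vanish.\<close>

lemma sum_pow_Minkowski:
  fixes f g :: "'a \<Rightarrow> real"
  assumes fin: "finite I" and f0: "\<And>i. i \<in> I \<Longrightarrow> 0 \<le> f i" and g0: "\<And>i. i \<in> I \<Longrightarrow> 0 \<le> g i"
    and A: "0 \<le> A" and B: "0 \<le> B" and W: "0 \<le> W" and m: "0 < m"
    and f: "(\<Sum>i\<in>I. f i^m) \<le> W * A^m" and g: "(\<Sum>i\<in>I. g i^m) \<le> W * B^m"
  shows "(\<Sum>i\<in>I. (f i + g i)^m) \<le> W * (A + B)^m"
proof (cases "A = 0 \<or> B = 0")
  case True
  then show ?thesis
  proof
    assume "A = 0"
    then have "(\<Sum>i\<in>I. f i^m) = 0" using f m f0 by (intro antisym sum_nonneg) (auto simp: zero_power)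
    then have "\<And>i. i \<in> I \<Longrightarrow> f i^m = 0"
      using sum_nonneg_eq_0_iff[OF fin, of "\<lambda>i. f i^m"] f0 by auto
    then have "\<And>i. i \<in> I \<Longrightarrow> f i = 0" by auto
    then show ?thesis using g \<open>A = 0\<close> by simp
  next
    assume "B = 0"
    then have "(\<Sum>i\<in>I. g i^m) = 0" using g m g0 by (intro antisym sum_nonneg) (auto simp: zero_power)
    then have "\<And>i. i \<in> I \<Longrightarrow> g i^m = 0"
      using sum_nonneg_eq_0_iff[OF fin, of "\<lambda>i. g i^m"] g0 by auto
    then have "\<And>i. i \<in> I \<Longrightarrow> g i = 0" by auto
    then show ?thesis using f \<open>B = 0\<close> by simp
  qed
next
  case False
  then have pos: "A > 0" "B > 0" using A B by auto
  have "(f i + g i)^m \<le> (A+B)^m * (A/(A+B) * (f i/A)^m + B/(A+B) * (g i/B)^m)" if "i \<in> I" for i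
  proof -
    have "(f i + g i)^m = (A+B)^m * (A/(A+B) * (f i/A) + B/(A+B) * (g i/B))^m"
    proof -
      have "f i + g i = (A+B) * (A/(A+B) * (f i/A) + B/(A+B) * (g i/B))"
        using pos by (simp add: distrib_left add_pos_pos[THEN less_imp_neq, symmetric])
      then show ?thesis by (metis power_mult_distrib)
    qed
    also have "\<dots> \<le> (A+B)^m * (A/(A+B) * (f i/A)^m + B/(A+B) * (g i/B)^m)"
      using pos f0[OF that] g0[OF that]
      by (intro mult_left_mono convex_power_real) (auto simp: add_divide_distrib[symmetric])
    finally show ?thesis .
  qed
  then have "(\<Sum>i\<in>I. (f i + g i)^m)
      \<le> (\<Sum>i\<in>I. (A+B)^m * (A/(A+B) * (f i/A)^m + B/(A+B) * (g i/B)^m))"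
    by (intro sum_mono)
  also have "\<dots> = (A+B)^m * (A/(A+B) * ((\<Sum>i\<in>I. f i^m) / A^m) + B/(A+B) * ((\<Sum>i\<in>I. g i^m) / B^m))"
    by (simp add: sum.distrib sum_distrib_left sum_divide_distrib power_divide algebra_simps)
  also have "\<dots> \<le> (A+B)^m * (A/(A+B) * W + B/(A+B) * W)"
    using pos f g by (intro mult_left_mono add_mono) (auto simp: divide_le_eq)
  also have "A/(A+B) * W + B/(A+B) * W = W"
    using pos by (simp add: distrib_right[symmetric] add_divide_distrib[symmetric])
  finally show ?thesis by (simp add: mult.commute)
qed

text \<open>The 2m-th power of the L_2m norm of the step function on [0,1] with value
  \<open>a j\<close> on the j-th dyadic interval of level \<open>l\<close>. Bounds are stated as
  m-th powers, so that their bases act as squared norms, the quantities that add up along the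
  tree.\<close>

definition dyadic_moment :: "nat \<Rightarrow> nat \<Rightarrow> (nat \<Rightarrow> real) \<Rightarrow> real" where
  "dyadic_moment m l a = (\<Sum>j<2^l. a j^(2*m)) / 2^l"

lemma dyadic_moment_le_iff:
  "dyadic_moment m l a \<le> B \<longleftrightarrow> (\<Sum>j<2^l. ((a j)\<^sup>2)^m) \<le> 2^l * B"
  unfolding dyadic_moment_def power_mult by (simp add: divide_le_eq mult.commute)

lemma dyadic_moment_add:
  assumes "0 \<le> A" "0 \<le> B" "0 < m"
    "dyadic_moment m l a \<le> (A\<^sup>2)^m" "dyadic_moment m l b \<le> (B\<^sup>2)^m"
  shows "dyadic_moment m l (\<lambda>j. a j + b j) \<le> ((A + B)\<^sup>2)^m"
proof -
  have *: "dyadic_moment m l c \<le> (C\<^sup>2)^m \<longleftrightarrow> (\<Sum>j<2^l. \<bar>c j\<bar>^(2*m)) \<le> 2^l * C^(2*m)" for c C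
    by (simp add: dyadic_moment_le_iff power_mult)
  have "(\<Sum>j<2^l. \<bar>a j + b j\<bar>^(2*m)) \<le> (\<Sum>j<2^l. (\<bar>a j\<bar> + \<bar>b j\<bar>)^(2*m))"
    by (intro sum_mono power_mono) auto
  also have "\<dots> \<le> 2^l * (A+B)^(2*m)"
    using assms by (intro sum_pow_Minkowski) (auto simp: *)
  finally show ?thesis by (simp add: *)
qed

lemma dyadic_moment_sum:
  assumes "finite I" "0 < m" "\<And>i. i \<in> I \<Longrightarrow> 0 \<le> A i"
    "\<And>i. i \<in> I \<Longrightarrow> dyadic_moment m l (a i) \<le> ((A i)\<^sup>2)^m"
  shows "dyadic_moment m l (\<lambda>j. \<Sum>i\<in>I. a i j) \<le> ((\<Sum>i\<in>I. A i)\<^sup>2)^m"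
  using assms
proof (induction I rule: finite_induct)
  case empty
  then show ?case by (simp add: dyadic_moment_def zero_power)
next
  case (insert x F)
  then show ?case
    using dyadic_moment_add[of "A x" "sum A F" m l "a x" "\<lambda>j. \<Sum>i\<in>F. a i j"]
    by (simp add: sum_nonneg)
qed

lemma dyadic_moment_scale:
  "dyadic_moment m l (\<lambda>j. c * a j) = (c\<^sup>2)^m * dyadic_moment m l a"
  by (simp add: dyadic_moment_def power_mult_distrib sum_distrib_left power_mult)

lemma dyadic_moment_refine:
  "dyadic_moment m (Suc l) (\<lambda>j. a (j div 2)) = dyadic_moment m l a"
  unfolding dyadic_moment_def power_Suc sum_lessThan_double by (simp add: sum_distrib_left[symmetric])

text \<open>One martingale step. The two-point inequality replaces the values a-d and a+d by a^2 +
  2m d^2, and Minkowski's inequality in l_m, applied to the two families of squares, adds the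
  squared norms.\<close>

lemma dyadic_moment_step:
  assumes m: "m = 2^s" and A: "0 \<le> A" and D: "0 \<le> D"
    and a: "dyadic_moment m l a \<le> A^m" and d: "dyadic_moment m l d \<le> D^m"
    and a': "\<And>j. j < 2^l \<Longrightarrow> a' (2*j) = a j - d j \<and> a' (2*j+1) = a j + d j"
  shows "dyadic_moment m (Suc l) a' \<le> (A + 2 * real m * D)^m"
proof -
  have m0: "m > 0" using m by simp
  then have m1: "real m \<ge> 1" by simp
  have "(\<Sum>j<2*2^l. a' j^(2*m)) = (\<Sum>j<2^l. 2 * (((a j + d j)^(2*m) + (a j - d j)^(2*m)) / 2))"
    unfolding sum_lessThan_double by (intro sum.cong) (auto simp: a'[simplified] add.commute)
  also have "\<dots> \<le> (\<Sum>j<2^l. 2 * ((a j)\<^sup>2 + 2 * real m * (d j)\<^sup>2)^m)"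
  proof (intro sum_mono mult_left_mono)
    fix j
    have "((a j + d j)^(2*m) + (a j - d j)^(2*m)) / 2 \<le> ((a j)\<^sup>2 + (2 * real m - 1) * (d j)\<^sup>2)^m"
      by (rule two_point_inequality[OF m])
    also have "\<dots> \<le> ((a j)\<^sup>2 + 2 * real m * (d j)\<^sup>2)^m"
      using m1 by (intro power_mono[where n = m] add_mono mult_right_mono add_nonneg_nonneg mult_nonneg_nonneg) auto
    finally show "((a j + d j)^(2*m) + (a j - d j)^(2*m)) / 2 \<le> ((a j)\<^sup>2 + 2 * real m * (d j)\<^sup>2)^m" .
  qed auto
  also have "\<dots> = 2 * (\<Sum>j<2^l. ((a j)\<^sup>2 + 2 * real m * (d j)\<^sup>2)^m)"
    by (simp add: sum_distrib_left)
  also have "\<dots> \<le> 2 * (2^l * (A + 2 * real m * D)^m)"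
  proof (intro mult_left_mono sum_pow_Minkowski)
    show "(\<Sum>j<2^l. (2 * real m * (d j)\<^sup>2)^m) \<le> 2^l * (2 * real m * D)^m"
    proof -
      have "(\<Sum>j<2^l. (2 * real m * (d j)\<^sup>2)^m) = (2 * real m)^m * (\<Sum>j<2^l. ((d j)\<^sup>2)^m)"
        by (simp only: power_mult_distrib sum_distrib_left)
      also have "\<dots> \<le> (2 * real m)^m * (2^l * D^m)"
        using d by (intro mult_left_mono) (auto simp: dyadic_moment_le_iff)
      also have "\<dots> = 2^l * (2 * real m * D)^m"
        by (simp only: power_mult_distrib mult_ac)
      finally show ?thesis .
    qed
  qed (use assms m0 in \<open>auto simp: dyadic_moment_le_iff\<close>)
  finally have "(\<Sum>j<2*2^l. a' j^(2*m)) \<le> (A + 2 * real m * D)^m * (2 * 2^l)"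
    by (simp only: mult_ac)
  then show ?thesis
    by (simp add: dyadic_moment_def divide_le_eq)
qed

lemma dyadic_moment_tree:
  assumes m: "m = 2^s" and a0: "a 0 0 = 0"
    and D: "\<And>l. l < M \<Longrightarrow> 0 \<le> D l" and d: "\<And>l. l < M \<Longrightarrow> dyadic_moment m l (d l) \<le> (D l)^m"
    and a: "\<And>l j. l < M \<Longrightarrow> j < 2^l \<Longrightarrow>
      a (Suc l) (2*j) = a l j - d l j \<and> a (Suc l) (2*j+1) = a l j + d l j"
  shows "dyadic_moment m M (a M) \<le> (2 * real m * (\<Sum>l<M. D l))^m"
  using D d a
proof (induction M)
  case 0
  then show ?case using a0 m by (simp add: dyadic_moment_def zero_power)
next
  case (Suc M)
  have "dyadic_moment m (Suc M) (a (Suc M)) \<le> (2 * real m * (\<Sum>l<M. D l) + 2 * real m * D M)^m"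
  proof (rule dyadic_moment_step[OF m])
    show "dyadic_moment m M (a M) \<le> (2 * real m * (\<Sum>l<M. D l))^m"
      by (rule Suc.IH) (use Suc.prems in auto)
  qed (use Suc.prems in \<open>auto intro!: mult_nonneg_nonneg sum_nonneg\<close>)
  then show ?case by (simp add: algebra_simps)
qed

section \<open>Random signs, incoherent vectors and approximation of the l_1 ball\<close>

definition parity_sign :: "nat \<Rightarrow> real" where
  "parity_sign k = (if odd k then 1 else -1)"

text \<open>The i-th turn on the path from the root to leaf \<open>p\<close> in the binary tree of
  height \<open>n\<close>. Digits are read from the most significant one, so that passing to a child
  2j or 2j+1 leaves the earlier turns unchanged.\<close>

definition bit_sign :: "nat \<Rightarrow> nat \<Rightarrow> nat \<Rightarrow> real" where
  "bit_sign n p i = parity_sign (p div 2^(n - 1 - i))"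

lemma abs_bit_sign [simp]: "\<bar>bit_sign n p i\<bar> = 1"
  by (simp add: bit_sign_def parity_sign_def)

lemma bit_sign_even: "i < l \<Longrightarrow> bit_sign (Suc l) (2*j) i = bit_sign l j i"
  and bit_sign_odd: "i < l \<Longrightarrow> bit_sign (Suc l) (Suc (2*j)) i = bit_sign l j i"
proof -
  assume "i < l"
  then have e: "(2::nat)^(Suc l - 1 - i) = 2 * 2^(l - 1 - i)"
    by (metis Suc_diff_Suc diff_Suc_1 diff_commute power_Suc zero_less_diff diff_Suc_eq_diff_pred)
  show "bit_sign (Suc l) (2*j) i = bit_sign l j i"
    unfolding bit_sign_def e by (simp add: div_mult2_eq)
  show "bit_sign (Suc l) (Suc (2*j)) i = bit_sign l j i"
    unfolding bit_sign_def e by (simp add: div_mult2_eq)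
qed

text \<open>The sign vectors of length n are the leaves of a binary tree of height n, so the tree
  inequality contains Khinchine's inequality for even exponents.\<close>

lemma khinchine_bit_sign:
  assumes m: "m = 2^s" and u: "\<And>i. \<bar>u i\<bar> = 1"
  shows "dyadic_moment m n (\<lambda>p. \<Sum>i<n. u i * bit_sign n p i) \<le> (2 * real m * real n)^m"
proof -
  have "dyadic_moment m n ((\<lambda>l p. \<Sum>i<l. u i * bit_sign l p i) n) \<le> (2 * real m * (\<Sum>l<n. 1))^m"
  proof (rule dyadic_moment_tree[OF m, where d = "\<lambda>l p. u l"])
    fix l assume "l < n"
    have "u l ^ (2*m) = 1"
      using u[of l] by (metis abs_1 even_mult_iff even_two_times_div_two power_even_abs power_one dvd_triv_left)
    then show "dyadic_moment m l (\<lambda>p. u l) \<le> 1^m"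
      by (simp add: dyadic_moment_def)
  next
    fix l j :: nat
    show "(\<Sum>i<Suc l. u i * bit_sign (Suc l) (2*j) i) = (\<Sum>i<l. u i * bit_sign l j i) - u l \<and>
      (\<Sum>i<Suc l. u i * bit_sign (Suc l) (2*j+1) i) = (\<Sum>i<l. u i * bit_sign l j i) + u l"
      by (simp add: bit_sign_even bit_sign_odd) (simp add: bit_sign_def parity_sign_def)
  qed auto
  then show ?thesis by simp
qed

text \<open>Khinchine's inequality bounds the mean over all 2^n sign vectors, the leaves of the
  tree, for each fixed sign pattern \<open>u k\<close>; some vector does not exceed the mean of the
  sum over k.\<close>

lemma exists_sign_vector:
  assumes m: "m = 2^s" and fin: "finite I" and u: "\<And>k i. k \<in> I \<Longrightarrow> \<bar>u k i\<bar> = (1::real)"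
  shows "\<exists>v. (\<forall>i. \<bar>v i\<bar> = 1) \<and>
    (\<Sum>k\<in>I. (\<Sum>i<n. u k i * v i)^(2*m)) \<le> real (card I) * (2 * real m * real n)^m"
proof (rule ccontr)
  let ?R = "(2 * real m * real n)^m"
  assume neg: "\<not> ?thesis"
  have big: "(\<Sum>k\<in>I. (\<Sum>i<n. u k i * bit_sign n p i)^(2*m)) > real (card I) * ?R" for p
    using neg by (meson abs_bit_sign not_le)
  have "2^n * (real (card I) * ?R) = (\<Sum>p<(2::nat)^n. real (card I) * ?R)" by simp
  also have "\<dots> < (\<Sum>p<(2::nat)^n. \<Sum>k\<in>I. (\<Sum>i<n. u k i * bit_sign n p i)^(2*m))"
    by (intro sum_strict_mono big) (auto simp: lessThan_empty_iff)
  also have "\<dots> = (\<Sum>k\<in>I. 2^n * dyadic_moment m n (\<lambda>p. \<Sum>i<n. u k i * bit_sign n p i))"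
    by (subst sum.swap) (simp add: dyadic_moment_def)
  also have "\<dots> \<le> (\<Sum>k\<in>I. 2^n * ?R)"
    using u by (intro sum_mono mult_left_mono khinchine_bit_sign[OF m]) auto
  also have "\<dots> = 2^n * (real (card I) * ?R)" by simp
  finally show False by simp
qed

text \<open>Greedy choice: each new vector is compared only with the earlier ones, whose signs are
  already fixed.\<close>

lemma exists_incoherent_signs:
  assumes m: "m = 2^s"
  shows "\<exists>v :: nat \<Rightarrow> nat \<Rightarrow> real. (\<forall>k<N. \<forall>i. \<bar>v k i\<bar> = 1) \<and>
    (\<forall>k<N. (\<Sum>j<k. (\<Sum>i<n. v j i * v k i)^(2*m)) \<le> real k * (2 * real m * real n)^m)"
proof (induction N)
  case 0
  then show ?case by simp
next
  case (Suc N)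
  then obtain v :: "nat \<Rightarrow> nat \<Rightarrow> real" where v: "\<And>k i. k < N \<Longrightarrow> \<bar>v k i\<bar> = 1"
    "\<And>k. k < N \<Longrightarrow> (\<Sum>j<k. (\<Sum>i<n. v j i * v k i)^(2*m)) \<le> real k * (2 * real m * real n)^m"
    by blast
  obtain w where w: "\<And>i. \<bar>w i\<bar> = 1"
    "(\<Sum>k<N. (\<Sum>i<n. v k i * w i)^(2*m)) \<le> real N * (2 * real m * real n)^m"
    using exists_sign_vector[OF m, of "{..<N}" v n] v(1) by auto
  have "(\<Sum>j<k. (\<Sum>i<n. (v(N:=w)) j i * (v(N:=w)) k i)^(2*m)) \<le> real k * (2 * real m * real n)^m"
    if "k < Suc N" for k
  proof (cases "k = N")
    case True
    have "(\<Sum>j<N. (\<Sum>i<n. (v(N:=w)) j i * (v(N:=w)) N i)^(2*m)) = (\<Sum>k<N. (\<Sum>i<n. v k i * w i)^(2*m))"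
      by (intro sum.cong) auto
    then show ?thesis using w(2) True by simp
  next
    case False
    then have "k < N" using that by simp
    then have "(\<Sum>j<k. (\<Sum>i<n. (v(N:=w)) j i * (v(N:=w)) k i)^(2*m)) = (\<Sum>j<k. (\<Sum>i<n. v j i * v k i)^(2*m))"
      by (intro sum.cong) auto
    then show ?thesis using v(2) \<open>k < N\<close> by simp
  qed
  then show ?case using v(1) w(1)
    by (intro exI[of _ "v(N:=w)"]) (auto simp: less_Suc_eq)
qed

text \<open>Coordinate i is labelled by a sign vector v_i of length n, and the unit vector e_j is
  approximated by the combination with coefficients v_j / n. The approximant has i-th coordinate
  <v_i, v_j> / n, which is 1 at i = j, so the error consists of off-diagonal entries of a normalised
  Gram matrix. Starting from 2N vectors leaves N of them after those with a large error are
  discarded.\<close>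

lemma incoherent_columns:
  assumes m: "m = 2^s" and n: "0 < n"
  shows "\<exists>w :: nat \<Rightarrow> nat \<Rightarrow> real. \<forall>j<N. \<exists>c.
    (\<Sum>i<N. ((if i = j then 1 else 0) - (\<Sum>t<n. c t * w t i))^(2*m)) \<le> 4 * real N * (2 * real m / real n)^m"
proof -
  let ?R = "(2 * real m * real n)^m"
  have m0: "m > 0" using m by simp
  obtain v :: "nat \<Rightarrow> nat \<Rightarrow> real" where v: "\<And>k i. k < 2*N \<Longrightarrow> \<bar>v k i\<bar> = 1"
    "\<And>k. k < 2*N \<Longrightarrow> (\<Sum>j<k. (\<Sum>i<n. v j i * v k i)^(2*m)) \<le> real k * ?R"
    using exists_incoherent_signs[OF m, of "2*N" n] by blast
  have R: "?R > 0" using m0 n by simp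
  define P where "P j k = (\<Sum>i<n. v j i * v k i)^(2*m)" for j k
  have Psym: "P j k = P k j" for j k by (simp add: P_def mult.commute)
  have P0: "P j k \<ge> 0" for j k by (simp add: P_def)
  define T where "T k = (\<Sum>j\<in>{..<2*N}-{k}. P j k)" for k
  \<comment> \<open>The greedy construction controls only pairs j < k; by the symmetry of
    \<open>P\<close> the sum over all ordered pairs of distinct indices is twice that one.\<close>
  have "(\<Sum>k<K. \<Sum>j\<in>{..<K}-{k}. P j k) = 2 * (\<Sum>k<K. \<Sum>j<k. P j k)" for K
  proof (induction K)
    case (Suc K)
    have "(\<Sum>k<Suc K. \<Sum>j\<in>{..<Suc K}-{k}. P j k)
        = (\<Sum>k<K. (\<Sum>j\<in>{..<K}-{k}. P j k) + P K k) + (\<Sum>j<K. P j K)"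
    proof -
      have "(\<Sum>j\<in>{..<Suc K}-{k}. P j k) = (\<Sum>j\<in>{..<K}-{k}. P j k) + P K k" if "k < K" for k
      proof -
        have "{..<Suc K}-{k} = insert K ({..<K}-{k})" using that by auto
        then show ?thesis by simp
      qed
      moreover have "{..<Suc K}-{K} = {..<K}" by auto
      ultimately show ?thesis by simp
    qed
    then show ?case using Suc by (simp add: sum.distrib Psym[of K])
  qed simp
  then have "(\<Sum>k<2*N. T k) = 2 * (\<Sum>k<2*N. \<Sum>j<k. P j k)" by (simp add: T_def)
  also have "\<dots> \<le> 2 * (\<Sum>k<2*N. real k * ?R)"
    using v(2) by (intro mult_left_mono sum_mono) (auto simp: P_def)
  also have "\<dots> \<le> (2 * real N)\<^sup>2 * ?R"
  proof -
    have "2 * (\<Sum>k<K. real k) \<le> (real K)\<^sup>2" for K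
      by (induction K) (auto simp: power2_eq_square algebra_simps)
    from this[of "2*N"] show ?thesis
      using R by (simp add: sum_distrib_right[symmetric] mult.assoc[symmetric] mult_right_mono)
  qed
  finally have tot: "(\<Sum>k<2*N. T k) \<le> 4 * real N * real N * ?R" by (simp add: power2_eq_square)
  define B where "B = {k\<in>{..<2*N}. T k > 4 * real N * ?R}"
  have T0: "T k \<ge> 0" for k unfolding T_def by (intro sum_nonneg P0)
  \<comment> \<open>By Markov's inequality at least half of the 2N columns are good; only those are kept.\<close>
  have "card B \<le> N"
  proof (rule ccontr)
    assume c: "\<not> card B \<le> N"
    then have "B \<noteq> {}" by auto
    have "real N * (4 * real N * ?R) \<le> real (card B) * (4 * real N * ?R)"
      using c R by (intro mult_right_mono) auto
    also have "\<dots> = (\<Sum>k\<in>B. 4 * real N * ?R)" by simp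
    also have "\<dots> < (\<Sum>k\<in>B. T k)"
      using \<open>B \<noteq> {}\<close> by (intro sum_strict_mono) (auto simp: B_def)
    also have "\<dots> \<le> (\<Sum>k<2*N. T k)"
      using T0 by (intro sum_mono2) (auto simp: B_def)
    finally show False using tot by simp
  qed
  moreover have "card ({..<2*N} - B) = 2*N - card B"
    by (subst card_Diff_subset) (auto simp: B_def)
  ultimately have "N \<le> card ({..<2*N} - B)" by simp
  then obtain J where J: "J \<subseteq> {..<2*N} - B" "card J = N"
    by (meson obtain_subset_with_card_n)
  then have "finite J" by (meson finite_Diff finite_lessThan finite_subset)
  then obtain \<pi> where \<pi>: "bij_betw \<pi> {..<N} J"
    using J(2) ex_bij_betw_nat_finite[of J] by (auto simp: atLeast0LessThan)
  have inj: "\<pi> i = \<pi> j \<longleftrightarrow> i = j" if "i < N" "j < N" for i j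
    using \<pi> that by (auto simp: bij_betw_def inj_on_def)
  have piJ: "\<pi> i < 2*N" "T (\<pi> i) \<le> 4 * real N * ?R" if "i < N" for i
    using bij_betwE[OF \<pi>] that J(1) by (auto simp: B_def not_less subset_iff)
  have "(\<Sum>i<N. ((if i = j then 1 else 0) - (\<Sum>t<n. v (\<pi> j) t / n * v (\<pi> i) t))^(2*m))
      \<le> 4 * real N * (2 * real m / real n)^m" if j: "j < N" for j
  proof -
    have "((if i = j then 1 else 0) - (\<Sum>t<n. v (\<pi> j) t / n * v (\<pi> i) t))^(2*m)
        = (if i = j then 0 else P (\<pi> i) (\<pi> j) / real n^(2*m))" if i: "i < N" for i
    proof (cases "i = j")
      case True
      have "v (\<pi> j) t * v (\<pi> j) t = 1" for t
        using v(1)[OF piJ(1)[OF j], of t] abs_mult_self_eq[of "v (\<pi> j) t"] by simp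
      then have "(\<Sum>t<n. v (\<pi> j) t / n * v (\<pi> j) t) = 1" using n by simp
      then show ?thesis using True m0 by (simp add: zero_power)
    next
      case False
      have "(\<Sum>t<n. v (\<pi> j) t / n * v (\<pi> i) t) = (\<Sum>t<n. v (\<pi> i) t * v (\<pi> j) t) / n"
        by (simp add: sum_divide_distrib mult.commute)
      then show ?thesis using False by (simp add: P_def power_divide)
    qed
    then have "(\<Sum>i<N. ((if i = j then 1 else 0) - (\<Sum>t<n. v (\<pi> j) t / n * v (\<pi> i) t))^(2*m))
        = (\<Sum>i<N. if i = j then 0 else P (\<pi> i) (\<pi> j) / real n^(2*m))"
      by (intro sum.cong) auto
    also have "\<dots> = (\<Sum>i\<in>{..<N}-{j}. P (\<pi> i) (\<pi> j) / real n^(2*m))"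
      by (intro sum.mono_neutral_cong_right) auto
    also have "\<dots> = (\<Sum>i\<in>{..<N}-{j}. P (\<pi> i) (\<pi> j)) / real n^(2*m)"
      by (simp add: sum_divide_distrib)
    also have "\<dots> = (\<Sum>k\<in>\<pi> ` ({..<N}-{j}). P k (\<pi> j)) / real n^(2*m)"
      by (subst sum.reindex) (use inj in \<open>auto simp: inj_on_def\<close>)
    also have "\<dots> \<le> T (\<pi> j) / real n^(2*m)"
      unfolding T_def using piJ(1) inj j P0
      by (intro divide_right_mono sum_mono2) (auto simp: image_iff)
    also have "\<dots> \<le> 4 * real N * ?R / real n^(2*m)"
      by (intro divide_right_mono piJ(2) j) simp
    also have "\<dots> = 4 * real N * (2 * real m / real n)^m"
    proof -
      have "?R / real n^(2*m) = (2 * real m * real n / (real n)\<^sup>2)^m"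
        by (simp only: power_mult power_divide)
      also have "2 * real m * real n / (real n)\<^sup>2 = 2 * real m / real n"
        using n by (simp add: power2_eq_square)
      finally show ?thesis by (simp only: times_divide_eq_right[symmetric])
    qed
    finally show ?thesis .
  qed
  then show ?thesis
    by (intro exI[of _ "\<lambda>t i. v (\<pi> i) t"] allI impI exI[of _ "\<lambda>t. v (\<pi> _) t / n"])
qed

text \<open>Jensen's inequality for x^(2m) with weights |s_j| / S, multiplied out by S^(2m). It
  carries an error bound for the unit vectors over to their combinations.\<close>

lemma weighted_sum_power_le:
  fixes s w :: "'a \<Rightarrow> real"
  assumes fin: "finite J" and m: "0 < m"
  shows "(\<Sum>j\<in>J. s j * w j)^(2*m) \<le> (\<Sum>j\<in>J. \<bar>s j\<bar>)^(2*m - 1) * (\<Sum>j\<in>J. \<bar>s j\<bar> * (w j)^(2*m))"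
proof (cases "(\<Sum>j\<in>J. \<bar>s j\<bar>) = 0")
  case True
  then have "\<And>j. j \<in> J \<Longrightarrow> s j = 0" using fin by (simp add: sum_nonneg_eq_0_iff)
  then show ?thesis using m by (simp add: zero_power)
next
  case False
  define S where "S = (\<Sum>j\<in>J. \<bar>s j\<bar>)"
  have S: "S > 0" using False sum_nonneg[of J "\<lambda>j. \<bar>s j\<bar>"] by (auto simp: S_def less_le)
  have "(\<Sum>j\<in>J. s j * w j)^(2*m) = \<bar>\<Sum>j\<in>J. s j * w j\<bar>^(2*m)" by (simp add: power_even_abs)
  also have "\<dots> \<le> (\<Sum>j\<in>J. \<bar>s j\<bar> * \<bar>w j\<bar>)^(2*m)"
    by (intro power_mono order.trans[OF sum_abs]) (auto simp: abs_mult)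
  also have "\<dots> = S^(2*m) * (\<Sum>j\<in>J. (\<bar>s j\<bar> / S) * \<bar>w j\<bar>)^(2*m)"
    using S by (simp add: power_mult_distrib[symmetric] sum_divide_distrib[symmetric])
  also have "\<dots> \<le> S^(2*m) * (\<Sum>j\<in>J. (\<bar>s j\<bar> / S) * \<bar>w j\<bar>^(2*m))"
  proof (intro mult_left_mono)
    have "J \<noteq> {}" using S by (auto simp: S_def)
    show "(\<Sum>j\<in>J. (\<bar>s j\<bar> / S) * \<bar>w j\<bar>)^(2*m) \<le> (\<Sum>j\<in>J. (\<bar>s j\<bar> / S) * \<bar>w j\<bar>^(2*m))"
      using convex_on_sum[OF fin \<open>J \<noteq> {}\<close> convex_on_power_nonneg, of "\<lambda>j. \<bar>s j\<bar>/S" "\<lambda>j. \<bar>w j\<bar>" "2*m"] S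
      by (simp add: sum_divide_distrib[symmetric] S_def[symmetric])
  qed (use S in simp)
  also have "\<dots> = S^(2*m - 1) * (\<Sum>j\<in>J. \<bar>s j\<bar> * (w j)^(2*m))"
  proof -
    have "S^(2*m) = S^(2*m-1) * S" using m by (cases "2*m") auto
    then show ?thesis using S by (simp add: sum_divide_distrib[symmetric] power_even_abs)
  qed
  finally show ?thesis by (simp add: S_def)
qed

text \<open>The l_1 ball is the convex hull of the vectors e_j and -e_j, so the approximation of the
  unit vectors by incoherent columns extends linearly. The denominator n+1 lets the statement
  include the trivial subspace n = 0. The constant 16 absorbs a factor 4, bounded by 4^m, and the
  estimate n+1 \<le> 2n.\<close>

lemma random_subspace_approximation:
  assumes m: "m = 2^s" and N: "0 < N"
  shows "\<exists>w :: nat \<Rightarrow> nat \<Rightarrow> real. \<forall>x. \<exists>c.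
    (\<Sum>i<N. (x i - (\<Sum>t<n. c t * w t i))^(2*m)) / real N
      \<le> (16 * real m / real (n+1) * (\<Sum>j<N. \<bar>x j\<bar>)\<^sup>2)^m"
proof (cases "n = 0")
  case True
  have m0: "m > 0" using m by simp
  have "(\<Sum>i<N. (x i - (\<Sum>t<n. (0::real) * 0))^(2*m)) / real N \<le> (16 * real m / real (n+1) * (\<Sum>j<N. \<bar>x j\<bar>)\<^sup>2)^m"
    for x :: "nat \<Rightarrow> real"
  proof -
    let ?S = "\<Sum>j<N. \<bar>x j\<bar>"
    have S: "?S \<ge> 0" by (simp add: sum_nonneg)
    have "(x i)^(2*m) \<le> (?S\<^sup>2)^m" if "i < N" for i
    proof -
      have "\<bar>x i\<bar> \<le> ?S" using that by (intro member_le_sum) auto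
      then show ?thesis unfolding power_mult by (intro power_mono[where n = m]) (auto simp: abs_le_square_iff[symmetric])
    qed
    then have "(\<Sum>i<N. (x i)^(2*m)) \<le> real N * (?S\<^sup>2)^m"
      using sum_mono[of "{..<N}" "\<lambda>i. (x i)^(2*m)" "\<lambda>_. (?S\<^sup>2)^m"] by simp
    then have "(\<Sum>i<N. (x i)^(2*m)) / real N \<le> (?S\<^sup>2)^m"
      using N by (simp add: divide_le_eq mult.commute)
    also have "\<dots> \<le> (16 * real m / real (n+1) * ?S\<^sup>2)^m"
    proof (rule power_mono)
      have "1 * ?S\<^sup>2 \<le> 16 * real m / real (n+1) * ?S\<^sup>2"
        using m0 True by (intro mult_right_mono) auto
      then show "?S\<^sup>2 \<le> 16 * real m / real (n+1) * ?S\<^sup>2" by simp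
    qed simp
    finally show ?thesis by simp
  qed
  then show ?thesis
    by (intro exI[of _ "\<lambda>_ _. 0"] allI exI[of _ "\<lambda>_. 0"]) simp
next
  case False
  then have n: "n > 0" by simp
  have m0: "m > 0" using m by simp
  obtain w :: "nat \<Rightarrow> nat \<Rightarrow> real" where w: "\<And>j. j < N \<Longrightarrow> \<exists>c.
    (\<Sum>i<N. ((if i = j then 1 else 0) - (\<Sum>t<n. c t * w t i))^(2*m)) \<le> 4 * real N * (2 * real m / real n)^m"
    using incoherent_columns[OF m n, of N] by blast
  define c where "c j = (SOME c. (\<Sum>i<N. ((if i = j then 1 else 0) - (\<Sum>t<n. c t * w t i))^(2*m))
      \<le> 4 * real N * (2 * real m / real n)^m)" for j
  have c: "(\<Sum>i<N. ((if i = j then 1 else 0) - (\<Sum>t<n. c j t * w t i))^(2*m))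
      \<le> 4 * real N * (2 * real m / real n)^m"
    if "j < N" for j
    using someI_ex[OF w[OF that]] unfolding c_def .
  have "(\<Sum>i<N. (x i - (\<Sum>t<n. (\<Sum>j<N. x j * c j t) * w t i))^(2*m)) / real N
      \<le> (16 * real m / real (n+1) * (\<Sum>j<N. \<bar>x j\<bar>)\<^sup>2)^m" for x
  proof -
    let ?S = "\<Sum>j<N. \<bar>x j\<bar>"
    let ?e = "\<lambda>j i. (if i = j then 1 else 0) - (\<Sum>t<n. c j t * w t i)"
    have S: "?S \<ge> 0" by (simp add: sum_nonneg)
    have eq: "x i - (\<Sum>t<n. (\<Sum>j<N. x j * c j t) * w t i) = (\<Sum>j<N. x j * ?e j i)" if "i < N" for i
    proof -
      have "(\<Sum>j<N. x j * ?e j i) = (\<Sum>j<N. x j * (if i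
          = j then 1 else 0)) - (\<Sum>j<N. x j * (\<Sum>t<n. c j t * w t i))"
        by (simp only: right_diff_distrib sum_subtractf)
      also have "(\<Sum>j<N. x j * (if i = j then 1 else 0)) = x i"
        using that by (simp add: if_distrib[of "\<lambda>z. _ * z"] cong: if_cong)
      also have "(\<Sum>j<N. x j * (\<Sum>t<n. c j t * w t i)) = (\<Sum>t<n. (\<Sum>j<N. x j * c j t) * w t i)"
        unfolding sum_distrib_left sum_distrib_right by (subst sum.swap) (simp add: mult.assoc)
      finally show ?thesis by simp
    qed
    have "(\<Sum>i<N. (x i - (\<Sum>t<n. (\<Sum>j<N. x j * c j t) * w t i))^(2*m)) = (\<Sum>i<N. (\<Sum>j<N. x j * ?e j i)^(2*m))"
      by (intro sum.cong) (simp_all add: eq)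
    also have "\<dots> \<le> (\<Sum>i<N. ?S^(2*m-1) * (\<Sum>j<N. \<bar>x j\<bar> * (?e j i)^(2*m)))"
      by (intro sum_mono weighted_sum_power_le m0) simp
    also have "\<dots> = ?S^(2*m-1) * (\<Sum>i<N. \<Sum>j<N. \<bar>x j\<bar> * (?e j i)^(2*m))"
      by (rule sum_distrib_left[symmetric])
    also have "(\<Sum>i<N. \<Sum>j<N. \<bar>x j\<bar> * (?e j i)^(2*m)) = (\<Sum>j<N. \<Sum>i<N. \<bar>x j\<bar> * (?e j i)^(2*m))"
      by (rule sum.swap)
    also have "\<dots> = (\<Sum>j<N. \<bar>x j\<bar> * (\<Sum>i<N. (?e j i)^(2*m)))"
      by (intro sum.cong refl sum_distrib_left[symmetric])
    also have "?S^(2*m-1) * \<dots> \<le> ?S^(2*m-1) * (\<Sum>j<N. \<bar>x j\<bar> * (4 * real N * (2 * real m / real n)^m))"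
      using S c by (intro mult_left_mono sum_mono) auto
    also have "\<dots> = ?S^(2*m-1) * ?S * (4 * real N * (2 * real m / real n)^m)"
      by (subst sum_distrib_right[symmetric]) (simp only: mult.assoc)
    also have "?S^(2*m-1) * ?S = (?S\<^sup>2)^m"
      using m0 by (cases "2*m") (auto simp: power_mult[symmetric])
    finally have "(\<Sum>i<N. (x i - (\<Sum>t<n. (\<Sum>j<N. x j * c j t) * w t i))^(2*m)) / real N
        \<le> 4 * (2 * real m / real n)^m * (?S\<^sup>2)^m"
      using N by (simp add: divide_le_eq mult_ac)
    also have "\<dots> \<le> 4^m * (4 * real m / real (n+1))^m * (?S\<^sup>2)^m"
    proof (intro mult_mono power_mono)
      show "(4::real) \<le> 4^m" using m0 by (cases m) auto
      show "2 * real m / real n \<le> 4 * real m / real (n+1)" using n m0 by (simp add: field_simps)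
    qed auto
    also have "\<dots> = (16 * real m / real (n+1) * ?S\<^sup>2)^m"
      unfolding power_mult_distrib[symmetric] by simp
    finally show ?thesis .
  qed
  then show ?thesis by (intro exI[of _ w] allI exI[of _ "\<lambda>t. \<Sum>j<N. _ j * c j t"])
qed

section \<open>Dyadic averages\<close>

definition dyadic :: "nat \<Rightarrow> nat \<Rightarrow> real" where
  "dyadic l j = real j / 2^l"

definition davg :: "(real \<Rightarrow> real) \<Rightarrow> nat \<Rightarrow> nat \<Rightarrow> real" where
  "davg f l j = 2^l * integral {dyadic l j..dyadic l (Suc j)} f"

definition dhalf :: "(real \<Rightarrow> real) \<Rightarrow> nat \<Rightarrow> nat \<Rightarrow> real" where
  "dhalf f l j = (davg f (Suc l) (2*j+1) - davg f (Suc l) (2*j)) / 2"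

text \<open>Subtracting half of the parent difference removes affine functions, so that the slopes of
  positive level are controlled by the modulus of smoothness of order two.\<close>

definition dslope :: "(real \<Rightarrow> real) \<Rightarrow> nat \<Rightarrow> nat \<Rightarrow> real" where
  "dslope f l j = (if l = 0 then dhalf f 0 j else dhalf f l j - dhalf f (l - 1) (j div 2) / 2)"

lemma dyadic_le [simp]: "dyadic l i \<le> dyadic l j \<longleftrightarrow> i \<le> j"
  by (simp add: dyadic_def divide_le_cancel)

lemma dyadic_nonneg [simp]: "0 \<le> dyadic l j"
  by (simp add: dyadic_def)

lemma dyadic_Suc_level: "dyadic (Suc l) (2*j) = dyadic l j"
  by (simp add: dyadic_def)

lemma dyadic_le_1: "j \<le> 2^l \<Longrightarrow> dyadic l j \<le> 1"
  by (simp add: dyadic_def divide_le_eq)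

lemma dyadic_Suc: "dyadic l (Suc j) = dyadic l j + 1 / 2^l"
  by (simp add: dyadic_def add_divide_distrib)

lemma dyadic_subset: "j < 2^l \<Longrightarrow> {dyadic l j..dyadic l (Suc j)} \<subseteq> {0..1}"
  using dyadic_le_1[of "Suc j" l] dyadic_nonneg[of l j]
  by (auto intro: order_trans)

lemma dyadic_integrable:
  fixes f :: "real \<Rightarrow> real"
  assumes "f integrable_on {0..1}" "i \<le> j" "j \<le> 2^l"
  shows "f integrable_on {dyadic l i..dyadic l j}"
  using assms dyadic_le_1[of j l] by (intro integrable_on_subinterval[OF assms(1)]) (auto intro: order_trans)

lemma davg_split:
  assumes f: "f integrable_on {0..1}" and j: "j < 2^l"
  shows "davg f l j = (davg f (Suc l) (2*j) + davg f (Suc l) (2*j+1)) / 2"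
proof -
  have "integral {dyadic (Suc l) (2*j)..dyadic (Suc l) (2*j+1)} f
      + integral {dyadic (Suc l) (2*j+1)..dyadic (Suc l) (2*Suc j)} f
      = integral {dyadic (Suc l) (2*j)..dyadic (Suc l) (2*Suc j)} f"
    by (rule Henstock_Kurzweil_Integration.integral_combine) (use j in \<open>auto intro!: dyadic_integrable f\<close>)
  moreover have "2 * Suc j = Suc (2*j+1)" by simp
  ultimately have "integral {dyadic (Suc l) (2*j)..dyadic (Suc l) (Suc (2*j))} f
      + integral {dyadic (Suc l) (2*j+1)..dyadic (Suc l) (Suc (2*j+1))} f
      = integral {dyadic l j..dyadic l (Suc j)} f"
    by (metis Suc_eq_plus1 dyadic_Suc_level)
  then show ?thesis unfolding davg_def
    by (simp add: distrib_left[symmetric] del: mult_Suc_right)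
qed

lemma davg_children:
  assumes "f integrable_on {0..1}" "j < 2^l"
  shows "davg f (Suc l) (2*j) = davg f l j - dhalf f l j \<and> davg f (Suc l) (2*j+1) = davg f l j + dhalf f l j"
  using davg_split[OF assms] by (simp add: dhalf_def field_simps)

lemma davg_diff:
  assumes "f integrable_on {0..1}" "g integrable_on {0..1}" "j < 2^l"
  shows "davg (\<lambda>x. f x - g x) l j = davg f l j - davg g l j"
  using assms unfolding davg_def
  by (subst Henstock_Kurzweil_Integration.integral_diff) (auto intro!: dyadic_integrable simp: right_diff_distrib)

lemma davg_sum:
  assumes "finite I" "\<And>i. i \<in> I \<Longrightarrow> g i integrable_on {0..1}" "j < 2^l"
  shows "davg (\<lambda>x. \<Sum>i\<in>I. c i * g i x) l j = (\<Sum>i\<in>I. c i * davg (g i) l j)"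
proof -
  have "integral {dyadic l j..dyadic l (Suc j)} (\<lambda>x. \<Sum>i\<in>I. c i * g i x)
      = (\<Sum>i\<in>I. integral {dyadic l j..dyadic l (Suc j)} (\<lambda>x. c i * g i x))"
    by (rule integral_sum) (use assms in \<open>auto intro!: integrable_on_mult_right dyadic_integrable\<close>)
  then show ?thesis by (simp add: davg_def sum_distrib_left mult.left_commute)
qed

lemma dhalf_diff:
  assumes "f integrable_on {0..1}" "g integrable_on {0..1}" "j < 2^l"
  shows "dhalf (\<lambda>x. f x - g x) l j = dhalf f l j - dhalf g l j"
  unfolding dhalf_def using assms by (simp add: davg_diff diff_divide_distrib)

lemma dhalf_sum:
  assumes "finite I" "\<And>i. i \<in> I \<Longrightarrow> g i integrable_on {0..1}" "j < 2^l"
  shows "dhalf (\<lambda>x. \<Sum>i\<in>I. c i * g i x) l j = (\<Sum>i\<in>I. c i * dhalf (g i) l j)"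
proof -
  have "2*j+1 < 2^Suc l" "2*j < 2^Suc l" using assms(3) by auto
  then show ?thesis
    unfolding dhalf_def using assms
    by (simp only: davg_sum[OF assms(1,2)]) (simp add: sum_subtractf sum_divide_distrib[symmetric] right_diff_distrib diff_divide_distrib)
qed

lemma dslope_diff:
  assumes "f integrable_on {0..1}" "g integrable_on {0..1}" "j < 2^l"
  shows "dslope (\<lambda>x. f x - g x) l j = dslope f l j - dslope g l j"
proof (cases l)
  case (Suc k)
  then have "j div 2 < 2^k" using assms(3) by auto
  then show ?thesis using assms Suc by (simp add: dslope_def dhalf_diff diff_divide_distrib)
qed (use assms in \<open>simp add: dslope_def dhalf_diff\<close>)

lemma dslope_sum:
  assumes "finite I" "\<And>i. i \<in> I \<Longrightarrow> g i integrable_on {0..1}" "j < 2^l"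
  shows "dslope (\<lambda>x. \<Sum>i\<in>I. c i * g i x) l j = (\<Sum>i\<in>I. c i * dslope (g i) l j)"
proof (cases l)
  case (Suc k)
  then have "j div 2 < 2^k" using assms(3) by auto
  then show ?thesis using assms Suc
    by (simp add: dslope_def dhalf_sum right_diff_distrib sum_subtractf sum_divide_distrib)
qed (use assms in \<open>simp add: dslope_def dhalf_sum\<close>)

section \<open>Dyadic averages and L_q norms\<close>

text \<open>Averages over [x, x+h] converge to g x off a negligible set; the same fact for the
  reflected function gives averages over [x-h, x]. A dyadic interval containing x is cut at x into
  one interval of each kind, and the two errors, each proportional to the length of its piece, add
  up however unevenly the cut falls.\<close>

lemma lebesgue_differentiation_dyadic:
  assumes f: "f integrable_on {0..1::real}"
  obtains N where "negligible N"
    "\<And>x. x \<notin> N \<Longrightarrow> x \<in> {0..<1} \<Longrightarrow> (\<lambda>M. davg f M (nat \<lfloor>2^M * x\<rfloor>)) \<longlonglongrightarrow> f x"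
proof -
  define g where "g x = (if x \<in> {0..1} then f x else 0)" for x
  have gi: "g integrable_on {a..b}" for a b :: real
  proof -
    have "g integrable_on UNIV" unfolding g_def using f integrable_restrict_UNIV by blast
    then show ?thesis by (rule integrable_on_subinterval) simp
  qed
  obtain N1 where N1: "negligible N1" "\<And>x e. x \<notin> N1 \<Longrightarrow> 0 < e \<Longrightarrow>
      \<exists>d>0. \<forall>h. 0 < h \<and> h < d \<longrightarrow> norm (integral {x..x+h} g / h - g x) < e"
    using integrable_ccontinuous_explicit[of g] gi by (auto simp: divide_inverse_commute)
  have gi': "(\<lambda>x. g (-x)) integrable_on {a..b}" for a b :: real
    using gi[of "-b" "-a"] Henstock_Kurzweil_Integration.integrable_reflect_real[where f = g and a = "-b" and b = "-a"] by simp
  obtain N2 where N2: "negligible N2" "\<And>x e. x \<notin> N2 \<Longrightarrow> 0 < e \<Longrightarrow>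
      \<exists>d>0. \<forall>h. 0 < h \<and> h < d \<longrightarrow> norm (integral {x..x+h} (\<lambda>x. g (-x)) / h - g (-x)) < e"
    using integrable_ccontinuous_explicit[of "\<lambda>x. g (-x)"] gi' by (auto simp: divide_inverse_commute)
  have "negligible (N1 \<union> uminus ` N2)"
    by (intro negligible_Un N1 negligible_differentiable_image_negligible N2)
      (auto intro!: differentiable_on_minus differentiable_on_ident)
  moreover have "(\<lambda>M. davg f M (nat \<lfloor>2^M * x\<rfloor>)) \<longlonglongrightarrow> f x"
    if x: "x \<notin> N1 \<union> uminus ` N2" "x \<in> {0..<1}" for x
  proof (rule LIMSEQ_I)
    fix e :: real assume e: "0 < e"
    obtain d1 where d1: "d1 > 0" "\<And>h. 0 < h \<Longrightarrow> h < d1 \<Longrightarrow> \<bar>integral {x..x+h} g / h - g x\<bar> < e/2"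
      using N1(2)[of x "e/2"] x e by auto
    have "- x \<notin> N2" using x by (auto simp: image_iff)
    then obtain d2 where d2: "d2 > 0" "\<And>h. 0 < h \<Longrightarrow> h < d2 \<Longrightarrow>
        \<bar>integral {-x..-x+h} (\<lambda>x. g (-x)) / h - g x\<bar> < e/2"
      using N2(2)[of "-x" "e/2"] e by auto
    have R: "\<bar>integral {x..v} g - (v-x) * g x\<bar> \<le> e/2 * (v-x)" if "x \<le> v" "v - x < d1" for v
    proof (cases "v = x")
      case False
      then have "\<bar>integral {x..x+(v-x)} g / (v-x) - g x\<bar> < e/2" using d1(2)[of "v-x"] that by simp
      moreover have "\<bar>integral {x..v} g - (v-x) * g x\<bar> = (v-x) * \<bar>integral {x..v} g / (v-x) - g x\<bar>"
        using False that by (subst abs_of_pos[of "v-x", symmetric], simp) (simp only: abs_mult[symmetric], simp add: right_diff_distrib)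
      ultimately show ?thesis using that mult_left_mono[of "\<bar>integral {x..v} g / (v-x) - g x\<bar>" "e/2" "v-x"]
        by (simp add: mult.commute)
    qed simp
    have L: "\<bar>integral {u..x} g - (x-u) * g x\<bar> \<le> e/2 * (x-u)" if "u \<le> x" "x - u < d2" for u
    proof (cases "u = x")
      case False
      have "integral {-x..-u} (\<lambda>x. g (-x)) = integral {u..x} g" by (rule Henstock_Kurzweil_Integration.integral_reflect_real)
      then have "\<bar>integral {u..x} g / (x-u) - g x\<bar> < e/2" using d2(2)[of "x-u"] that False by simp
      moreover have "\<bar>integral {u..x} g - (x-u) * g x\<bar> = (x-u) * \<bar>integral {u..x} g / (x-u) - g x\<bar>"
        using False that by (subst abs_of_pos[of "x-u", symmetric], simp) (simp only: abs_mult[symmetric], simp add: right_diff_distrib)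
      ultimately show ?thesis using that mult_left_mono[of "\<bar>integral {u..x} g / (x-u) - g x\<bar>" "e/2" "x-u"]
        by (simp add: mult.commute)
    qed simp
    have "(\<lambda>M. (1/2::real)^M) \<longlonglongrightarrow> 0" by (rule LIMSEQ_power_zero) simp
    then obtain M0 where M0: "\<And>M. M \<ge> M0 \<Longrightarrow> (1/2::real)^M < min d1 d2"
      using LIMSEQ_D[of "\<lambda>M. (1/2::real)^M" 0 "min d1 d2"] d1(1) d2(1) by auto
    show "\<exists>no. \<forall>n\<ge>no. norm (davg f n (nat \<lfloor>2 ^ n * x\<rfloor>) - f x) < e"
    proof (intro exI allI impI)
      fix M assume M: "M0 \<le> M"
      define j where "j = nat \<lfloor>2^M * x\<rfloor>"
      have jr: "real j = of_int \<lfloor>2^M * x\<rfloor>" using x by (simp add: j_def)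
      have jb: "real j \<le> 2^M * x" "2^M * x < real j + 1" unfolding jr by linarith+
      have "2^M * x < 2^M" using x by simp
      then have "real j < 2^M" using jb by linarith
      then have j: "j < 2^M" by (metis of_nat_less_iff of_nat_numeral of_nat_power)
      let ?u = "dyadic M j" and ?v = "dyadic M (Suc j)"
      have uv: "?u \<le> x" "x \<le> ?v" "?v = ?u + (1/2)^M"
        using jb by (auto simp: dyadic_def field_simps)
      have small: "?v - x < d1" "x - ?u < d2" using uv M0[OF M] by auto
      have "integral {?u..?v} f = integral {?u..?v} g"
        using subsetD[OF dyadic_subset[OF j]]
        by (intro Henstock_Kurzweil_Integration.integral_cong) (simp only: g_def if_True)
      also have "\<dots> = integral {?u..x} g + integral {x..?v} g"
        using uv gi by (intro Henstock_Kurzweil_Integration.integral_combine[symmetric]) auto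
      finally have "integral {?u..?v} f - (?v - ?u) * g x
          = (integral {?u..x} g - (x - ?u) * g x) + (integral {x..?v} g - (?v - x) * g x)"
        by (simp add: algebra_simps)
      then have "\<bar>integral {?u..?v} f - (?v - ?u) * g x\<bar> \<le> e/2 * (x - ?u) + e/2 * (?v - x)"
        using L[OF uv(1) small(2)] R[OF uv(2) small(1)] by linarith
      also have "e/2 * (x - ?u) + e/2 * (?v - x) = e/2 * (?v - ?u)"
        by (simp add: algebra_simps diff_divide_distrib)
      finally have "\<bar>integral {?u..?v} f - (?v - ?u) * g x\<bar> \<le> e/2 * (?v - ?u)" .
      then have "\<bar>integral {?u..?v} f - (1/2)^M * g x\<bar> \<le> e/2 * (1/2)^M" using uv by simp
      then have "2^M * \<bar>integral {?u..?v} f - (1/2)^M * g x\<bar> \<le> 2^M * (e/2 * (1/2)^M)"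
        by (intro mult_left_mono) auto
      moreover have "2^M * \<bar>integral {?u..?v} f - (1/2)^M * g x\<bar> = \<bar>davg f M j - g x\<bar>"
        by (subst abs_of_nonneg[of "2^M", symmetric], simp)
          (simp only: abs_mult[symmetric], simp add: davg_def right_diff_distrib power_divide)
      ultimately have "\<bar>davg f M j - g x\<bar> \<le> e/2" by (simp add: power_divide)
      then show "norm (davg f M (nat \<lfloor>2 ^ M * x\<rfloor>) - f x) < e"
        using e x by (simp add: j_def g_def)
    qed
  qed
  ultimately show ?thesis using that by blast
qed

text \<open>The right-hand side is affine in t^p and touches t^q at t = \<mu>. Integrated over a
  probability space it turns the L_p bound \<mu> into the L_q bound \<mu>, so that this pointwise
  consequence of Young's inequality serves as Hoelder's inequality.\<close>

lemma powr_le_affine_powr: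
  fixes t :: real
  assumes "0 \<le> t" "0 < q" "q \<le> p" "0 < \<mu>"
  shows "t powr q \<le> \<mu> powr q * (q/p * (t powr p / \<mu> powr p) + (1 - q/p))"
proof (cases "t = 0")
  case True
  then show ?thesis using assms by (simp add: divide_le_eq)
next
  case False
  have p: "p > 0" using assms by simp
  have "((t/\<mu>) powr p) powr (q/p) * 1 powr (1 - q/p) \<le> q/p * (t/\<mu>) powr p + (1 - q/p) * 1"
    using assms False p by (intro Youngs_inequality_0) (auto simp: divide_le_eq)
  then have "(t/\<mu>) powr q \<le> q/p * (t/\<mu>) powr p + (1 - q/p)"
    using p by (simp add: powr_powr)
  then have "\<mu> powr q * (t/\<mu>) powr q \<le> \<mu> powr q * (q/p * (t/\<mu>) powr p + (1 - q/p))"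
    by (intro mult_left_mono) auto
  then show ?thesis using assms by (simp add: powr_divide)
qed

lemma set_borel_measurable_abs_powr:
  assumes "set_borel_measurable M S f" "0 < p"
  shows "set_borel_measurable M S (\<lambda>x. \<bar>f x\<bar> powr p :: real)"
proof -
  have "(\<lambda>x. \<bar>indicator S x *\<^sub>R f x\<bar> powr p) \<in> borel_measurable M"
    using assms(1) unfolding set_borel_measurable_def by measurable
  also have "(\<lambda>x. \<bar>indicator S x *\<^sub>R f x\<bar> powr p) = (\<lambda>x. indicator S x *\<^sub>R (\<bar>f x\<bar> powr p))"
    using assms(2) by (auto simp: indicator_def)
  finally show ?thesis unfolding set_borel_measurable_def .
qed

text \<open>\<open>Lp_enorm\<close> is infinite off the space, so a bound by a real number includes
  membership. Together with its converse \<open>Lp_enorm_leD\<close>, the lemma translates such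
  bounds into nonnegative integrals, where they can be compared without integrability
  conditions.\<close>

lemma Lp_enorm_leI:
  assumes f: "set_borel_measurable lebesgue S f" and p: "0 < p" and \<mu>: "0 \<le> \<mu>"
    and le: "(\<integral>\<^sup>+ x. ennreal (indicator S x * \<bar>f x\<bar> powr p) \<partial>lebesgue) \<le> ennreal (\<mu> powr p)"
  shows "Lp_mem p S f" "Lp_enorm p S f \<le> ennreal \<mu>"
proof -
  have meas: "(\<lambda>x. indicator S x * \<bar>f x\<bar> powr p) \<in> borel_measurable lebesgue"
    using set_borel_measurable_abs_powr[OF f p] by (simp add: set_borel_measurable_def)
  have int: "integrable lebesgue (\<lambda>x. indicator S x * \<bar>f x\<bar> powr p)"
    using le by (intro integrableI_bounded meas) (auto simp: abs_mult intro: le_less_trans)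
  then show mem: "Lp_mem p S f"
    using f by (simp add: Lp_mem_def set_integrable_def)
  have "(LINT x:S|lebesgue. \<bar>f x\<bar> powr p) = enn2real (\<integral>\<^sup>+ x. ennreal
      (indicator S x * \<bar>f x\<bar> powr p) \<partial>lebesgue)"
    unfolding set_lebesgue_integral_def using meas by (subst integral_eq_nn_integral) auto
  also have "\<dots> \<le> \<mu> powr p"
    using le by (intro enn2real_leI) auto
  finally have I: "(LINT x:S|lebesgue. \<bar>f x\<bar> powr p) \<le> \<mu> powr p" .
  have "(LINT x:S|lebesgue. \<bar>f x\<bar> powr p) powr (1/p) \<le> (\<mu> powr p) powr (1/p)"
    using p by (intro powr_mono2 I) (auto simp: set_lebesgue_integral_def intro!: Bochner_Integration.integral_nonneg)
  also have "\<dots> = \<mu>" using p \<mu> by (simp add: powr_powr)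
  finally show "Lp_enorm p S f \<le> ennreal \<mu>"
    using mem by (simp add: Lp_enorm_def ennreal_leI)
qed

lemma Lp_enorm_leD:
  assumes le: "Lp_enorm p S f \<le> ennreal \<mu>" and p: "0 < p" and \<mu>: "0 \<le> \<mu>"
  shows "Lp_mem p S f" "(\<integral>\<^sup>+ x. ennreal (indicator S x * \<bar>f x\<bar> powr p) \<partial>lebesgue) \<le> ennreal (\<mu> powr p)"
proof -
  show mem: "Lp_mem p S f"
    using le by (auto simp: Lp_enorm_def top_unique split: if_splits)
  have int: "integrable lebesgue (\<lambda>x. indicator S x * \<bar>f x\<bar> powr p)"
    using mem by (simp add: Lp_mem_def set_integrable_def)
  have nn: "(LINT x:S|lebesgue. \<bar>f x\<bar> powr p) \<ge> 0"
    by (auto simp: set_lebesgue_integral_def intro!: Bochner_Integration.integral_nonneg)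
  have "(LINT x:S|lebesgue. \<bar>f x\<bar> powr p) powr (1/p) \<le> \<mu>"
    using le mem \<mu> by (simp add: Lp_enorm_def)
  then have "((LINT x:S|lebesgue. \<bar>f x\<bar> powr p) powr (1/p)) powr p \<le> \<mu> powr p"
    using p by (intro powr_mono2) auto
  then have "(LINT x:S|lebesgue. \<bar>f x\<bar> powr p) \<le> \<mu> powr p"
    using p nn by (simp add: powr_powr)
  moreover have "(\<integral>\<^sup>+ x. ennreal (indicator S x * \<bar>f x\<bar> powr p) \<partial>lebesgue)
      = ennreal (LINT x:S|lebesgue. \<bar>f x\<bar> powr p)"
    unfolding set_lebesgue_integral_def using int by (subst nn_integral_eq_integral) auto
  ultimately show "(\<integral>\<^sup>+ x. ennreal (indicator S x * \<bar>f x\<bar> powr p) \<partial>lebesgue) \<le> ennreal (\<mu> powr p)"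
    by (simp add: ennreal_leI)
qed

lemma Lp_enorm_mono_exponent:
  assumes f: "set_borel_measurable lebesgue {0..1} f" and q: "0 < q" "q \<le> p" and \<mu>: "0 < \<mu>"
    and le: "(\<integral>\<^sup>+ x. ennreal (indicator {0..1} x * \<bar>f x\<bar> powr p) \<partial>lebesgue) \<le> ennreal (\<mu> powr p)"
  shows "Lp_mem q {0..1} f" "Lp_enorm q {0..1} f \<le> ennreal \<mu>"
proof -
  have p: "0 < p" using q by simp
  have [measurable]: "{0..1::real} \<in> sets lebesgue" by simp
  have meas: "(\<lambda>x. indicator {0..1} x * \<bar>f x\<bar> powr p) \<in> borel_measurable lebesgue"
    using set_borel_measurable_abs_powr[OF f p] by (simp add: set_borel_measurable_def)
  define A where "A = \<mu> powr q * (q/p) / \<mu> powr p"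
  define B where "B = \<mu> powr q * (1 - q/p)"
  have AB: "A \<ge> 0" "B \<ge> 0" using q p by (auto simp: A_def B_def)
  have "(\<integral>\<^sup>+ x. ennreal (indicator {0..1} x * \<bar>f x\<bar> powr q) \<partial>lebesgue)
      \<le> (\<integral>\<^sup>+ x. ennreal A * ennreal (indicator {0..1} x * \<bar>f x\<bar> powr p) + ennreal B * indicator {0..1} x \<partial>lebesgue)"
  proof (intro nn_integral_mono)
    fix x :: real
    have "\<bar>f x\<bar> powr q \<le> A * \<bar>f x\<bar> powr p + B"
      using powr_le_affine_powr[of "\<bar>f x\<bar>" q p \<mu>] q \<mu> by (simp add: A_def B_def distrib_left)
    then show "ennreal (indicator {0..1} x * \<bar>f x\<bar> powr q)
        \<le> ennreal A * ennreal (indicator {0..1} x * \<bar>f x\<bar> powr p) + ennreal B * indicator {0..1} x"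
      using AB by (auto simp: indicator_def ennreal_mult'[symmetric] ennreal_plus[symmetric] ennreal_leI simp del: ennreal_plus)
  qed
  also have "\<dots> = ennreal A * (\<integral>\<^sup>+ x. ennreal (indicator {0..1} x * \<bar>f x\<bar> powr p) \<partial>lebesgue) + ennreal B"
    using meas by (subst nn_integral_add) (auto simp: nn_integral_cmult nn_integral_cmult_indicator)
  also have "\<dots> \<le> ennreal A * ennreal (\<mu> powr p) + ennreal B"
    by (intro add_mono mult_left_mono le) auto
  also have "\<dots> = ennreal (A * \<mu> powr p + B)"
    using AB by (simp add: ennreal_mult'[symmetric] ennreal_plus[symmetric] del: ennreal_plus)
  also have "A * \<mu> powr p + B = \<mu> powr q"
    using \<mu> by (simp add: A_def B_def right_diff_distrib)
  finally show "Lp_mem q {0..1} f" "Lp_enorm q {0..1} f \<le> ennreal \<mu>"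
    using Lp_enorm_leI[OF f q(1), of \<mu>] \<mu> by auto
qed

text \<open>The step functions with values \<open>davg f M j\<close> converge to f almost
  everywhere, so Fatou's lemma bounds the integral of |f|^(2m), and the L_q norm follows by
  monotonicity in the exponent.\<close>

lemma Lp_enorm_le_of_dyadic_moments:
  assumes f: "set_integrable lebesgue {0..1} f" and m: "0 < m" and R: "0 < R"
    and q: "0 < q" "q \<le> 2 * real m"
    and mom: "\<And>M. dyadic_moment m M (davg f M) \<le> R^m"
  shows "Lp_enorm q {0..1} f \<le> ennreal (sqrt R)"
proof -
  define F where "F M x = (\<Sum>j<2^M. ennreal ((davg f M j)^(2*m)) * indicator {dyadic M j..<dyadic M
      (Suc j)} x)" for M x
  have fi: "f integrable_on {0..1}" using f by (rule set_lebesgue_integral_eq_integral)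
  have sm: "set_borel_measurable lebesgue {0..1} f"
    using f by (auto simp: set_integrable_def set_borel_measurable_def)
  obtain N where N: "negligible N"
    "\<And>x. x \<notin> N \<Longrightarrow> x \<in> {0..<1} \<Longrightarrow> (\<lambda>M. davg f M (nat \<lfloor>2^M * x\<rfloor>)) \<longlonglongrightarrow> f x"
    using lebesgue_differentiation_dyadic[OF fi] by blast
  have Feq: "F M x = ennreal ((davg f M (nat \<lfloor>2^M * x\<rfloor>))^(2*m))" if x: "x \<in> {0..<1}" for M x
  proof -
    define i where "i = nat \<lfloor>2^M * x\<rfloor>"
    have ir: "real i = of_int \<lfloor>2^M * x\<rfloor>" using x by (simp add: i_def)
    have ib: "real i \<le> 2^M * x" "2^M * x < real i + 1" unfolding ir by linarith+
    have "2^M * x < 2^M" using x by simp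
    then have "real i < 2^M" using ib by linarith
    then have i: "i < 2^M" by (metis of_nat_less_iff of_nat_numeral of_nat_power)
    have ind: "indicator {dyadic M j..<dyadic M (Suc j)} x = (if j = i then 1 else 0 :: ennreal)" for j
    proof -
      have "x \<in> {dyadic M j..<dyadic M (Suc j)} \<longleftrightarrow> real j \<le> 2^M * x \<and> 2^M * x < real j + 1"
        by (simp add: dyadic_def field_simps)
      also have "\<dots> \<longleftrightarrow> j = i" using ib by auto
      finally show ?thesis by (simp add: indicator_def)
    qed
    show ?thesis unfolding F_def ind i_def[symmetric] using i
      by (simp add: if_distrib[of "\<lambda>z. _ * z"] cong: if_cong)
  qed
  \<comment> \<open>The half-open dyadic intervals do not cover the point 1.\<close>
  have "AE x in lebesgue. x \<notin> N \<and> x \<noteq> 1"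
  proof -
    have "negligible (N \<union> {1})" using N by auto
    then show ?thesis using AE_not_in[of "N \<union> {1}" lebesgue] by (simp add: negligible_iff_null_sets)
  qed
  then have "AE x in lebesgue. ennreal (indicator {0..1} x * \<bar>f x\<bar> powr (2 * real m)) \<le> liminf (\<lambda>M. F M x)"
  proof eventually_elim
    case (elim x)
    show ?case
    proof (cases "x \<in> {0..<1}")
      case True
      have "(\<lambda>M. ennreal ((davg f M (nat \<lfloor>2^M * x\<rfloor>))^(2*m))) \<longlonglongrightarrow> ennreal (f x^(2*m))"
        using N(2)[of x] elim True by (intro tendsto_ennrealI tendsto_power) auto
      then have "liminf (\<lambda>M. F M x) = ennreal (f x^(2*m))"
        unfolding Feq[OF True] by (intro lim_imp_Liminf) auto
      moreover have "\<bar>f x\<bar> powr (2 * real m) = f x^(2*m)"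
        using powr_realpow'[of "\<bar>f x\<bar>" "2*m"] m by (simp add: power_even_abs)
      ultimately show ?thesis using True by simp
    next
      case False
      then have "x \<notin> {0..1}" using elim by auto
      then show ?thesis by simp
    qed
  qed
  then have "(\<integral>\<^sup>+ x. ennreal (indicator {0..1} x * \<bar>f x\<bar> powr (2 * real m)) \<partial>lebesgue)
      \<le> (\<integral>\<^sup>+ x. liminf (\<lambda>M. F M x) \<partial>lebesgue)"
    by (rule nn_integral_mono_AE)
  also have "\<dots> \<le> liminf (\<lambda>M. \<integral>\<^sup>+ x. F M x \<partial>lebesgue)"
  proof (intro nn_integral_liminf)
    have [measurable]: "{a..<b::real} \<in> sets lebesgue" for a b by simp
    show "F M \<in> borel_measurable lebesgue" for M unfolding F_def by measurable
  qed
  also have "\<dots> \<le> ennreal (R^m)"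
  proof (rule order.trans[OF Liminf_mono[of _ "\<lambda>_. ennreal (R^m)"]])
    have "(\<integral>\<^sup>+ x. F M x \<partial>lebesgue) = ennreal (dyadic_moment m M (davg f M))" for M
    proof -
      have "(\<integral>\<^sup>+ x. F M x \<partial>lebesgue) = (\<Sum>j<2^M. ennreal ((davg f M j)^(2*m)) * ennreal (1 / 2^M))"
      proof -
        have [measurable]: "{a..<b::real} \<in> sets lebesgue" for a b by simp
        have "(\<integral>\<^sup>+ x. F M x \<partial>lebesgue) = (\<Sum>j<2^M. \<integral>\<^sup>+ x. ennreal
            ((davg f M j)^(2*m)) * indicator {dyadic M j..<dyadic M (Suc j)} x \<partial>lebesgue)"
          unfolding F_def by (rule nn_integral_sum) measurable
        also have "\<dots> = (\<Sum>j<2^M. ennreal ((davg f M j)^(2*m)) * ennreal (1 / 2^M))"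
          by (intro sum.cong refl) (simp add: nn_integral_cmult_indicator dyadic_Suc)
        finally show ?thesis .
      qed
      also have "\<dots> = (\<Sum>j<2^M. ennreal ((davg f M j)^(2*m) / 2^M))"
        by (intro sum.cong refl) (simp add: ennreal_mult'[symmetric])
      also have "\<dots> = ennreal (dyadic_moment m M (davg f M))"
        by (simp add: dyadic_moment_def sum_divide_distrib)
      finally show ?thesis .
    qed
    then show "\<forall>\<^sub>F M in sequentially. (\<integral>\<^sup>+ x. F M x \<partial>lebesgue) \<le> ennreal (R^m)"
      using mom by (simp add: ennreal_leI)
  qed (simp add: Liminf_const)
  also have "R^m = sqrt R powr (2 * real m)"
    using R powr_realpow[of "sqrt R" "2*m"] by (simp add: power_mult)
  finally show ?thesis
    using Lp_enorm_mono_exponent[OF sm q, of "sqrt R"] R by simp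
qed

lemma Lp_mem_1_iff: "Lp_mem 1 S f \<longleftrightarrow> set_integrable lebesgue S f"
proof
  assume "Lp_mem 1 S f"
  then show "set_integrable lebesgue S f"
    using set_integrable_abs_iff[of lebesgue S f] by (simp add: Lp_mem_def)
next
  assume f: "set_integrable lebesgue S f"
  then have "set_borel_measurable lebesgue S f"
    by (auto simp: set_integrable_def set_borel_measurable_def)
  then show "Lp_mem 1 S f"
    using set_integrable_abs_iff[of lebesgue S f] f by (simp add: Lp_mem_def)
qed

lemma abs_powr_2: "\<bar>x::real\<bar> powr 2 = x\<^sup>2"
  by (cases "x = 0") (auto simp: powr_numeral)

lemma Lp_enorm_le_imp_integrable:
  assumes q: "1 \<le> q" and e: "0 < e" and le: "Lp_enorm q {0..1} f \<le> ennreal e"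
  shows "set_integrable lebesgue {0..1} f"
proof -
  have q0: "0 < q" using q by simp
  note D = Lp_enorm_leD[OF le q0 less_imp_le[OF e]]
  have sm: "set_borel_measurable lebesgue {0..1} f" using D(1) by (simp add: Lp_mem_def)
  show ?thesis
    using Lp_enorm_mono_exponent(1)[OF sm _ q e D(2)] by (simp add: Lp_mem_1_iff)
qed

text \<open>Hoelder's inequality on an interval of measure 2^(-l). The factor 2^(l/q) is the price
  of testing by the average over one cell; it decides how fine the levels in the lower bound may
  be.\<close>

lemma Lp_enorm_dyadic_average:
  assumes q: "1 \<le> q" and e: "0 < e" and le: "Lp_enorm q {0..1} f \<le> ennreal e" and j: "j < 2^l"
  shows "\<bar>davg f l j\<bar> \<le> 2 powr (real l / q) * e"
proof -
  have q0: "0 < q" using q by simp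
  note D = Lp_enorm_leD[OF le q0 less_imp_le[OF e]]
  let ?I = "{dyadic l j..dyadic l (Suc j)}"
  \<comment> \<open>The constant \<mu> on a cell of length 2^(-l) has L_q norm e; at this value the
    affine bound of \<open>powr_le_affine_powr\<close> is an equality.\<close>
  define \<mu> where "\<mu> = 2 powr (real l / q) * e"
  have \<mu>: "\<mu> > 0" using e by (simp add: \<mu>_def)
  have fint: "set_integrable lebesgue {0..1} f" by (rule Lp_enorm_le_imp_integrable[OF q e le])
  have fI: "set_integrable lebesgue ?I f"
    by (rule set_integrable_subset[OF fint]) (use dyadic_subset[OF j] in auto)
  have meas: "(\<lambda>x. indicator {0..1} x * \<bar>f x\<bar> powr q) \<in> borel_measurable lebesgue"
    using set_borel_measurable_abs_powr[of lebesgue "{0..1}" f q] D(1) q0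
    by (simp add: set_borel_measurable_def Lp_mem_def)
  have [measurable]: "?I \<in> sets lebesgue" by simp
  define A where "A = \<mu> * (1/q) / \<mu> powr q"
  define B where "B = \<mu> * (1 - 1/q)"
  have AB: "A \<ge> 0" "B \<ge> 0" using q \<mu> by (auto simp: A_def B_def)
  have "ennreal (LINT x:?I|lebesgue. \<bar>f x\<bar>) = (\<integral>\<^sup>+ x. ennreal (indicator ?I x * \<bar>f x\<bar>) \<partial>lebesgue)"
    using set_integrable_abs[OF fI] unfolding set_lebesgue_integral_def set_integrable_def
    by (subst nn_integral_eq_integral) auto
  also have "\<dots> \<le> (\<integral>\<^sup>+ x. ennreal A * ennreal (indicator {0..1} x * \<bar>f x\<bar> powr q)
      + ennreal B * indicator ?I x \<partial>lebesgue)"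
  proof (intro nn_integral_mono)
    fix x :: real
    have "\<bar>f x\<bar> \<le> A * \<bar>f x\<bar> powr q + B"
      using powr_le_affine_powr[of "\<bar>f x\<bar>" 1 q \<mu>] q \<mu> by (simp add: A_def B_def distrib_left)
    moreover have "x \<in> ?I \<Longrightarrow> x \<in> {0..1}" using subsetD[OF dyadic_subset[OF j]] by blast
    ultimately show "ennreal (indicator ?I x * \<bar>f x\<bar>)
        \<le> ennreal A * ennreal (indicator {0..1} x * \<bar>f x\<bar> powr q) + ennreal B * indicator ?I x"
      using AB by (cases "x \<in> ?I") (auto simp: ennreal_mult'[symmetric] ennreal_plus[symmetric] ennreal_leI simp del: ennreal_plus)
  qed
  also have "\<dots> = ennreal A * (\<integral>\<^sup>+ x. ennreal (indicator {0..1} x * \<bar>f x\<bar> powr q) \<partial>lebesgue)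
      + ennreal B * ennreal (1 / 2^l)"
  proof -
    have "(\<lambda>x. ennreal B * indicator ?I x) \<in> borel_measurable lebesgue" by measurable
    moreover have "emeasure lebesgue ?I = ennreal (1 / 2^l)" by (simp add: dyadic_Suc)
    ultimately show ?thesis
      using meas by (subst nn_integral_add) (auto simp: nn_integral_cmult nn_integral_cmult_indicator simp del: emeasure_lborel_Icc emeasure_completion)
  qed
  also have "\<dots> \<le> ennreal A * ennreal (e powr q) + ennreal B * ennreal (1/2^l)"
    by (intro add_mono mult_left_mono D(2)) auto
  also have "\<dots> = ennreal (A * e powr q + B * (1/2^l))"
    using AB by (simp add: ennreal_mult'[symmetric] ennreal_plus[symmetric] del: ennreal_plus)
  also have "A * e powr q + B * (1/2^l) = \<mu> / 2^l"
  proof -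
    have "\<mu> powr q = 2^l * e powr q"
      using e q0 by (simp add: \<mu>_def powr_mult powr_powr powr_realpow)
    then have "A * e powr q = \<mu> * (1/q) / 2^l" using e by (simp add: A_def)
    then show ?thesis by (simp add: B_def right_diff_distrib diff_divide_distrib)
  qed
  finally have "(LINT x:?I|lebesgue. \<bar>f x\<bar>) \<le> \<mu> / 2^l"
    using \<mu> by simp
  moreover have "\<bar>integral ?I f\<bar> \<le> (LINT x:?I|lebesgue. \<bar>f x\<bar>)"
    using set_integral_norm_bound[OF fI] set_lebesgue_integral_eq_integral(2)[OF fI] by simp
  ultimately have "\<bar>integral ?I f\<bar> \<le> \<mu> / 2^l" by simp
  then show ?thesis
    by (simp add: davg_def abs_mult \<mu>_def field_simps)
qed

lemma sum_dyadic_integrals: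
  fixes f :: "real \<Rightarrow> real"
  assumes f: "f integrable_on {0..dyadic l k}"
  shows "(\<Sum>j<k. integral {dyadic l j..dyadic l (Suc j)} f) = integral {0..dyadic l k} f"
  using f
proof (induction k)
  case 0
  then show ?case by (simp add: dyadic_def)
next
  case (Suc k)
  have "integral {dyadic l 0..dyadic l k} f + integral {dyadic l k..dyadic l (Suc k)} f
      = integral {dyadic l 0..dyadic l (Suc k)} f"
    by (rule Henstock_Kurzweil_Integration.integral_combine) (use Suc.prems in \<open>auto simp: dyadic_def divide_right_mono\<close>)
  moreover have "f integrable_on {0..dyadic l k}"
    by (rule integrable_on_subinterval[OF Suc.prems]) auto
  ultimately show ?case using Suc.IH by (simp add: dyadic_def)
qed

text \<open>Averaging over cells is an L_2 contraction, and on [0,1] the L_2 norm is at most the L_q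
  norm when q \<ge> 2.\<close>

lemma Lp_enorm_dyadic_L2:
  assumes q: "2 \<le> q" and e: "0 < e" and le: "Lp_enorm q {0..1} f \<le> ennreal e"
  shows "(\<Sum>j<2^l. (davg f l j)\<^sup>2) \<le> 2^l * e\<^sup>2"
proof -
  have q0: "0 < q" "1 \<le> q" using q by auto
  note D = Lp_enorm_leD[OF le q0(1) less_imp_le[OF e]]
  have fint: "set_integrable lebesgue {0..1} f" by (rule Lp_enorm_le_imp_integrable[OF q0(2) e le])
  then have fi: "f integrable_on {0..1}" by (rule set_lebesgue_integral_eq_integral)
  have sm: "set_borel_measurable lebesgue {0..1} f" using D(1) by (simp add: Lp_mem_def)
  have L2: "Lp_enorm 2 {0..1} f \<le> ennreal e"
    using Lp_enorm_mono_exponent(2)[OF sm _ q e D(2)] by simp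
  have mem2: "Lp_mem 2 {0..1} f" using Lp_enorm_leD(1)[OF L2] e by simp
  have f2: "set_integrable lebesgue {0..1} (\<lambda>x. (f x)\<^sup>2)"
    using mem2 by (simp add: Lp_mem_def abs_powr_2)
  then have f2i: "(\<lambda>x. (f x)\<^sup>2) integrable_on {0..1}" by (rule set_lebesgue_integral_eq_integral)
  have "ennreal (integral {0..1} (\<lambda>x. (f x)\<^sup>2)) = (\<integral>\<^sup>+ x. ennreal
      (indicator {0..1} x * \<bar>f x\<bar> powr 2) \<partial>lebesgue)"
    using f2 unfolding set_lebesgue_integral_eq_integral(2)[OF f2, symmetric] set_lebesgue_integral_def set_integrable_def
    by (subst nn_integral_eq_integral) (auto simp: abs_powr_2)
  also have "\<dots> \<le> ennreal (e\<^sup>2)"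
    using Lp_enorm_leD(2)[OF L2] e by (simp add: powr_numeral)
  finally have tot: "integral {0..1} (\<lambda>x. (f x)\<^sup>2) \<le> e\<^sup>2" by simp
  have "(davg f l j)\<^sup>2 / 2^l \<le> integral {dyadic l j..dyadic l (Suc j)} (\<lambda>x. (f x)\<^sup>2)" if j: "j < 2^l" for j
  proof -
    let ?I = "{dyadic l j..dyadic l (Suc j)}"
    let ?a = "davg f l j"
    have i1: "f integrable_on ?I" "(\<lambda>x. (f x)\<^sup>2) integrable_on ?I"
      using j by (auto intro!: dyadic_integrable fi f2i)
    \<comment> \<open>Integrating 2 a f - a^2 \<le> f^2, with a the mean of f over the cell, gives
      Jensen's inequality for the square.\<close>
    have hi: "((\<lambda>x. 2 * ?a * f x - ?a\<^sup>2) has_integral (2 * ?a * integral ?I f - ?a\<^sup>2 * (1/2^l))) ?I"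
      using has_integral_diff[OF has_integral_mult_right[OF integrable_integral[OF i1(1)], of "2 * ?a"]
          has_integral_const_real[of "?a\<^sup>2" "dyadic l j" "dyadic l (Suc j)"]]
      by (simp add: dyadic_Suc mult.commute)
    have "2 * ?a * integral ?I f - ?a\<^sup>2 * (1/2^l) \<le> integral ?I (\<lambda>x. (f x)\<^sup>2)"
      by (rule has_integral_le[OF hi integrable_integral[OF i1(2)]])
        (use sum_squares_bound[of ?a] in \<open>auto simp: algebra_simps power2_eq_square\<close>)
    moreover have "2 * ?a * integral ?I f - ?a\<^sup>2 * (1/2^l) = ?a\<^sup>2 / 2^l"
    proof -
      have "integral ?I f = ?a / 2^l" by (simp add: davg_def)
      then show ?thesis by (simp add: power2_eq_square)
    qed
    ultimately show ?thesis by simp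
  qed
  then have "(\<Sum>j<2^l. (davg f l j)\<^sup>2 / 2^l) \<le> (\<Sum>j<2^l. integral {dyadic l j..dyadic l (Suc j)} (\<lambda>x. (f x)\<^sup>2))"
    by (intro sum_mono) auto
  also have "\<dots> = integral {0..1} (\<lambda>x. (f x)\<^sup>2)"
    using sum_dyadic_integrals[of "\<lambda>x. (f x)\<^sup>2" l "2^l"] f2i by (simp add: dyadic_def)
  finally have "(\<Sum>j<2^l. (davg f l j)\<^sup>2) / 2^l \<le> e\<^sup>2"
    using tot by (simp add: sum_divide_distrib)
  then show ?thesis by (simp add: divide_le_eq mult.commute)
qed

section \<open>Slopes\<close>

text \<open>The linear function with mean zero on one dyadic interval, scaled so that its averages
  over the two halves are -1 and 1. It is to \<open>dslope\<close> what a Haar function is to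
  \<open>dhalf\<close>.\<close>

definition sawtooth :: "nat \<Rightarrow> nat \<Rightarrow> real \<Rightarrow> real" where
  "sawtooth l j x = (if x \<in> {dyadic l j..<dyadic l (Suc j)}
     then 2^(l+2) * (x - (dyadic l j + dyadic l (Suc j)) / 2) else 0)"

lemma sawtooth_has_integral_inside:
  assumes "dyadic l j \<le> u" "u \<le> v" "v \<le> dyadic l (Suc j)"
  defines "c \<equiv> (dyadic l j + dyadic l (Suc j)) / 2"
  shows "(sawtooth l j has_integral 2^(l+1) * ((v-c)\<^sup>2 - (u-c)\<^sup>2)) {u..v}"
proof -
  have "((\<lambda>x. 2^(l+2) * (x - c)) has_integral (2^(l+1) * (v-c)\<^sup>2 - 2^(l+1) * (u-c)\<^sup>2)) {u..v}"
    by (rule fundamental_theorem_of_calculus[OF assms(2)])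
      (auto intro!: derivative_eq_intros simp flip: has_real_derivative_iff_has_vector_derivative)
  then have "(sawtooth l j has_integral (2^(l+1) * (v-c)\<^sup>2 - 2^(l+1) * (u-c)\<^sup>2)) {u..v}"
    by (rule has_integral_spike_finite[of "{dyadic l (Suc j)}", rotated 2])
      (use assms in \<open>auto simp: sawtooth_def\<close>)
  then show ?thesis by (simp add: right_diff_distrib)
qed

lemma sawtooth_has_integral_outside:
  assumes "v \<le> dyadic l j \<or> dyadic l (Suc j) \<le> u"
  shows "(sawtooth l j has_integral 0) {u..v}"
  by (rule has_integral_spike_finite[of "{dyadic l j}" _ _ "\<lambda>_. 0"])
    (use assms in \<open>auto simp: sawtooth_def\<close>)

lemma sawtooth_has_integral_around:
  assumes "u \<le> dyadic l j" "dyadic l (Suc j) \<le> v"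
  shows "(sawtooth l j has_integral 0) {u..v}"
proof -
  let ?a = "dyadic l j" and ?b = "dyadic l (Suc j)"
  have ab: "?a \<le> ?b" by simp
  have "(sawtooth l j has_integral 0) {?a..?b}"
    using sawtooth_has_integral_inside[of l j ?a ?b] ab by (simp add: power2_eq_square field_simps)
  from has_integral_combine[OF assms(1) _ sawtooth_has_integral_outside this] ab
  have "(sawtooth l j has_integral 0) {u..?b}" by simp
  from has_integral_combine[OF _ assms(2) this sawtooth_has_integral_outside] ab assms
  show ?thesis by simp
qed

lemma sawtooth_measurable: "sawtooth l j \<in> borel_measurable borel"
  and sawtooth_bounded: "\<bar>sawtooth l j x\<bar> \<le> 2"
proof -
  have "sawtooth l j = (\<lambda>x. indicator {dyadic l j..<dyadic l (Suc j)} x * (2^(l+2) * (x - (dyadic l j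
      + dyadic l (Suc j)) / 2)))"
    by (auto simp: sawtooth_def fun_eq_iff)
  then show "sawtooth l j \<in> borel_measurable borel" by simp
  have "\<bar>x - (dyadic l j + dyadic l (Suc j)) / 2\<bar> \<le> 1 / 2^(l+1)" if "x \<in> {dyadic l j..<dyadic l (Suc j)}"
    using that by (auto simp: dyadic_Suc abs_le_iff field_simps)
  then have "2^(l+2) * \<bar>x - (dyadic l j + dyadic l (Suc j)) / 2\<bar> \<le> 2^(l+2) * (1 / 2^(l+1))"
    if "x \<in> {dyadic l j..<dyadic l (Suc j)}" using that by (intro mult_left_mono) auto
  then show "\<bar>sawtooth l j x\<bar> \<le> 2" by (auto simp: sawtooth_def abs_mult)
qed

lemma sawtooth_integrable: "sawtooth l j absolutely_integrable_on {0..1}"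
proof (rule measurable_bounded_by_integrable_imp_absolutely_integrable[where g = "\<lambda>_. 2"])
  show "sawtooth l j \<in> borel_measurable (lebesgue_on {0..1})"
    using sawtooth_measurable by (simp add: measurable_completion measurable_restrict_space1)
qed (auto simp: sawtooth_bounded)

lemma davg_sawtooth_coarse:
  assumes "M \<le> l"
  shows "davg (sawtooth l j) M i = 0"
proof -
  define k where "k = (2::nat)^(l-M)"
  have p: "(2::real)^l = 2^M * real k"
    using assms by (simp add: k_def flip: power_add)
  have k0: "k > 0" by (simp add: k_def)
  have e: "dyadic M i' = dyadic l (k*i')" for i'
    using k0 by (simp add: dyadic_def p)
  have "(sawtooth l j has_integral 0) {dyadic M i..dyadic M (Suc i)}"
  proof (cases "k * i \<le> j \<and> Suc j \<le> k * Suc i")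
    case True
    then show ?thesis unfolding e by (intro sawtooth_has_integral_around) (simp_all only: dyadic_le)
  next
    case False
    have "k * Suc i \<le> j \<or> Suc j \<le> k * i" using False by linarith
    then show ?thesis unfolding e by (intro sawtooth_has_integral_outside) (simp only: dyadic_le)
  qed
  then show ?thesis by (simp add: davg_def integral_unique)
qed

lemma dhalf_sawtooth_fine:
  assumes "l \<le> M"
  shows "dhalf (sawtooth l j) M i = (if i div 2^(M-l) = j then 1 / 2^(M-l) else 0)"
proof -
  define k where "k = (2::nat)^(M-l)"
  have p: "(2::real)^M = 2^l * real k"
    using assms by (simp add: k_def flip: power_add)
  have k0: "k > 0" by (simp add: k_def)
  have e: "dyadic l j' = dyadic (Suc M) (2*(k*j'))" for j'
    using k0 by (simp add: dyadic_def p)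
  show ?thesis
  proof (cases "i div k = j")
    case True
    define c where "c = (dyadic l j + dyadic l (Suc j)) / 2"
    let ?u = "dyadic (Suc M) (2*i)" and ?w = "dyadic (Suc M) (2*i+1)" and ?v = "dyadic (Suc M) (Suc (2*i+1))"
    have "k * j \<le> i" "i < k * Suc j"
      using True k0 by (auto simp: dividend_less_times_div mult.commute)
    then have in': "dyadic l j \<le> ?u" "?v \<le> dyadic l (Suc j)" unfolding e dyadic_le by auto
    have uwv: "?w = ?u + 1 / 2^Suc M" "?v = ?u + 2 / 2^Suc M" by (simp_all add: dyadic_def add_divide_distrib)
    have uw: "?u \<le> ?w" "?w \<le> ?v" by simp_all
    have I1: "integral {?u..?w} (sawtooth l j) = 2^(l+1) * ((?w-c)\<^sup>2 - (?u-c)\<^sup>2)"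
      unfolding c_def by (intro integral_unique sawtooth_has_integral_inside) (use in' uw in linarith)+
    have I2: "integral {?w..?v} (sawtooth l j) = 2^(l+1) * ((?v-c)\<^sup>2 - (?w-c)\<^sup>2)"
      unfolding c_def by (intro integral_unique sawtooth_has_integral_inside) (use in' uw in linarith)+
    have "dhalf (sawtooth l j) M i = (2^Suc M * integral {?w..?v} (sawtooth l j)
        - 2^Suc M * integral {?u..?w} (sawtooth l j)) / 2"
      by (simp add: dhalf_def davg_def)
    also have "\<dots> = 2^M * 2^(l+1) * ((?v-c)\<^sup>2 - 2 * (?w-c)\<^sup>2 + (?u-c)\<^sup>2)"
      unfolding I1 I2 power_Suc by (simp add: algebra_simps diff_divide_distrib add_divide_distrib)
    also have "(?v-c)\<^sup>2 - 2 * (?w-c)\<^sup>2 + (?u-c)\<^sup>2 = 2 * (1 / 2^Suc M)\<^sup>2"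
      unfolding uwv by (simp add: power2_eq_square algebra_simps add_divide_distrib)
    also have "2^M * 2^(l+1) * (2 * (1 / 2^Suc M)\<^sup>2) = 2^l / (2::real)^M"
      by (simp add: power2_eq_square)
    also have "\<dots> = 1 / real k" by (simp add: p)
    finally show ?thesis using True by (simp add: k_def)
  next
    case False
    have "\<not> (k * j \<le> i \<and> i < k * Suc j)"
    proof
      assume a: "k * j \<le> i \<and> i < k * Suc j"
      then have "i div k = j" by (intro div_nat_eqI) (auto simp: mult.commute)
      with False show False by simp
    qed
    then have out: "i < k * j \<or> k * Suc j \<le> i" by linarith
    have "(sawtooth l j has_integral 0) {dyadic (Suc M) (2*i+b)..dyadic (Suc M) (Suc (2*i+b))}" if "b
        \<le> 1" for b
    proof -
      have "Suc (2*i+b) \<le> 2*(k*j) \<or> 2*(k*Suc j) \<le> 2*i+b" using out that by linarith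
      then show ?thesis
        by (intro sawtooth_has_integral_outside) (simp only: e dyadic_le)
    qed
    from this[of 0] this[of 1] show ?thesis
      using False by (simp add: dhalf_def davg_def integral_unique k_def)
  qed
qed

lemma dhalf_sawtooth_coarse: "M < l \<Longrightarrow> dhalf (sawtooth l j) M i = 0"
  by (simp add: dhalf_def davg_sawtooth_coarse)

text \<open>Biorthogonality. The vanishing mean kills all coarser levels; on finer levels the
  half-difference of a linear function is halved at each refinement, which is exactly what
  \<open>dslope\<close> subtracts.\<close>

lemma dslope_sawtooth:
  "dslope (sawtooth l j) M i = (if M = l \<and> i = j then 1 else 0)"
proof -
  consider "M < l" | "M = l" | "M > l" by linarith
  then show ?thesis
  proof cases
    case 1
    then show ?thesis by (simp add: dslope_def dhalf_sawtooth_coarse)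
  next
    case 2
    then show ?thesis
      by (cases "l = 0") (auto simp: dslope_def dhalf_sawtooth_coarse dhalf_sawtooth_fine)
  next
    case 3
    then have "M - l = Suc (M - 1 - l)" by simp
    moreover have "i div 2^Suc n = i div 2 div 2^n" for n
      by (simp add: div_mult2_eq)
    ultimately show ?thesis using 3
      by (simp add: dslope_def dhalf_sawtooth_fine)
  qed
qed

text \<open>y is the convolution of x with the powers of 1/2, whose l_1 norm is 2, so Young's
  convolution inequality predicts the factor 4 for the squares.\<close>

lemma sum_square_geometric_convolution:
  fixes x y :: "nat \<Rightarrow> real"
  assumes "y 0 = x 0" "\<And>l. y (Suc l) = x (Suc l) + y l / 2"
  shows "(\<Sum>l<M. (y l)\<^sup>2) \<le> 4 * (\<Sum>l<M. (x l)\<^sup>2)"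
proof -
  \<comment> \<open>The last square is counted twice so that it can pay for the next one: with M =
    k+1, 2 (y M)^2 \<le> (y k)^2 + 4 (x M)^2.\<close>
  have "(\<Sum>l<M. (y l)\<^sup>2) + (if M = 0 then 0 else (y (M-1))\<^sup>2) \<le> 4 * (\<Sum>l<M. (x l)\<^sup>2)"
  proof (induction M)
    case (Suc M)
    show ?case
    proof (cases M)
      case 0
      then show ?thesis using assms by simp
    next
      case (Suc k)
      have "2 * (y M)\<^sup>2 \<le> (y k)\<^sup>2 + 4 * (x M)\<^sup>2"
        using sum_squares_bound[of "x M" "y k / 2"] sum_power2_ge_zero[of "x M
            - y k / 2" 0] assms(2)[of k] Suc
        by (simp add: power2_eq_square algebra_simps)
      then show ?thesis using Suc.IH Suc by simp
    qed
  qed simp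
  then show ?thesis by (auto split: if_splits intro: order_trans[rotated])
qed

text \<open>Half-differences are recovered from slopes by adding half of the parent's
  half-difference, so their norms obey y_(l+1) = x_(l+1) + y_l / 2. This convolution costs a factor
  4 and the tree inequality a factor 2m, together 8m.\<close>

lemma Lp_enorm_le_of_slopes:
  assumes E: "set_integrable lebesgue {0..1} E" and m: "m = 2^s" and q: "0 < q" "q \<le> 2 * real m"
    and E0: "davg E 0 0 = 0" and x0: "\<And>l. 0 \<le> x l"
    and x: "\<And>l. dyadic_moment m l (dslope E l) \<le> ((x l)\<^sup>2)^m"
    and X: "0 < X" "\<And>M. (\<Sum>l<M. (x l)\<^sup>2) \<le> X"
  shows "Lp_enorm q {0..1} E \<le> ennreal (sqrt (8 * real m * X))"
proof -
  have m0: "m > 0" using m by simp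
  have Ei: "E integrable_on {0..1}" using E by (rule set_lebesgue_integral_eq_integral)
  define y where "y = rec_nat (x 0) (\<lambda>l z. x (Suc l) + z / 2)"
  have y: "y 0 = x 0" "\<And>l. y (Suc l) = x (Suc l) + y l / 2" by (simp_all add: y_def)
  have y0: "0 \<le> y l" for l by (induction l) (auto simp: y x0)
  have mom: "dyadic_moment m l (dhalf E l) \<le> ((y l)\<^sup>2)^m" for l
  proof (induction l)
    case 0
    have "dhalf E 0 = dslope E 0" by (auto simp: dslope_def)
    then show ?case using x[of 0] by (simp add: y)
  next
    case (Suc l)
    have "dyadic_moment m (Suc l) (\<lambda>j. dslope E (Suc l) j + (1/2) * dhalf E l (j div 2))
        \<le> ((x (Suc l) + y l / 2)\<^sup>2)^m"
    proof (rule dyadic_moment_add[OF x0 _ m0 x])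
      show "0 \<le> y l / 2" using y0 by simp
      have "dyadic_moment m (Suc l) (\<lambda>j. (1/2) * dhalf E l (j div 2))
          = ((1/2)\<^sup>2)^m * dyadic_moment m l (dhalf E l)"
        by (simp only: dyadic_moment_scale dyadic_moment_refine)
      also have "\<dots> \<le> ((1/2)\<^sup>2)^m * ((y l)\<^sup>2)^m" by (intro mult_left_mono Suc) simp
      also have "\<dots> = ((y l / 2)\<^sup>2)^m" by (simp only: power_mult_distrib[symmetric]) simp
      finally show "dyadic_moment m (Suc l) (\<lambda>j. (1/2) * dhalf E l (j div 2)) \<le> ((y l / 2)\<^sup>2)^m" .
    qed
    moreover have "(\<lambda>j. dslope E (Suc l) j + (1/2) * dhalf E l (j div 2)) = dhalf E (Suc l)"
      by (auto simp: dslope_def)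
    ultimately show ?case by (simp add: y)
  qed
  have "dyadic_moment m M (davg E M) \<le> (8 * real m * X)^m" for M
  proof -
    have "dyadic_moment m M (davg E M) \<le> (2 * real m * (\<Sum>l<M. (y l)\<^sup>2))^m"
      by (rule dyadic_moment_tree[OF m, where a = "davg E" and d = "dhalf E"])
        (use E0 davg_children[OF Ei] in \<open>auto intro: mom\<close>)
    also have "\<dots> \<le> (8 * real m * X)^m"
    proof (rule power_mono)
      have "(\<Sum>l<M. (y l)\<^sup>2) \<le> 4 * X"
        using sum_square_geometric_convolution[OF y, of M] X(2)[of M] by linarith
      then have "2 * real m * (\<Sum>l<M. (y l)\<^sup>2) \<le> 2 * real m * (4 * X)" by (intro mult_left_mono) auto
      then show "2 * real m * (\<Sum>l<M. (y l)\<^sup>2) \<le> 8 * real m * X" by simp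
    qed (simp add: sum_nonneg)
    finally show ?thesis .
  qed
  then show ?thesis
    using Lp_enorm_le_of_dyadic_moments[OF E m0 _ q] m0 X(1) by simp
qed

section \<open>Slopes, second differences and the Besov norm\<close>

lemma absolutely_integrable_shift:
  fixes f :: "real \<Rightarrow> real"
  assumes "f absolutely_integrable_on {a..b}"
  shows "(\<lambda>x. f (x + c)) absolutely_integrable_on {a-c..b-c}"
  using assms integrable_shift_real_ivl[of f a b c] integrable_shift_real_ivl[of "\<lambda>x. norm (f x)" a b c]
  unfolding absolutely_integrable_on_def by simp

lemma fwd_diff_2: "fwd_diff 2 h f x = f x - 2 * f (x + h) + f (x + 2 * h)"
  by (simp add: fwd_diff_def numeral_2_eq_2 algebra_simps)

lemma fwd_diff_2_absolutely_integrable: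
  assumes f: "f absolutely_integrable_on {0..1}" and h: "0 \<le> h"
  shows "fwd_diff 2 h f absolutely_integrable_on {0..1-2*h}"
proof -
  have *: "(\<lambda>x. f (x + c)) absolutely_integrable_on {0..1-2*h}" if "0 \<le> c" "c \<le> 2*h" for c
    by (rule set_integrable_subset[OF absolutely_integrable_shift[OF f, of c]]) (use that in auto)
  have "(\<lambda>x. f (x + 0) - 2 * f (x + h) + f (x + 2*h)) absolutely_integrable_on {0..1-2*h}"
    by (intro set_integral_add(1) set_integral_diff(1) set_integrable_mult_right *) (use h in auto)
  moreover have "fwd_diff 2 h f = (\<lambda>x. f (x + 0) - 2 * f (x + h) + f (x + 2*h))"
    by (auto simp: fwd_diff_2)
  ultimately show ?thesis by simp
qed

lemma davg_second_difference:
  assumes f: "f integrable_on {0..1}" and i: "i + 2 < 2^L"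
  shows "davg f L i - 2 * davg f L (i+1) + davg f L (i+2)
    = 2^L * integral {dyadic L i..dyadic L (Suc i)} (fwd_diff 2 (1/2^L) f)"
proof -
  let ?u = "dyadic L i" and ?v = "dyadic L (Suc i)" and ?h = "1/2^L :: real"
  have sh: "((\<lambda>x. f (x + real k * ?h)) has_integral davg f L (i+k) / 2^L) {?u..?v}" if "k \<le> 2" for k
  proof -
    have "f integrable_on {dyadic L (i+k)..dyadic L (Suc (i+k))}"
      by (rule dyadic_integrable[OF f]) (use i that in auto)
    then have "(f has_integral davg f L (i+k) / 2^L) {dyadic L (i+k)..dyadic L (Suc (i+k))}"
      by (simp add: davg_def integrable_integral)
    from has_integral_shift_real_ivl[OF this, of "real k * ?h"] show ?thesis
      by (simp add: dyadic_def add_divide_distrib diff_divide_distrib)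
  qed
  have "((\<lambda>x. f (x + real 0 * ?h) - 2 * f (x + real 1 * ?h) + f (x + real 2 * ?h)) has_integral
      (davg f L (i+0) / 2^L - 2 * (davg f L (i+1) / 2^L) + davg f L (i+2) / 2^L)) {?u..?v}"
    by (intro has_integral_add has_integral_diff has_integral_mult_right sh) auto
  moreover have "fwd_diff 2 ?h f = (\<lambda>x. f (x + real 0 * ?h) - 2 * f (x + real 1 * ?h) + f (x + real 2 * ?h))"
    by (auto simp: fwd_diff_2)
  ultimately have "integral {?u..?v} (fwd_diff 2 ?h f)
      = (davg f L i - 2 * davg f L (i+1) + davg f L (i+2)) / 2^L"
    by (simp add: integral_unique diff_divide_distrib add_divide_distrib)
  then show ?thesis by simp
qed

text \<open>c 0, ..., c 3 are averages over four consecutive equal cells. The slopes vanish when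
  these form an arithmetic progression, so they are combinations of the two second differences. The
  coefficients are -3/8, -1/8 for the left sibling and 1/8, 3/8 for the right one, and for each
  second difference the absolute values add up to 1/2.\<close>

lemma dslope_siblings:
  assumes f: "f integrable_on {0..1}" and p: "p < 2^k"
  defines "c \<equiv> \<lambda>i. davg f (Suc (Suc k)) (4*p+i)"
  shows "\<bar>dslope f (Suc k) (2*p)\<bar> + \<bar>dslope f (Suc k) (2*p+1)\<bar>
    \<le> (\<bar>c 0 - 2 * c 1 + c 2\<bar> + \<bar>c 1 - 2 * c 2 + c 3\<bar>) / 2"
proof -
  have e: "2*(2*p) = 4*p" "4*p+0 = 4*p" "2*(2*p+1) = 4*p+2" "4*p+2+1 = 4*p+3" by simp_all
  have d: "davg f (Suc k) (2*p) = (c 0 + c 1) / 2" "davg f (Suc k) (2*p+1) = (c 2 + c 3) / 2"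
    using davg_split[OF f, of "2*p" "Suc k"] davg_split[OF f, of "2*p+1" "Suc k"] p
    unfolding c_def e by auto
  have h: "dhalf f (Suc k) (2*p) = (c 1 - c 0) / 2" "dhalf f (Suc k) (2*p+1) = (c 3 - c 2) / 2"
    unfolding dhalf_def e c_def by simp_all
  have hk: "dhalf f k p = ((c 2 + c 3) / 2 - (c 0 + c 1) / 2) / 2"
    unfolding dhalf_def d ..
  have ds: "dslope f (Suc k) (2*p) = dhalf f (Suc k) (2*p) - dhalf f k p / 2"
    "dslope f (Suc k) (2*p+1) = dhalf f (Suc k) (2*p+1) - dhalf f k p / 2"
    by (simp_all add: dslope_def)
  have s: "dslope f (Suc k) (2*p) = - 3/8 * (c 0 - 2 * c 1 + c 2) - 1/8 * (c 1 - 2 * c 2 + c 3)"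
    "dslope f (Suc k) (2*p+1) = 1/8 * (c 0 - 2 * c 1 + c 2) + 3/8 * (c 1 - 2 * c 2 + c 3)"
    unfolding ds h hk by (simp_all add: field_simps)
  define A where "A = c 0 - 2 * c 1 + c 2"
  define B where "B = c 1 - 2 * c 2 + c 3"
  have "\<bar>- 3/8 * A - 1/8 * B\<bar> \<le> 3/8 * \<bar>A\<bar> + 1/8 * \<bar>B\<bar>"
    using abs_triangle_ineq4[of "- 3/8 * A" "1/8 * B"] by (simp add: abs_mult)
  moreover have "\<bar>1/8 * A + 3/8 * B\<bar> \<le> 1/8 * \<bar>A\<bar> + 3/8 * \<bar>B\<bar>"
    using abs_triangle_ineq[of "1/8 * A" "3/8 * B"] by (simp add: abs_mult)
  ultimately show ?thesis unfolding s A_def[symmetric] B_def[symmetric] by (simp add: field_simps)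
qed

lemma sum_abs_dslope_le:
  assumes f: "f absolutely_integrable_on {0..1}"
  shows "(\<Sum>j<2^Suc k. \<bar>dslope f (Suc k) j\<bar>)
    \<le> 2^Suc k * integral {0..1 - 2 * (1/2^Suc (Suc k))} (\<lambda>x. \<bar>fwd_diff 2 (1/2^Suc (Suc k)) f x\<bar>)"
proof -
  define L where "L = Suc (Suc k)"
  define h where "h = (1/2^L :: real)"
  have fi: "f integrable_on {0..1}" using f by (rule set_lebesgue_integral_eq_integral)
  have top: "dyadic L (2^L - 2) = 1 - 2*h"
    by (simp add: dyadic_def L_def h_def of_nat_diff diff_divide_distrib)
  have ai: "fwd_diff 2 h f absolutely_integrable_on {0..1-2*h}"
    by (rule fwd_diff_2_absolutely_integrable[OF f]) (simp add: h_def)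
  have gi: "(\<lambda>x. \<bar>fwd_diff 2 h f x\<bar>) integrable_on {0..1-2*h}"
    using ai by (simp add: absolutely_integrable_on_def)
  \<comment> \<open>Extension by zero past the last complete triple lets the sum over groups of four
    cells be regrouped as one sum over all 2^L cells.\<close>
  define T where "T i = (if i + 2 < 2^L then \<bar>davg f L i - 2 * davg f L (i+1) + davg f L (i+2)\<bar> else 0)" for i
  have T0: "T i \<ge> 0" for i by (simp add: T_def)
  have "(\<Sum>j<2*2^k. \<bar>dslope f (Suc k) j\<bar>) \<le> (\<Sum>p<2^k. (T (4*p) + T (4*p+1)) / 2)"
    unfolding sum_lessThan_double
  proof (intro sum_mono)
    fix p assume "p \<in> {..<(2::nat)^k}"
    then have p: "p < 2^k" by simp
    then have "4 * p + 3 < 2^L" by (simp add: L_def)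
    then show "\<bar>dslope f (Suc k) (2*p)\<bar> + \<bar>dslope f (Suc k) (2*p+1)\<bar> \<le> (T (4*p) + T (4*p+1)) / 2"
      using dslope_siblings[OF fi p] by (simp add: T_def L_def numeral_3_eq_3 add_ac)
  qed
  also have "\<dots> \<le> (\<Sum>p<2^k. ((T (4*p) + T (4*p+1)) + (T (4*p+2) + T (4*p+3))) / 2)"
    using T0 by (intro sum_mono divide_right_mono) (auto intro: add_nonneg_nonneg)
  also have "\<dots> = (\<Sum>i<2*(2*2^k). T i) / 2"
    unfolding sum_lessThan_double by (simp add: sum_divide_distrib numeral_3_eq_3)
  also have "2*(2*2^k) = (2::nat)^L" by (simp add: L_def)
  also have "(\<Sum>i<2^L. T i) = (\<Sum>i<2^L-2. T i)"
    by (rule sum.mono_neutral_right) (auto simp: T_def)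
  also have "\<dots> \<le> (\<Sum>i<2^L-2. 2^L * integral {dyadic L i..dyadic L (Suc i)} (\<lambda>x. \<bar>fwd_diff 2 h f x\<bar>))"
  proof (intro sum_mono)
    fix i assume "i \<in> {..<(2::nat)^L-2}"
    then have i: "i + 2 < 2^L" by auto
    have sub: "{dyadic L i..dyadic L (Suc i)} \<subseteq> {0..1-2*h}"
      unfolding top[symmetric] using i by (intro atLeastatMost_subset_iff[THEN iffD2]) auto
    have ai': "fwd_diff 2 h f absolutely_integrable_on {dyadic L i..dyadic L (Suc i)}"
      by (rule set_integrable_subset[OF ai _ sub]) simp
    have "T i = 2^L * \<bar>integral {dyadic L i..dyadic L (Suc i)} (fwd_diff 2 h f)\<bar>"
      using davg_second_difference[OF fi i] i by (simp add: T_def h_def abs_mult)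
    also have "\<dots> \<le> 2^L * integral {dyadic L i..dyadic L (Suc i)} (\<lambda>x. \<bar>fwd_diff 2 h f x\<bar>)"
      using ai' integral_norm_bound_integral[of "fwd_diff 2 h f" "{dyadic L i..dyadic L
          (Suc i)}" "\<lambda>x. \<bar>fwd_diff 2 h f x\<bar>"]
      by (intro mult_left_mono) (auto simp: absolutely_integrable_on_def)
    finally show "T i \<le> 2^L * integral {dyadic L i..dyadic L (Suc i)} (\<lambda>x. \<bar>fwd_diff 2 h f x\<bar>)" .
  qed
  also have "\<dots> = 2^L * integral {0..1-2*h} (\<lambda>x. \<bar>fwd_diff 2 h f x\<bar>)"
    using sum_dyadic_integrals[of "\<lambda>x. \<bar>fwd_diff 2 h f x\<bar>" L "2^L-2"] gi
    by (simp add: top sum_distrib_left[symmetric])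
  finally show ?thesis by (simp add: L_def h_def)
qed

lemma sum_abs_dslope_le_modulus:
  assumes f: "f absolutely_integrable_on {0..1}" and l: "l > 0"
  shows "ennreal (\<Sum>j<2^l. \<bar>dslope f l j\<bar>) \<le> ennreal (2^l) * modulus 2 1 0 1 f (1/2^Suc l)"
proof -
  obtain k where k: "l = Suc k" using l by (cases l) auto
  define h where "h = (1/2^Suc l :: real)"
  have h0: "h > 0" by (simp add: h_def)
  have ai: "fwd_diff 2 h f absolutely_integrable_on {0..1-2*h}"
    by (rule fwd_diff_2_absolutely_integrable[OF f]) (simp add: h_def)
  have S: "{x. x \<in> {0..1} \<and> x + real 2 * h \<in> {0..1}} = {0..1-2*h}"
    using h0 by auto
  have abs_ai: "(\<lambda>x. \<bar>fwd_diff 2 h f x\<bar>) absolutely_integrable_on {0..1-2*h}"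
    using set_integrable_abs[OF ai] by simp
  have "Lp_enorm 1 {0..1-2*h} (fwd_diff 2 h f) = ennreal (integral {0..1-2*h} (\<lambda>x. \<bar>fwd_diff 2 h f x\<bar>))"
    using ai set_lebesgue_integral_eq_integral(2)[OF abs_ai]
    by (simp add: Lp_enorm_def Lp_mem_1_iff integral_nonneg set_lebesgue_integral_eq_integral(1)[OF abs_ai])
  moreover have "Lp_enorm 1 {0..1-2*h} (fwd_diff 2 h f) \<le> modulus 2 1 0 1 f h"
    unfolding modulus_def by (rule SUP_upper2[of h]) (use h0 S in auto)
  ultimately have "ennreal (2^l) * ennreal (integral {0..1-2*h} (\<lambda>x. \<bar>fwd_diff 2 h f x\<bar>))
      \<le> ennreal (2^l) * modulus 2 1 0 1 f h"
    by (intro mult_left_mono) auto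
  moreover have "ennreal (\<Sum>j<2^l. \<bar>dslope f l j\<bar>) \<le> ennreal (2^l) * ennreal (integral {0..1-2*h}
      (\<lambda>x. \<bar>fwd_diff 2 h f x\<bar>))"
    using sum_abs_dslope_le[OF f, of k] by (simp add: ennreal_mult'[symmetric] ennreal_leI k h_def)
  ultimately show ?thesis by (simp add: h_def)
qed

lemma modulus_mono: "t \<le> t' \<Longrightarrow> modulus s p a b f t \<le> modulus s p a b f t'"
  unfolding modulus_def by (rule SUP_subset_mono) auto

lemma enn_powr_mono: "x \<le> y \<Longrightarrow> 0 \<le> a \<Longrightarrow> enn_powr x a \<le> enn_powr y a"
  unfolding enn_powr_def
  by (auto simp: top_unique less_top intro!: ennreal_leI powr_mono2 enn2real_mono)

lemma enn_powr_ennreal: "0 \<le> x \<Longrightarrow> enn_powr (ennreal x) a = ennreal (x powr a)"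
  by (simp add: enn_powr_def)

lemma besov_class_1_1D:
  assumes f: "f \<in> besov_class 1 1 \<theta> 0 1"
  shows "f absolutely_integrable_on {0..1}" "integral {0..1} (\<lambda>x. \<bar>f x\<bar>) \<le> 1" "besov_semi 1 1 \<theta> 0 1 f \<le> 1"
proof -
  have mem: "Lp_mem 1 {0..1} f" and le: "Lp_enorm 1 {0..1} f + besov_semi 1 1 \<theta> 0 1 f \<le> 1"
    using f by (auto simp: besov_class_def)
  show ai: "f absolutely_integrable_on {0..1}" using mem by (simp add: Lp_mem_1_iff)
  have abs_ai: "(\<lambda>x. \<bar>f x\<bar>) absolutely_integrable_on {0..1}"
    using set_integrable_abs[OF ai] by simp
  have "Lp_enorm 1 {0..1} f = ennreal (integral {0..1} (\<lambda>x. \<bar>f x\<bar>))"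
    using mem set_lebesgue_integral_eq_integral(2)[OF abs_ai]
    by (simp add: Lp_enorm_def integral_nonneg set_lebesgue_integral_eq_integral(1)[OF abs_ai])
  moreover have "Lp_enorm 1 {0..1} f \<le> 1" by (rule order.trans[OF _ le]) simp
  ultimately show "integral {0..1} (\<lambda>x. \<bar>f x\<bar>) \<le> 1" by simp
  show "besov_semi 1 1 \<theta> 0 1 f \<le> 1" by (rule order.trans[OF _ le]) simp
qed

text \<open>Second differences do not see affine functions, so level 0 has to be controlled by the
  L_1 part of the Besov norm.\<close>

lemma besov_slope_0:
  assumes f: "f \<in> besov_class 1 1 \<theta> 0 1"
  shows "\<bar>dslope f 0 0\<bar> \<le> 1"
proof -
  note D = besov_class_1_1D[OF f]
  have fi: "f integrable_on {0..1}" and fa: "(\<lambda>x. \<bar>f x\<bar>) integrable_on {0..1}"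
    using D(1) by (auto simp: absolutely_integrable_on_def)
  have s: "f integrable_on {0..1/2}" "f integrable_on {1/2..1}"
    "(\<lambda>x. \<bar>f x\<bar>) integrable_on {0..1/2}" "(\<lambda>x. \<bar>f x\<bar>) integrable_on {1/2..1}"
    by (auto intro: integrable_on_subinterval[OF fi] integrable_on_subinterval[OF fa])
  have "dslope f 0 0 = integral {1/2..1} f - integral {0..1/2} f"
    by (simp add: dslope_def dhalf_def davg_def dyadic_def)
  moreover have "\<bar>integral {1/2..1} f\<bar> \<le> integral {1/2..1} (\<lambda>x. \<bar>f x\<bar>)" "\<bar>integral {0..1/2} f\<bar>
      \<le> integral {0..1/2} (\<lambda>x. \<bar>f x\<bar>)"
    using s integral_norm_bound_integral[of f "{1/2..1}" "\<lambda>x. \<bar>f x\<bar>"]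
      integral_norm_bound_integral[of f "{0..1/2}" "\<lambda>x. \<bar>f x\<bar>"] by auto
  moreover have "integral {0..1/2} (\<lambda>x. \<bar>f x\<bar>) + integral {1/2..1} (\<lambda>x. \<bar>f x\<bar>) = integral {0..1} (\<lambda>x. \<bar>f x\<bar>)"
    using fa by (intro Henstock_Kurzweil_Integration.integral_combine) auto
  ultimately show ?thesis using D(2) by linarith
qed

lemma besov_slopes_infinity:
  assumes f: "f \<in> besov_class 1 1 \<infinity> 0 1"
  shows "(\<Sum>j<2^l. \<bar>dslope f l j\<bar>) \<le> 1"
proof (cases "l = 0")
  case True
  then show ?thesis using besov_slope_0[OF f] by simp
next
  case False
  note D = besov_class_1_1D[OF f]
  have "ennreal (\<Sum>j<2^l. \<bar>dslope f l j\<bar>) \<le> ennreal (2^l) * modulus 2 1 0 1 f (1/2^Suc l)"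
    using False by (intro sum_abs_dslope_le_modulus D) auto
  also have "\<dots> \<le> ennreal ((1/2^Suc l) powr (-1)) * modulus 2 1 0 1 f (1/2^Suc l)"
    by (intro mult_right_mono ennreal_leI) (auto simp: powr_minus)
  also have "\<dots> \<le> (SUP t\<in>{0<..}. ennreal (t powr (- 1)) * modulus 2 1 0 1 f t)"
    by (rule SUP_upper) simp
  also have "\<dots> \<le> 1" using D(3) by (simp add: besov_semi_def Let_def numeral_2_eq_2)
  finally show ?thesis by simp
qed

text \<open>On the shell [2^(-l-1), 2^(-l)) the modulus is at least its value at 2^(-l-1), and 1/t
  is at least 2^l both in the integrand and in dt/t. As the shell has length 2^(-l-1), it
  contributes at least b_l^r / 2 to the integral. This yields 2 for the positive levels, and level 0
  adds 1.\<close>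

lemma besov_slopes_finite:
  assumes f: "f \<in> besov_class 1 1 (ereal r) 0 1" and r: "1 \<le> r"
  shows "(\<Sum>l<M. (\<Sum>j<2^l. \<bar>dslope f l j\<bar>) powr r) \<le> 3"
proof -
  note D = besov_class_1_1D[OF f]
  define b where "b l = (\<Sum>j<2^l. \<bar>dslope f l j\<bar>)" for l
  have b0: "b l \<ge> 0" for l by (simp add: b_def sum_nonneg)
  define G where "G t = indicator {0<..} t * enn_powr (ennreal (t powr
      (- 1)) * modulus 2 1 0 1 f t) r * ennreal (1 / t)" for t :: real
  have "enn_powr (\<integral>\<^sup>+ t. G t \<partial>lborel) (1/r) \<le> 1"
    using D(3) by (simp add: besov_semi_def Let_def numeral_2_eq_2 G_def)
  then have I1: "(\<integral>\<^sup>+ t. G t \<partial>lborel) \<le> 1"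
  proof -
    assume a: "enn_powr (\<integral>\<^sup>+ t. G t \<partial>lborel) (1/r) \<le> 1"
    then have fin: "(\<integral>\<^sup>+ t. G t \<partial>lborel) \<noteq> \<infinity>" by (auto simp: enn_powr_def top_unique)
    then have "enn2real (\<integral>\<^sup>+ t. G t \<partial>lborel) powr (1/r) \<le> 1" using a by (simp add: enn_powr_def)
    then have "(enn2real (\<integral>\<^sup>+ t. G t \<partial>lborel) powr (1/r)) powr r
        \<le> 1 powr r" using r by (intro powr_mono2) auto
    then have "enn2real (\<integral>\<^sup>+ t. G t \<partial>lborel) \<le> 1" using r by (simp add: powr_powr)
    then have "ennreal (enn2real (\<integral>\<^sup>+ t. G t \<partial>lborel)) \<le> ennreal 1" by (rule ennreal_leI)
    then show ?thesis using fin by (simp add: less_top)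
  qed
  define J where "J l = {1/2^Suc l..<1/2^l :: real}" for l
  have Jdis: "l = l'" if "t \<in> J l" "t \<in> J l'" for t l l'
  proof -
    have "\<not> k < k'" if "t \<in> J k" "t \<in> J k'" for k k'
    proof
      assume "k < k'"
      then have "(2::real)^Suc k \<le> 2^k'" by (intro power_increasing) auto
      then have "1/2^k' \<le> (1/2^Suc k :: real)" by (intro divide_left_mono) auto
      then show False using that by (auto simp: J_def)
    qed
    then show ?thesis using that by (meson nat_neq_iff)
  qed
  have Gl: "ennreal (b l powr r * 2^l) \<le> G t" if t: "t \<in> J l" and l: "l > 0" for t l
  proof -
    have t0: "t > 0" using t by (auto simp: J_def intro: less_le_trans[of 0 "1/2^Suc l"])
    have tb: "2^l \<le> 1/t" using t t0 by (auto simp: J_def field_simps)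
    have "ennreal (b l) \<le> ennreal (2^l) * modulus 2 1 0 1 f (1/2^Suc l)"
      unfolding b_def using l by (intro sum_abs_dslope_le_modulus D) auto
    also have "\<dots> \<le> ennreal (t powr (-1)) * modulus 2 1 0 1 f t"
      using t tb t0 by (intro mult_mono ennreal_leI modulus_mono) (auto simp: powr_minus_divide J_def)
    finally have "enn_powr (ennreal (b l)) r \<le> enn_powr (ennreal (t powr (-1)) * modulus 2 1 0 1 f t) r"
      using r by (intro enn_powr_mono) auto
    then have "enn_powr (ennreal (b l)) r * ennreal (2^l)
        \<le> enn_powr (ennreal (t powr (-1)) * modulus 2 1 0 1 f t) r * ennreal (1/t)"
      by (intro mult_mono ennreal_leI tb) auto
    then show ?thesis using t0 b0 by (simp add: G_def enn_powr_ennreal ennreal_mult')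
  qed
  have "ennreal (\<Sum>l\<in>{1..<M}. b l powr r / 2) = (\<Sum>l\<in>{1..<M}. ennreal (b l powr r * 2^l) * emeasure lborel
      (J l))"
  proof -
    have "ennreal (b l powr r * 2^l) * emeasure lborel (J l) = ennreal (b l powr r / 2)" for l
      by (simp add: J_def ennreal_mult'[symmetric] divide_right_mono field_simps)
    then show ?thesis by simp
  qed
  also have "\<dots> = (\<integral>\<^sup>+ t. (\<Sum>l\<in>{1..<M}. ennreal (b l powr r * 2^l) * indicator (J l) t) \<partial>lborel)"
    by (subst nn_integral_sum) (auto simp: nn_integral_cmult_indicator J_def)
  also have "\<dots> \<le> (\<integral>\<^sup>+ t. G t \<partial>lborel)"
  proof (rule nn_integral_mono)
    fix t :: real
    show "(\<Sum>l\<in>{1..<M}. ennreal (b l powr r * 2^l) * indicator (J l) t) \<le> G t"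
    proof (cases "\<exists>k\<in>{1..<M}. t \<in> J k")
      case True
      then obtain k where k: "k \<in> {1..<M}" "t \<in> J k" by blast
      have "(\<Sum>l\<in>{1..<M}. ennreal (b l powr r * 2^l) * indicator (J l) t)
          = (\<Sum>l\<in>{1..<M}. if l = k then ennreal (b k powr r * 2^k) else 0)"
        using k Jdis by (intro sum.cong) (auto simp: indicator_def)
      also have "\<dots> = ennreal (b k powr r * 2^k)" using k by simp
      also have "\<dots> \<le> G t" using k by (intro Gl) auto
      finally show ?thesis .
    next
      case False
      then have "(\<Sum>l\<in>{1..<M}. ennreal (b l powr r * 2^l) * indicator (J l) t) = 0"
        by (intro sum.neutral) auto
      then show ?thesis by simp
    qed
  qed
  also have "\<dots> \<le> ennreal 1" using I1 by simp
  finally have le2: "(\<Sum>l\<in>{1..<M}. b l powr r) \<le> 2"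
    by (simp add: sum_divide_distrib[symmetric])
  have "b 0 powr r \<le> 1 powr r"
    using besov_slope_0[OF f] b0[of 0] r by (intro powr_mono2) (auto simp: b_def)
  then have b1: "b 0 powr r \<le> 1" by simp
  have "(\<Sum>l<M. b l powr r) \<le> (\<Sum>l\<in>insert 0 {1..<M}. b l powr r)"
    by (intro sum_mono2) auto
  also have "\<dots> \<le> 3" using le2 b1 by simp
  finally show ?thesis by (simp add: b_def)
qed

section \<open>Upper bound\<close>

lemma Lp_mem_bounded:
  assumes g: "g \<in> borel_measurable borel" and B: "\<And>x. \<bar>g x\<bar> \<le> B" and q: "0 < q"
  shows "Lp_mem q {0..1} g"
proof -
  have "g \<in> borel_measurable lebesgue" using g by (simp add: measurable_completion)
  then have sm: "set_borel_measurable lebesgue {0..1} g"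
    unfolding set_borel_measurable_def by (intro borel_measurable_scaleR borel_measurable_indicator) auto
  have B0: "0 \<le> B" using B[of 0] by linarith
  have "(\<integral>\<^sup>+ x. ennreal (indicator {0..1} x * \<bar>g x\<bar> powr q) \<partial>lebesgue)
      \<le> (\<integral>\<^sup>+ x. ennreal (B powr q) * indicator {0..1::real} x \<partial>lebesgue)"
    using B q by (intro nn_integral_mono) (auto simp: indicator_def intro!: ennreal_leI powr_mono2)
  also have "\<dots> = ennreal (B powr q)" by (subst nn_integral_cmult_indicator) auto
  finally show ?thesis using Lp_enorm_leI(1)[OF sm q B0] by simp
qed

text \<open>A finite index set of any type is enumerated and padded with zero functions to match the
  format of the definition.\<close>

lemma kolmogorov_width_le:
  assumes fin: "finite I" and card: "card I \<le> n" and q: "0 < q"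
    and G: "\<And>i. i \<in> I \<Longrightarrow> Lp_mem q {0..1} (G i)"
    and F: "\<And>f. f \<in> F \<Longrightarrow> \<exists>c. Lp_enorm q {0..1} (\<lambda>x. f x - (\<Sum>i\<in>I. c i * G i x)) \<le> R"
  shows "kolmogorov_width n F q 0 1 \<le> R"
proof -
  obtain e where e: "bij_betw e {..<card I} I"
    using ex_bij_betw_nat_finite[OF fin] by (auto simp: atLeast0LessThan)
  define g where "g i = (if i < card I then G (e i) else (\<lambda>_. 0))" for i
  have "Lp_mem q {0..1} (g i)" for i
  proof (cases "i < card I")
    case True
    then show ?thesis using bij_betwE[OF e] G by (auto simp: g_def)
  next
    case False
    have "Lp_mem q {0..1} (\<lambda>_. 0 :: real)" by (rule Lp_mem_bounded[of _ 0]) (use q in auto)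
    then show ?thesis using False by (simp add: g_def)
  qed
  then have gin: "g \<in> {g. \<forall>i<n. Lp_mem q {0..1} (g i)}" by simp
  show ?thesis unfolding kolmogorov_width_def
  proof (rule INF_lower2[OF gin], rule SUP_least)
    fix f assume "f \<in> F"
    then obtain c where c: "Lp_enorm q {0..1} (\<lambda>x. f x - (\<Sum>i\<in>I. c i * G i x)) \<le> R" using F by blast
    have "(\<Sum>i<n. c (e i) * g i x) = (\<Sum>i\<in>I. c i * G i x)" for x
    proof -
      have "(\<Sum>i<n. c (e i) * g i x) = (\<Sum>i<card I. c (e i) * G (e i) x)"
        using card by (intro sum.mono_neutral_cong_right) (auto simp: g_def)
      also have "\<dots> = (\<Sum>i\<in>I. c i * G i x)" by (rule sum.reindex_bij_betw[OF e])
      finally show ?thesis .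
    qed
    then show "(INF c. Lp_enorm q {0..1} (\<lambda>x. f x - (\<Sum>i<n. c i * g i x))) \<le> R"
      using c by (intro INF_lower2[of "\<lambda>i. c (e i)"]) auto
  qed
qed

lemma dyadic_moment_cong:
  "(\<And>j. j < 2^l \<Longrightarrow> a j = b j) \<Longrightarrow> dyadic_moment m l a = dyadic_moment m l b"
  unfolding dyadic_moment_def by (intro arg_cong2[where f = "(/)"] sum.cong) auto

text \<open>The l_2m norm is at most the l_1 norm, and the normalisation by 2^l yields the decay.
  This is the estimate for levels on which nothing is approximated.\<close>

lemma dyadic_moment_le_l1:
  assumes m: "0 < m"
  shows "dyadic_moment m l a \<le> ((2 powr (- real l / (2 * real m)) * (\<Sum>j<2^l. \<bar>a j\<bar>))\<^sup>2)^m"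
proof -
  let ?S = "\<Sum>j<2^l. \<bar>a j\<bar>"
  have S0: "?S \<ge> 0" by (simp add: sum_nonneg)
  have le: "\<bar>a j\<bar> \<le> ?S" if "j < 2^l" for j using that by (intro member_le_sum) auto
  have "(\<Sum>j<2^l. a j^(2*m)) \<le> (\<Sum>j<2^l. \<bar>a j\<bar> * ?S^(2*m-1))"
  proof (intro sum_mono)
    fix j assume "j \<in> {..<(2::nat)^l}"
    then have j: "j < 2^l" by simp
    have "a j^(2*m) = \<bar>a j\<bar>^(2*m)" by (simp add: power_even_abs)
    also have "\<dots> = \<bar>a j\<bar> * \<bar>a j\<bar>^(2*m-1)" using m by (cases "2*m") auto
    also have "\<dots> \<le> \<bar>a j\<bar> * ?S^(2*m-1)" by (intro mult_left_mono power_mono le j) auto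
    finally show "a j^(2*m) \<le> \<bar>a j\<bar> * ?S^(2*m-1)" .
  qed
  also have "\<dots> = ?S * ?S^(2*m-1)" by (rule sum_distrib_right[symmetric])
  also have "\<dots> = ?S^(2*m)" using m by (cases "2*m") auto
  finally have "dyadic_moment m l a \<le> ?S^(2*m) / 2^l"
    by (simp add: dyadic_moment_def divide_right_mono)
  also have "\<dots> = ((2 powr (- real l / (2 * real m)) * ?S)\<^sup>2)^m"
  proof -
    have "(2 powr (- real l / (2 * real m)))^(2*m) = 2 powr (- real l)"
      using m by (subst powr_realpow[symmetric]) (auto simp: powr_powr)
    also have "\<dots> = 1/2^l" by (simp add: powr_minus_divide powr_realpow)
    finally show ?thesis
      by (simp add: power_mult[symmetric] power_mult_distrib)
  qed
  finally show ?thesis .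
qed

lemma dslope_const: "dslope (\<lambda>_. c) l j = 0"
proof -
  have "davg (\<lambda>_. c) l j = c" for l j by (simp add: davg_def dyadic_Suc)
  then show ?thesis by (simp add: dslope_def dhalf_def)
qed

text \<open>The approximating space is spanned by the constant 1 and, on each of the K coarse
  levels, by N combinations of sawtooth functions whose coefficient vectors come from
  \<open>random_subspace_approximation\<close>. By biorthogonality the slopes of the residual are
  the errors of the approximation of the slope vectors. \<open>w l\<close> is the error on level l
  per unit of l_1 norm.\<close>

lemma kolmogorov_width_le_of_slopes:
  fixes F :: "(real \<Rightarrow> real) set"
  assumes m: "m = 2^s" and q: "0 < q" "q \<le> 2 * real m" and n: "1 + K * N \<le> n" and X: "0 < X"
  defines "w \<equiv> \<lambda>l. if l < K then sqrt (16 * real m / real (N+1)) else 2 powr (- real l / (2 * real m))"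
  assumes F: "\<And>f. f \<in> F \<Longrightarrow> f absolutely_integrable_on {0..1}"
    and slopes: "\<And>f M. f \<in> F \<Longrightarrow> (\<Sum>l<M. (w l * (\<Sum>j<2^l. \<bar>dslope f l j\<bar>))\<^sup>2) \<le> X"
  shows "kolmogorov_width n F q 0 1 \<le> ennreal (sqrt (8 * real m * X))"
proof -
  have m0: "m > 0" using m by simp
  have "\<exists>V :: nat \<Rightarrow> nat \<Rightarrow> real. \<forall>x. \<exists>c. dyadic_moment m l (\<lambda>i. x i - (\<Sum>t<N. c t * V t i))
      \<le> (16 * real m / real (N+1) * (\<Sum>j<2^l. \<bar>x j\<bar>)\<^sup>2)^m" for l
    using random_subspace_approximation[OF m, of "2^l" N] unfolding dyadic_moment_def by simp
  then obtain V :: "nat \<Rightarrow> nat \<Rightarrow> nat \<Rightarrow> real" where V: "\<And>l x. \<exists>c. dyadic_moment m l (\<lambda>i. x i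
      - (\<Sum>t<N. c t * V l t i))
      \<le> (16 * real m / real (N+1) * (\<Sum>j<2^l. \<bar>x j\<bar>)\<^sup>2)^m"
    using choice[of "\<lambda>l V. \<forall>x. \<exists>c. dyadic_moment m l (\<lambda>i. x i - (\<Sum>t<N. c t * V t i))
      \<le> (16 * real m / real (N+1) * (\<Sum>j<2^l. \<bar>x j\<bar>)\<^sup>2)^m"] by blast
  define H where "H l t x = (\<Sum>j<2^l. V l t j * sawtooth l j x)" for l t x
  define G where "G = (\<lambda>p. case p of None \<Rightarrow> (\<lambda>_. 1) | Some lt \<Rightarrow> H (fst lt) (snd lt))"
  define I where "I = insert None (Some ` ({..<K} \<times> {..<N}))"
  have finI: "finite I" by (simp add: I_def)
  have cardI: "card I \<le> n"
    using n by (simp add: I_def card_image card_cartesian_product)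
  have Hai: "H l t absolutely_integrable_on {0..1}" for l t
    unfolding H_def by (intro absolutely_integrable_sum set_integrable_mult_right sawtooth_integrable) auto
  have Hi: "H l t integrable_on {0..1}" for l t
    using Hai by (rule set_lebesgue_integral_eq_integral)
  have Gai: "G p absolutely_integrable_on {0..1}" for p
    using Hai by (cases p) (auto simp: G_def absolutely_integrable_on_const)
  have Gi: "G p integrable_on {0..1}" for p
    using Gai by (rule set_lebesgue_integral_eq_integral)
  have si: "sawtooth l j integrable_on {0..1}" for l j
    using sawtooth_integrable by (rule set_lebesgue_integral_eq_integral)
  have Gmem: "Lp_mem q {0..1} (G p)" for p
  proof (cases p)
    case None
    then show ?thesis using q by (auto simp: G_def intro!: Lp_mem_bounded[of _ 1])
  next
    case (Some lt)
    have "Lp_mem q {0..1} (H l t)" for l t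
    proof (rule Lp_mem_bounded[of _ "\<Sum>j<2^l. \<bar>V l t j\<bar> * 2"])
      show "H l t \<in> borel_measurable borel"
        unfolding H_def using sawtooth_measurable by measurable
      show "\<bar>H l t x\<bar> \<le> (\<Sum>j<2^l. \<bar>V l t j\<bar> * 2)" for x
        unfolding H_def by (rule order.trans[OF sum_abs sum_mono]) (simp add: abs_mult mult_left_mono sawtooth_bounded)
    qed (rule q)
    then show ?thesis using Some by (simp add: G_def)
  qed
  have slopeH: "dslope (H l' t) l j = (if l' = l then V l t j else 0)" if "j < 2^l" for l' t l j
  proof -
    have "dslope (H l' t) l j = (\<Sum>i<2^l'. V l' t i * dslope (sawtooth l' i) l j)"
      unfolding H_def using that by (intro dslope_sum si) auto
    also have "\<dots> = (\<Sum>i<2^l'. if l = l' \<and> i = j then V l' t i else 0)"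
      by (intro sum.cong) (auto simp: dslope_sawtooth)
    also have "\<dots> = (if l' = l then V l t j else 0)" using that by auto
    finally show ?thesis .
  qed
  have avgH: "davg (H l t) 0 0 = 0" for l t
    unfolding H_def using davg_sum[of "{..<2^l}" "sawtooth l" 0 0 "V l t"] si by (simp add: davg_sawtooth_coarse)
  show ?thesis
  proof (rule kolmogorov_width_le[OF finI cardI q(1) Gmem])
    fix f assume f: "f \<in> F"
    have fi: "f integrable_on {0..1}" using F[OF f] by (rule set_lebesgue_integral_eq_integral)
    obtain c where c: "\<And>l. dyadic_moment m l (\<lambda>i. dslope f l i - (\<Sum>t<N. c l t * V l t i))
      \<le> (16 * real m / real (N+1) * (\<Sum>j<2^l. \<bar>dslope f l j\<bar>)\<^sup>2)^m"
      using choice[of "\<lambda>l c. dyadic_moment m l (\<lambda>i. dslope f l i - (\<Sum>t<N. c t * V l t i))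
      \<le> (16 * real m / real (N+1) * (\<Sum>j<2^l. \<bar>dslope f l j\<bar>)\<^sup>2)^m"] V by blast
    \<comment> \<open>The constant function receives the mean of f, so that the residual has mean
      zero, as the tree inequality demands at its root.\<close>
    define d where "d = (\<lambda>p. case p of None \<Rightarrow> davg f 0 0 | Some lt \<Rightarrow> c (fst lt) (snd lt))"
    define E where "E x = f x - (\<Sum>p\<in>I. d p * G p x)" for x
    have sumI: "(\<Sum>p\<in>I. u p) = u None + (\<Sum>l<K. \<Sum>t<N. u (Some (l,t)))" for u :: "(nat \<times> nat) option \<Rightarrow> real"
    proof -
      have "(\<Sum>p\<in>I. u p) = u None + (\<Sum>lt\<in>{..<K} \<times> {..<N}. u (Some lt))"
        unfolding I_def by (subst sum.insert) (auto simp: sum.reindex)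
      also have "(\<Sum>lt\<in>{..<K} \<times> {..<N}. u (Some lt)) = (\<Sum>l<K. \<Sum>t<N. u (Some (l,t)))"
        by (subst sum.cartesian_product) (simp add: case_prod_beta)
      finally show ?thesis .
    qed
    have Gsum: "(\<lambda>x. \<Sum>p\<in>I. d p * G p x) integrable_on {0..1}"
      by (intro integrable_sum finI integrable_on_mult_right Gi)
    have Eai: "set_integrable lebesgue {0..1} E"
      unfolding E_def by (intro set_integral_diff(1) F[OF f] absolutely_integrable_sum finI set_integrable_mult_right Gai)
    have E0: "davg E 0 0 = 0"
    proof -
      have "davg (\<lambda>x. \<Sum>p\<in>I. d p * G p x) 0 0 = (\<Sum>p\<in>I. d p * davg (G p) 0 0)"
        using finI by (intro davg_sum Gi) auto
      also have "\<dots> = davg f 0 0"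
        unfolding sumI by (simp add: d_def G_def avgH) (simp add: davg_def dyadic_def)
      finally show ?thesis unfolding E_def using davg_diff[OF fi Gsum, of 0 0] by simp
    qed
    have slE: "dslope E l j = dslope f l j - (if l < K then \<Sum>t<N. c l t * V l t j else 0)" if j: "j < 2^l" for l j
    proof -
      have "dslope (\<lambda>x. \<Sum>p\<in>I. d p * G p x) l j = (\<Sum>p\<in>I. d p * dslope (G p) l j)"
        using finI j by (intro dslope_sum Gi) auto
      also have "\<dots> = (\<Sum>l'<K. \<Sum>t<N. c l' t * (if l' = l then V l t j else 0))"
        unfolding sumI by (simp add: d_def G_def slopeH[OF j] dslope_const)
      also have "\<dots> = (\<Sum>l'<K. if l' = l then \<Sum>t<N. c l t * V l t j else 0)"
        by (intro sum.cong refl) simp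
      also have "\<dots> = (if l < K then \<Sum>t<N. c l t * V l t j else 0)" by simp
      finally show ?thesis unfolding E_def using dslope_diff[OF fi Gsum j] by simp
    qed
    have "Lp_enorm q {0..1} E \<le> ennreal (sqrt (8 * real m * X))"
    proof (rule Lp_enorm_le_of_slopes[OF Eai m q E0 _ _ X slopes[OF f]])
      fix l
      show "0 \<le> w l * (\<Sum>j<2^l. \<bar>dslope f l j\<bar>)"
        by (auto simp: w_def intro!: mult_nonneg_nonneg sum_nonneg)
      show "dyadic_moment m l (dslope E l) \<le> ((w l * (\<Sum>j<2^l. \<bar>dslope f l j\<bar>))\<^sup>2)^m"
      proof (cases "l < K")
        case True
        have "dyadic_moment m l (dslope E l) = dyadic_moment m l (\<lambda>i. dslope f l i - (\<Sum>t<N. c l t * V l t i))"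
          by (rule dyadic_moment_cong) (simp add: slE True)
        also note c[of l]
        also have "16 * real m / real (N+1) * (\<Sum>j<2^l. \<bar>dslope f l j\<bar>)\<^sup>2 = (w l * (\<Sum>j<2^l. \<bar>dslope f l j\<bar>))\<^sup>2"
          using True by (simp add: w_def power_mult_distrib)
        finally show ?thesis .
      next
        case False
        have "dyadic_moment m l (dslope E l) = dyadic_moment m l (dslope f l)"
          by (rule dyadic_moment_cong) (simp add: slE False)
        also have "\<dots> \<le> ((w l * (\<Sum>j<2^l. \<bar>dslope f l j\<bar>))\<^sup>2)^m"
          using dyadic_moment_le_l1[OF m0, of l "dslope f l"] False by (simp add: w_def)
        finally show ?thesis .
      qed
    qed
    then show "\<exists>c. Lp_enorm q {0..1} (\<lambda>x. f x - (\<Sum>i\<in>I. c i * G i x)) \<le> ennreal (sqrt (8 * real m * X))"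
      unfolding E_def by blast
  qed
qed

abbreviation (input) besov_width :: "real \<Rightarrow> ereal \<Rightarrow> nat \<Rightarrow> ennreal" where
  "besov_width q \<theta> n \<equiv> kolmogorov_width n (besov_class 1 1 \<theta> 0 1) q 0 1"

text \<open>One exponent lets a single upper bound serve both ranges of \<theta>.\<close>

definition log_exponent :: "ereal \<Rightarrow> real" where
  "log_exponent \<theta> = (if \<theta> \<le> 2 then 1/2 else 1 - inv_theta \<theta>)"

lemma log_exponent_bounds:
  assumes "1 \<le> \<theta>"
  shows "1/2 \<le> log_exponent \<theta>" "log_exponent \<theta> \<le> 1"
proof -
  have "1/2 \<le> log_exponent \<theta> \<and> log_exponent \<theta> \<le> 1"
  proof (cases \<theta>)
    case (real r)
    then show ?thesis using assms by (auto simp: log_exponent_def inv_theta_def field_simps)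
  qed (use assms in \<open>auto simp: log_exponent_def inv_theta_def\<close>)
  then show "1/2 \<le> log_exponent \<theta>" "log_exponent \<theta> \<le> 1" by auto
qed

text \<open>A comparison of l_\<theta> with l_2 on K levels. For \<theta> \<le> 2 the bound b_l
  \<le> 3 turns b_l^2 into 3 b_l^\<theta> without any power of K; for \<theta> > 2 Hoelder's
  inequality costs K^(1 - 2/\<theta>).\<close>

lemma besov_slopes_bounds:
  assumes f: "f \<in> besov_class 1 1 \<theta> 0 1" and \<theta>: "1 \<le> \<theta>"
  defines "b \<equiv> \<lambda>l. \<Sum>j<2^l. \<bar>dslope f l j\<bar>"
  shows "b l \<le> 3"
    and "0 < K \<Longrightarrow> (\<Sum>l<K. (b l)\<^sup>2) \<le> 9 * real K powr (2 * log_exponent \<theta> - 1)"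
proof -
  have b0: "b l \<ge> 0" for l by (simp add: b_def sum_nonneg)
  have "b l \<le> 3 \<and> (0 < K \<longrightarrow> (\<Sum>l<K. (b l)\<^sup>2) \<le> 9 * real K powr (2 * log_exponent \<theta> - 1))"
  proof (cases \<theta>)
    case MInf
    then show ?thesis using \<theta> by simp
  next
    case PInf
    have b1: "b l \<le> 1" for l unfolding b_def using f PInf by (intro besov_slopes_infinity) simp
    have "(\<Sum>l<K. (b l)\<^sup>2) \<le> (\<Sum>l<K. 1)"
      using b0 b1 by (intro sum_mono power_le_one) auto
    also have "\<dots> \<le> 9 * real K" by simp
    finally show ?thesis using b1[of l] PInf by (simp add: log_exponent_def inv_theta_def)
  next
    case (real r)
    have r: "1 \<le> r" using \<theta> real by simp
    have S: "(\<Sum>l<M. b l powr r) \<le> 3" for M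
      unfolding b_def using f real r by (intro besov_slopes_finite) auto
    have b3: "b l \<le> 3" for l
    proof -
      have "b l powr r \<le> 3"
        using S[of "Suc l"] member_le_sum[of l "{..<Suc l}" "\<lambda>l. b l powr r"] by simp
      then have "(b l powr r) powr (1/r) \<le> 3 powr (1/r)" using r by (intro powr_mono2) auto
      also have "\<dots> \<le> 3 powr 1" using r by (intro powr_mono) auto
      finally show ?thesis using b0[of l] r by (simp add: powr_powr)
    qed
    have "(\<Sum>l<K. (b l)\<^sup>2) \<le> 9 * real K powr (2 * log_exponent \<theta> - 1)" if K: "0 < K"
    proof (cases "r \<le> 2")
      case True
      have "(b l)\<^sup>2 \<le> 3 * b l powr r" for l
      proof -
        have "(b l)\<^sup>2 = b l powr (2 - r) * b l powr r"
          using b0[of l] abs_powr_2[of "b l"] by (simp add: powr_add[symmetric])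
        also have "\<dots> \<le> 3 powr (2 - r) * b l powr r"
          using b0 b3 True by (intro mult_right_mono powr_mono2) auto
        also have "\<dots> \<le> 3 powr 1 * b l powr r"
          using r by (intro mult_right_mono powr_mono) auto
        finally show ?thesis by simp
      qed
      then have "(\<Sum>l<K. (b l)\<^sup>2) \<le> 3 * (\<Sum>l<K. b l powr r)"
        unfolding sum_distrib_left by (intro sum_mono)
      then show ?thesis using S[of K] True real K by (simp add: log_exponent_def)
    next
      case False
      \<comment> \<open>The common value of the b_l if all K of them are equal and exhaust the bound
        3, which is the extremal case of the comparison for r > 2.\<close>
      define \<mu> where "\<mu> = (3 / real K) powr (1/r)"
      have \<mu>: "\<mu> > 0" using K by (simp add: \<mu>_def)
      have \<mu>r: "\<mu> powr r = 3 / real K" using r K by (simp add: \<mu>_def powr_powr)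
      have "(b l)\<^sup>2 \<le> \<mu> powr 2 * (2/r * (b l powr r / \<mu> powr r) + (1 - 2/r))" for l
        using powr_le_affine_powr[of "b l" 2 r \<mu>] abs_powr_2[of "b l"] b0[of l] False \<mu> by simp
      then have "(\<Sum>l<K. (b l)\<^sup>2) \<le> (\<Sum>l<K. \<mu> powr 2 * (2/r * (b l powr r / \<mu> powr r) + (1 - 2/r)))"
        by (intro sum_mono)
      also have "\<dots> = \<mu> powr 2 * (2/r * ((\<Sum>l<K. b l powr r) / \<mu> powr r) + real K * (1 - 2/r))"
        by (simp add: sum_distrib_left[symmetric] sum.distrib sum_divide_distrib[symmetric])
      also have "\<dots> \<le> \<mu> powr 2 * (2/r * (3 / \<mu> powr r) + real K * (1 - 2/r))"
        using S[of K] r by (intro mult_left_mono add_right_mono divide_right_mono) auto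
      also have "\<dots> = \<mu> powr 2 * real K"
        unfolding \<mu>r using r K by (simp add: algebra_simps)
      also have "\<dots> = 3 powr (2/r) * real K powr (1 - 2/r)"
        using K by (simp add: \<mu>_def powr_powr powr_divide powr_diff)
      also have "\<dots> \<le> 9 * real K powr (1 - 2/r)"
      proof (intro mult_right_mono)
        have "3 powr (2/r) \<le> 3 powr (2::real)" using r by (intro powr_mono) (auto simp: field_simps)
        then show "3 powr (2/r) \<le> (9::real)" by simp
      qed simp
      finally show ?thesis using False real by (simp add: log_exponent_def inv_theta_def)
    qed
    then show ?thesis using b3 by blast
  qed
  then show "b l \<le> 3" "0 < K \<Longrightarrow> (\<Sum>l<K. (b l)\<^sup>2) \<le> 9 * real K powr (2 * log_exponent \<theta> - 1)"
    by auto
qed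

text \<open>All K = m k levels receive the same share N of the dimensions, about n/K each, so the
  squared error per level is of order K/n. Since 2^k \<ge> n, the squared trivial weight 2^(-l/m)
  has fallen to at most 1/n at l = K and decays geometrically from there.\<close>

lemma besov_width_upper_moment:
  assumes m: "m = 2^s" and q: "0 < q" "q \<le> 2 * real m"
  shows "\<exists>C>0. \<forall>\<theta> n. 1 \<le> \<theta> \<longrightarrow> 2 \<le> n \<longrightarrow> besov_width q \<theta> n
    \<le> ennreal (C * real n powr (-1/2) * ln (real n) powr log_exponent \<theta>)"
proof -
  have m1: "real m \<ge> 1" using m by simp
  define \<rho> :: real where "\<rho> = 2 powr (- 1 / real m)"
  have \<rho>: "0 < \<rho>" "\<rho> < 1" using m1 by (auto simp: \<rho>_def powr_less_one)
  \<comment> \<open>288 = 16 * 2 * 9 collects the constant of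
    \<open>random_subspace_approximation\<close>, the loss in 1/(N+1) \<le> 2K/n and the bound 9 of
    \<open>besov_slopes_bounds\<close>; 9 / (1 - \<rho>) is the geometric tail with b_l \<le>
    3.\<close>
  define D where "D = 288 * real m + 9 / (1 - \<rho>)"
  have D0: "D > 0" using \<rho> m1 by (auto simp: D_def intro!: add_pos_pos)
  define C where "C = sqrt (8 * real m * D) * (3 * real m)"
  have "C > 0" using D0 m1 by (simp add: C_def)
  moreover have "besov_width q \<theta> n
    \<le> ennreal (C * real n powr (-1/2) * ln (real n) powr log_exponent \<theta>)"
    if \<theta>: "1 \<le> \<theta>" and n: "2 \<le> n" for \<theta> n
  proof -
    define k where "k = nat \<lceil>log 2 (real n)\<rceil>"
    have lg: "log 2 (real n) \<ge> 1" using n by (simp add: le_log_iff)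
    have kr: "real k = of_int \<lceil>log 2 (real n)\<rceil>" using lg by (simp add: k_def)
    have k: "log 2 (real n) \<le> real k" "real k \<le> 2 * log 2 (real n)" unfolding kr using lg by linarith+
    have "real n = 2 powr (log 2 (real n))" using n by simp
    also have "\<dots> \<le> 2 powr real k" using k by (intro powr_mono) auto
    finally have nk: "real n \<le> 2^k" by (simp add: powr_realpow)
    define K where "K = m * k"
    have k1: "k \<ge> 1" using k lg by linarith
    have K0: "K > 0" using m1 k1 by (simp add: K_def)
    \<comment> \<open>One dimension is reserved for the constants. For small n the share may be 0,
      which the form N+1 of the error bound admits.\<close>
    define N where "N = (n - 1) div K"
    have "K * N \<le> n - 1" unfolding N_def by (rule times_div_less_eq_dividend)
    then have KN: "1 + K * N \<le> n" using n by linarith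
    have N1: "1 / real (N+1) \<le> 2 * real K / real n"
    proof -
      have "n - 1 < K * (N + 1)" using K0 by (simp add: N_def dividend_less_times_div)
      then have "n \<le> K * (N+1)" by linarith
      then have "real n \<le> real K * real (N+1)" by (metis of_nat_le_iff of_nat_mult)
      then have "real n \<le> 2 * real K * real (N+1)" using K0 by linarith
      then show ?thesis using n by (simp add: field_simps)
    qed
    let ?e = "2 * log_exponent \<theta> - 1"
    have e0: "?e \<ge> 0" using log_exponent_bounds[OF \<theta>] by simp
    define X where "X = D * real K powr (1 + ?e) / real n"
    have X0: "X > 0" using D0 K0 n by (simp add: X_def)
    have "besov_width q \<theta> n \<le> ennreal (sqrt (8 * real m * X))"
    proof (rule kolmogorov_width_le_of_slopes[OF m q KN X0])
      fix f M assume f: "f \<in> besov_class 1 1 \<theta> 0 1"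
      define b where "b l = (\<Sum>j<2^l. \<bar>dslope f l j\<bar>)" for l
      have b0: "b l \<ge> 0" for l by (simp add: b_def sum_nonneg)
      have b3: "b l \<le> 3" for l unfolding b_def by (rule besov_slopes_bounds(1)[OF f \<theta>])
      have bK: "(\<Sum>l<K. (b l)\<^sup>2) \<le> 9 * real K powr ?e" unfolding b_def by (rule besov_slopes_bounds(2)[OF f \<theta> K0])
      let ?w = "\<lambda>l. if l < K then sqrt (16 * real m / real (N+1)) else 2 powr (- real l / (2 * real m))"
      have "(\<Sum>l<M. (?w l * b l)\<^sup>2) \<le> (\<Sum>l\<in>{..<K} \<union> {K..<M}. (?w l * b l)\<^sup>2)"
        by (intro sum_mono2) auto
      also have "\<dots> = (\<Sum>l<K. (?w l * b l)\<^sup>2) + (\<Sum>l\<in>{K..<M}. (?w l * b l)\<^sup>2)"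
        by (intro sum.union_disjoint) auto
      also have "(\<Sum>l<K. (?w l * b l)\<^sup>2) = 16 * real m * (1 / real (N+1)) * (\<Sum>l<K. (b l)\<^sup>2)"
        by (simp add: power_mult_distrib sum_distrib_left)
      also have "\<dots> \<le> 16 * real m * (2 * real K / real n) * (9 * real K powr ?e)"
        using N1 bK by (intro mult_mono) (auto intro: sum_nonneg)
      also have "\<dots> = 288 * real m * real K powr (1 + ?e) / real n"
        unfolding powr_add using K0 by simp
      also have "(\<Sum>l\<in>{K..<M}. (?w l * b l)\<^sup>2) \<le> (\<Sum>l\<in>{K..<M}. \<rho>^l * 9)"
      proof (intro sum_mono)
        fix l assume l: "l \<in> {K..<M}"
        have "(2 powr (- real l / (2 * real m)))\<^sup>2 = \<rho>^l"
          by (simp add: \<rho>_def powr_realpow[symmetric] powr_powr power2_eq_square powr_add[symmetric])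
        then have "(?w l * b l)\<^sup>2 = \<rho>^l * (b l)\<^sup>2" using l by (simp add: power_mult_distrib)
        also have "\<dots> \<le> \<rho>^l * 3\<^sup>2" using \<rho> b0 b3 by (intro mult_left_mono power_mono) auto
        finally show "(?w l * b l)\<^sup>2 \<le> \<rho>^l * 9" by simp
      qed
      also have "\<dots> \<le> 9 / (1 - \<rho>) * \<rho>^K"
      proof -
        have "(\<Sum>l\<in>{K..<M}. \<rho>^l) * 9 \<le> \<rho>^K / (1 - \<rho>) * 9"
          using \<rho> by (intro mult_right_mono sum_geometric_tail_le) auto
        then show ?thesis by (simp add: sum_distrib_right[symmetric] mult.commute)
      qed
      also have "9 / (1 - \<rho>) * \<rho>^K \<le> 9 / (1 - \<rho>) * (real K powr (1 + ?e) / real n)"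
      proof (intro mult_left_mono)
        have "\<rho>^K = 1 / 2^k"
        proof -
          have "\<rho>^K = \<rho> powr real K" using \<rho> by (simp add: powr_realpow)
          also have "\<dots> = 2 powr (- 1 / real m * real K)" unfolding \<rho>_def by (rule powr_powr)
          also have "- 1 / real m * real K = - real k" using m1 by (simp add: K_def)
          finally show ?thesis by (simp add: powr_minus_divide powr_realpow)
        qed
        also have "\<dots> \<le> 1 / real n" using nk n by (intro divide_left_mono) auto
        also have "\<dots> \<le> real K powr (1 + ?e) / real n"
          using K0 e0 ge_one_powr_ge_zero[of "real K" "1 + ?e"] by (intro divide_right_mono) auto
        finally show "\<rho>^K \<le> real K powr (1 + ?e) / real n" .
      qed (use \<rho> in simp)
      finally have "(\<Sum>l<M. (?w l * b l)\<^sup>2) \<le> X"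
        by (simp add: X_def D_def distrib_right add_divide_distrib)
      then show "(\<Sum>l<M. (?w l * (\<Sum>j<2^l. \<bar>dslope f l j\<bar>))\<^sup>2) \<le> X" by (simp add: b_def)
    qed (auto dest: besov_class_1_1D)
    also have "sqrt (8 * real m * X) \<le> C * real n powr (-1/2) * ln (real n) powr log_exponent \<theta>"
    proof -
      have "sqrt (8 * real m * X) = sqrt (8 * real m * D) * sqrt (real K powr (1 + ?e)) * (1 / sqrt (real n))"
        by (simp add: X_def real_sqrt_mult real_sqrt_divide)
      also have "1 / sqrt (real n) = real n powr (-1/2)"
        using n by (simp add: powr_minus_divide powr_half_sqrt)
      also have "sqrt (real K powr (1 + ?e)) = real K powr log_exponent \<theta>"
        by (simp add: powr_half_sqrt[symmetric] powr_powr)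
      finally have eq: "sqrt (8 * real m * X) = sqrt
          (8 * real m * D) * real K powr log_exponent \<theta> * real n powr (-1/2)" .
      have "real K powr log_exponent \<theta> \<le> (3 * real m * ln (real n)) powr log_exponent \<theta>"
      proof (rule powr_mono2)
        have "ln 2 \<ge> (2/3::real)" by (rule ln2_ge_two_thirds)
        then have "2 * log 2 (real n) \<le> 3 * ln (real n)"
          using n by (simp add: log_def field_simps)
        then have "real k \<le> 3 * ln (real n)" using k by linarith
        then have "real m * real k \<le> real m * (3 * ln (real n))" by (intro mult_left_mono) auto
        then show "real K \<le> 3 * real m * ln (real n)" by (simp add: K_def mult_ac)
      qed (use log_exponent_bounds[OF \<theta>] in auto)
      also have "\<dots> = (3 * real m) powr log_exponent \<theta> * ln (real n) powr log_exponent \<theta>"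
        using n by (subst powr_mult) auto
      also have "\<dots> \<le> (3 * real m) powr 1 * ln (real n) powr log_exponent \<theta>"
        using log_exponent_bounds[OF \<theta>] m1 by (intro mult_right_mono powr_mono) auto
      finally have "real K powr log_exponent \<theta> \<le> 3 * real m * ln
          (real n) powr log_exponent \<theta>" using m1 by simp
      then have "sqrt (8 * real m * D) * real K powr log_exponent \<theta> * real n powr (-1/2)
          \<le> sqrt (8 * real m * D) * (3 * real m * ln (real n) powr log_exponent \<theta>) * real n powr (-1/2)"
        using D0 m1 by (intro mult_right_mono mult_left_mono) auto
      then show ?thesis unfolding eq C_def by (simp only: mult_ac)
    qed
    finally show ?thesis by (simp add: ennreal_leI)
  qed
  ultimately show ?thesis by blast
qed

lemma besov_width_upper:
  assumes q: "2 < q"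
  shows "\<exists>C>0. \<forall>\<theta> n. 1 \<le> \<theta> \<longrightarrow> 2 \<le> n \<longrightarrow> besov_width q \<theta> n
    \<le> ennreal (C * real n powr (-1/2) * ln (real n) powr log_exponent \<theta>)"
proof -
  obtain s :: nat where "q < 2^s" using real_arch_pow[of 2 q] by auto
  then have "q \<le> 2 * real (2^s)" using q by simp
  then show ?thesis using besov_width_upper_moment[OF refl, of q s] q by simp
qed

section \<open>Operators of finite rank\<close>

definition ip :: "nat \<Rightarrow> (nat \<Rightarrow> real) \<Rightarrow> (nat \<Rightarrow> real) \<Rightarrow> real" where
  "ip N u v = (\<Sum>i<N. u i * v i)"

lemma ip_commute: "ip N u v = ip N v u"
  by (simp add: ip_def mult.commute)

lemma ip_self_nonneg: "0 \<le> ip N u u"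
  by (simp add: ip_def sum_nonneg)

lemma ip_self_eq_0: "ip N u u = 0 \<Longrightarrow> i < N \<Longrightarrow> u i = 0"
  by (simp add: ip_def sum_nonneg_eq_0_iff)

lemma ip_add_left: "ip N (\<lambda>i. u i + v i) w = ip N u w + ip N v w"
  by (simp add: ip_def distrib_right sum.distrib)

lemma ip_diff_left: "ip N (\<lambda>i. u i - v i) w = ip N u w - ip N v w"
  by (simp add: ip_def left_diff_distrib sum_subtractf)

lemma ip_scale_left: "ip N (\<lambda>i. c * u i) w = c * ip N u w"
  by (simp add: ip_def sum_distrib_left mult.assoc)

lemma ip_sum_left: "ip N (\<lambda>i. \<Sum>s\<in>S. c s * u s i) w = (\<Sum>s\<in>S. c s * ip N (u s) w)"
proof -
  have "ip N (\<lambda>i. \<Sum>s\<in>S. c s * u s i) w = (\<Sum>i<N. \<Sum>s\<in>S. c s * (u s i * w i))"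
    by (simp add: ip_def sum_distrib_right mult.assoc)
  also have "\<dots> = (\<Sum>s\<in>S. \<Sum>i<N. c s * (u s i * w i))" by (rule sum.swap)
  also have "\<dots> = (\<Sum>s\<in>S. c s * ip N (u s) w)" by (simp add: ip_def sum_distrib_left)
  finally show ?thesis .
qed

lemma gram_schmidt:
  fixes g :: "nat \<Rightarrow> nat \<Rightarrow> real"
  assumes g: "\<And>t i. N \<le> i \<Longrightarrow> g t i = 0"
  shows "\<exists>b. (\<forall>s i. N \<le> i \<longrightarrow> b s i = 0) \<and>
    (\<forall>s<n. \<forall>t<n. s \<noteq> t \<longrightarrow> ip N (b s) (b t) = 0) \<and>
    (\<forall>s<n. ip N (b s) (b s) = 0 \<or> ip N (b s) (b s) = 1) \<and>
    (\<forall>c i. (\<Sum>t<n. c t * g t i) = (\<Sum>s<n. ip N (\<lambda>i. \<Sum>t<n. c t * g t i) (b s) * b s i))"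
proof (induction n)
  case 0
  show ?case by (intro exI[of _ "\<lambda>_ _. 0"]) simp
next
  case (Suc n)
  then obtain b where b0: "\<And>s i. N \<le> i \<Longrightarrow> b s i = 0"
    and orth: "\<And>s t. s < n \<Longrightarrow> t < n \<Longrightarrow> s \<noteq> t \<Longrightarrow> ip N (b s) (b t) = 0"
    and norm: "\<And>s. s < n \<Longrightarrow> ip N (b s) (b s) = 0 \<or> ip N (b s) (b s) = 1"
    and span: "\<And>c i. (\<Sum>t<n. c t * g t i) = (\<Sum>s<n. ip N (\<lambda>i. \<Sum>t<n. c t * g t i) (b s) * b s i)"
    by blast
  define r where "r i = g n i - (\<Sum>s<n. ip N (g n) (b s) * b s i)" for i
  define \<nu> where "\<nu> = sqrt (ip N r r)"
  \<comment> \<open>If the residual r vanishes, then \<nu> = 0 and division by zero makes e the zero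
    vector.\<close>
  define e where "e i = r i / \<nu>" for i
  have r0: "N \<le> i \<Longrightarrow> r i = 0" for i using g b0 by (simp add: r_def)
  have re: "r i = \<nu> * e i" for i
  proof (cases "\<nu> = 0")
    case True
    then have "r i = 0" using ip_self_eq_0[of N r i] r0[of i] by (cases "i < N") (auto simp: \<nu>_def)
    then show ?thesis by (simp add: e_def)
  qed (simp add: e_def)
  have rb: "ip N r (b t) = 0" if t: "t < n" for t
  proof -
    have "(\<Sum>s<n. ip N (g n) (b s) * ip N (b s) (b t)) = (\<Sum>s<n. if s
        = t then ip N (g n) (b t) * ip N (b t) (b t) else 0)"
      using orth t by (intro sum.cong) auto
    also have "\<dots> = ip N (g n) (b t) * ip N (b t) (b t)" using t by simp
    also have "\<dots> = ip N (g n) (b t)"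
    proof (cases "ip N (b t) (b t) = 0")
      case True
      then have "ip N (g n) (b t) = 0" using ip_self_eq_0[OF True] by (simp add: ip_def)
      then show ?thesis by simp
    next
      case False
      then show ?thesis using norm[OF t] by simp
    qed
    finally show ?thesis unfolding r_def ip_diff_left ip_sum_left by simp
  qed
  have eb: "ip N e (b t) = 0" if "t < n" for t
    using rb[OF that] ip_scale_left[of N "1/\<nu>" r "b t"] by (simp add: e_def[abs_def])
  have be: "ip N (b t) e = 0" if "t < n" for t
    using eb[OF that] ip_commute[of N e "b t"] by simp
  have ee: "ip N e e = 0 \<or> ip N e e = 1"
  proof -
    have "ip N e e = ip N r r / \<nu>\<^sup>2"
      by (simp add: ip_def e_def power2_eq_square sum_divide_distrib)
    also have "\<nu>\<^sup>2 = ip N r r" using ip_self_nonneg[of N r] by (simp add: \<nu>_def)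
    finally show ?thesis by auto
  qed
  define b' where "b' = b(n := e)"
  have span': "(\<Sum>t<Suc n. c t * g t i) = (\<Sum>s<Suc n. ip N (\<lambda>i. \<Sum>t<Suc n. c t * g t i) (b' s) * b' s i)" for c i
  proof -
    define v where "v i = (\<Sum>t<n. c t * g t i)" for i
    define u where "u i = (\<Sum>t<Suc n. c t * g t i)" for i
    have u: "u = (\<lambda>i. v i + c n * g n i)" by (auto simp: u_def v_def)
    have vrep: "v = (\<lambda>i. \<Sum>s<n. ip N v (b s) * b s i)" unfolding v_def by (rule ext) (rule span)
    have "ip N v e = (\<Sum>s<n. ip N v (b s) * ip N (b s) e)"
      by (subst vrep) (rule ip_sum_left)
    then have ve: "ip N v e = 0" using be by simp
    have gn: "g n = (\<lambda>i. \<nu> * e i + (\<Sum>s<n. ip N (g n) (b s) * b s i))"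
      by (auto simp: re[symmetric] r_def)
    have "ip N (g n) e = \<nu> * ip N e e + (\<Sum>s<n. ip N (g n) (b s) * ip N (b s) e)"
      by (subst gn) (simp only: ip_add_left ip_scale_left ip_sum_left)
    then have ge: "ip N (g n) e = \<nu> * ip N e e" using be by simp
    have ue: "ip N u e * e i = c n * \<nu> * e i"
    proof (cases "ip N e e = 0")
      case True
      then have "e i = 0" using ip_self_eq_0[OF True] r0[of i] by (cases "i < N") (auto simp: e_def)
      then show ?thesis by simp
    next
      case False
      then have "ip N e e = 1" using ee by simp
      then show ?thesis unfolding u ip_add_left ip_scale_left ve ge by simp
    qed
    have ub: "ip N u (b s) = ip N v (b s) + c n * ip N (g n) (b s)" for s
      unfolding u ip_add_left ip_scale_left ..
    have "(\<Sum>s<Suc n. ip N u (b' s) * b' s i) = (\<Sum>s<n. ip N u (b s) * b s i) + ip N u e * e i"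
      by (simp add: b'_def)
    also have "\<dots> = (\<Sum>s<n. ip N v (b s) * b s i) + c n * (\<Sum>s<n. ip N (g n) (b s) * b s i) + c n * \<nu> * e i"
      unfolding ub ue by (simp add: distrib_right sum.distrib sum_distrib_left mult.assoc)
    also have "\<dots> = v i + c n * g n i"
      using fun_cong[OF vrep, of i] fun_cong[OF gn, of i] by (simp add: algebra_simps)
    also have "\<dots> = u i" by (simp add: u)
    finally show ?thesis unfolding u_def by (rule sym)
  qed
  have "\<forall>s i. N \<le> i \<longrightarrow> b' s i = 0" using b0 r0 by (auto simp: b'_def e_def)
  moreover have "\<forall>s<Suc n. \<forall>t<Suc n. s \<noteq> t \<longrightarrow> ip N (b' s) (b' t) = 0"
    using orth eb be by (auto simp: b'_def less_Suc_eq)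
  moreover have "\<forall>s<Suc n. ip N (b' s) (b' s) = 0 \<or> ip N (b' s) (b' s) = 1"
    using norm ee by (auto simp: b'_def less_Suc_eq)
  ultimately show ?case using span' by blast
qed

text \<open>The trace of an operator of rank at most n is at most the square root of n times its Hilbert-Schmidt norm.\<close>

lemma rank_inequality:
  fixes g :: "nat \<Rightarrow> nat \<Rightarrow> real" and Z :: "'a \<Rightarrow> (nat \<Rightarrow> real) \<Rightarrow> real"
  assumes g: "\<And>t i. N \<le> i \<Longrightarrow> g t i = 0" and fin: "finite \<Omega>"
    and p: "\<And>\<omega>. \<omega> \<in> \<Omega> \<Longrightarrow> 0 \<le> p \<omega>" and B: "0 \<le> B"
    and lin: "\<And>\<omega> a b. \<omega> \<in> \<Omega> \<Longrightarrow> Z \<omega> (\<lambda>i. \<Sum>s<n. a s * b s i) = (\<Sum>s<n. a s * Z \<omega> (b s))"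
    and bessel: "\<And>b. (\<Sum>\<omega>\<in>\<Omega>. p \<omega> * (Z \<omega> b)\<^sup>2) \<le> B * ip N b b"
    and y: "\<And>\<omega>. \<omega> \<in> \<Omega> \<Longrightarrow> y \<omega> = (\<lambda>i. \<Sum>t<n. c \<omega> t * g t i)"
  shows "(\<Sum>\<omega>\<in>\<Omega>. p \<omega> * Z \<omega> (y \<omega>))\<^sup>2 \<le> real n * B * (\<Sum>\<omega>\<in>\<Omega>. p \<omega> * ip N (y \<omega>) (y \<omega>))"
proof -
  obtain b where b0: "\<And>s i. N \<le> i \<Longrightarrow> b s i = 0"
    and orth: "\<And>s t. s < n \<Longrightarrow> t < n \<Longrightarrow> s \<noteq> t \<Longrightarrow> ip N (b s) (b t) = 0"
    and norm: "\<And>s. s < n \<Longrightarrow> ip N (b s) (b s) = 0 \<or> ip N (b s) (b s) = 1"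
    and span: "\<And>c i. (\<Sum>t<n. c t * g t i) = (\<Sum>s<n. ip N (\<lambda>i. \<Sum>t<n. c t * g t i) (b s) * b s i)"
    using gram_schmidt[of N g n, OF g] by blast
  have rep: "y \<omega> = (\<lambda>i. \<Sum>s<n. ip N (y \<omega>) (b s) * b s i)" if "\<omega> \<in> \<Omega>" for \<omega>
    unfolding y[OF that] by (rule ext) (rule span)
  \<comment> \<open>Expanding \<open>y \<omega>\<close> in the orthonormal system writes the trace
    as a sum over pairs (\<omega>, s). Cauchy-Schwarz separates the coordinates of
    \<open>y \<omega>\<close>, which give the Hilbert-Schmidt norm, from the values
    \<open>Z \<omega> (b s)\<close>, whose weighted squares the Bessel hypothesis bounds by B for
    each of the n vectors.\<close>
  define S where "S = \<Omega> \<times> {..<n}"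
  define u where "u = (\<lambda>(\<omega>, s). sqrt (p \<omega>) * ip N (y \<omega>) (b s))"
  define v where "v = (\<lambda>(\<omega>, s). sqrt (p \<omega>) * Z \<omega> (b s))"
  have "(\<Sum>\<omega>\<in>\<Omega>. p \<omega> * Z \<omega> (y \<omega>)) = (\<Sum>\<omega>\<in>\<Omega>. \<Sum>s<n. u (\<omega>, s) * v (\<omega>, s))"
  proof (rule sum.cong[OF refl])
    fix \<omega> assume w: "\<omega> \<in> \<Omega>"
    have "Z \<omega> (y \<omega>) = (\<Sum>s<n. ip N (y \<omega>) (b s) * Z \<omega> (b s))"
      by (rule trans[OF arg_cong[where f = "Z \<omega>", OF rep[OF w]] lin[OF w, where a = "\<lambda>s. ip N (y \<omega>)
          (b s)" and b = b]])
    then have "p \<omega> * Z \<omega> (y \<omega>) = p \<omega> * (\<Sum>s<n. ip N (y \<omega>) (b s) * Z \<omega> (b s))" by simp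
    also have "\<dots> = (\<Sum>s<n. u (\<omega>, s) * v (\<omega>, s))"
    proof -
      have "u (\<omega>, s) * v (\<omega>, s) = p \<omega> * (ip N (y \<omega>) (b s) * Z \<omega> (b s))" for s
      proof -
        have "u (\<omega>, s) * v (\<omega>, s) = (sqrt (p \<omega>) * sqrt (p \<omega>)) * (ip N (y \<omega>) (b s) * Z \<omega> (b s))"
          by (simp only: u_def v_def prod.case mult_ac)
        then show ?thesis using p[OF w] by simp
      qed
      then show ?thesis by (simp only: sum_distrib_left)
    qed
    finally show "p \<omega> * Z \<omega> (y \<omega>) = (\<Sum>s<n. u (\<omega>, s) * v (\<omega>, s))" .
  qed
  also have "\<dots> = (\<Sum>x\<in>S. u x * v x)" unfolding S_def by (subst sum.cartesian_product) (simp add: case_prod_beta)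
  finally have "(\<Sum>\<omega>\<in>\<Omega>. p \<omega> * Z \<omega> (y \<omega>))\<^sup>2 \<le> (\<Sum>x\<in>S. (u x)\<^sup>2) * (\<Sum>x\<in>S. (v x)\<^sup>2)"
    using Cauchy_Schwarz_ineq_sum[of u v S] by simp
  also have "\<dots> \<le> (\<Sum>\<omega>\<in>\<Omega>. p \<omega> * ip N (y \<omega>) (y \<omega>)) * (real n * B)"
  proof (rule mult_mono)
    have "(\<Sum>x\<in>S. (u x)\<^sup>2) = (\<Sum>\<omega>\<in>\<Omega>. \<Sum>s<n. (u (\<omega>, s))\<^sup>2)"
      unfolding S_def by (subst sum.cartesian_product) (simp add: case_prod_beta)
    also have "\<dots> = (\<Sum>\<omega>\<in>\<Omega>. p \<omega> * ip N (y \<omega>) (y \<omega>))"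
    proof (rule sum.cong[OF refl])
      fix \<omega> assume w: "\<omega> \<in> \<Omega>"
      have "ip N (y \<omega>) (y \<omega>) = (\<Sum>s<n. ip N (y \<omega>) (b s) * ip N (b s) (y \<omega>))"
        by (subst (1) rep[OF w]) (rule ip_sum_left)
      also have "\<dots> = (\<Sum>s<n. (ip N (y \<omega>) (b s))\<^sup>2)"
        by (simp add: power2_eq_square ip_commute[of N "b _" "y \<omega>"])
      finally show "(\<Sum>s<n. (u (\<omega>, s))\<^sup>2) = p \<omega> * ip N (y \<omega>) (y \<omega>)"
        using p[OF w] by (simp add: u_def power_mult_distrib sum_distrib_left)
    qed
    finally show "(\<Sum>x\<in>S. (u x)\<^sup>2) \<le> (\<Sum>\<omega>\<in>\<Omega>. p \<omega> * ip N (y \<omega>) (y \<omega>))" by simp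
    have "(\<Sum>x\<in>S. (v x)\<^sup>2) = (\<Sum>\<omega>\<in>\<Omega>. \<Sum>s<n. (v (\<omega>, s))\<^sup>2)"
      unfolding S_def by (subst sum.cartesian_product) (simp add: case_prod_beta)
    also have "\<dots> = (\<Sum>s<n. \<Sum>\<omega>\<in>\<Omega>. (v (\<omega>, s))\<^sup>2)" by (rule sum.swap)
    also have "\<dots> = (\<Sum>s<n. \<Sum>\<omega>\<in>\<Omega>. p \<omega> * (Z \<omega> (b s))\<^sup>2)"
      using p by (intro sum.cong) (auto simp: v_def power_mult_distrib)
    also have "\<dots> \<le> (\<Sum>s<n. B * 1)"
    proof (rule sum_mono)
      fix s assume "s \<in> {..<n}"
      then have "ip N (b s) (b s) \<le> 1" using norm[of s] by auto
      then show "(\<Sum>\<omega>\<in>\<Omega>. p \<omega> * (Z \<omega> (b s))\<^sup>2) \<le> B * 1"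
        using bessel[of "b s"] B by (meson mult_left_mono order_trans)
    qed
    finally show "(\<Sum>x\<in>S. (v x)\<^sup>2) \<le> real n * B" by simp
  qed (use p in \<open>auto intro!: sum_nonneg mult_nonneg_nonneg ip_self_nonneg\<close>)
  finally show ?thesis by (simp add: mult_ac)
qed

section \<open>Haar functionals on vectors of cell averages\<close>

text \<open>If v lists the averages over the cells of level K, then \<open>coarsen v d\<close> lists
  those of level K - d. Counting steps up from the finest level makes the recursion meaningful, and
  linear, for every vector v.\<close>

fun coarsen :: "(nat \<Rightarrow> real) \<Rightarrow> nat \<Rightarrow> nat \<Rightarrow> real" where
  "coarsen v 0 j = v j"
| "coarsen v (Suc d) j = (coarsen v d (2*j) + coarsen v d (2*j+1)) / 2"

definition coarsen_diff :: "(nat \<Rightarrow> real) \<Rightarrow> nat \<Rightarrow> nat \<Rightarrow> real" where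
  "coarsen_diff v d j = (coarsen v d (2*j+1) - coarsen v d (2*j)) / 2"

lemma coarsen_sum: "coarsen (\<lambda>i. \<Sum>s\<in>S. a s * b s i) d j = (\<Sum>s\<in>S. a s * coarsen (b s) d j)"
  by (induction d arbitrary: j)
    (simp_all add: sum.distrib[symmetric] sum_divide_distrib distrib_left add_divide_distrib)

lemma coarsen_diff_sum: "coarsen_diff (\<lambda>i. \<Sum>s\<in>S. a s * b s i) d j = (\<Sum>s\<in>S. a s * coarsen_diff (b s) d j)"
  unfolding coarsen_diff_def coarsen_sum
  by (simp add: sum_subtractf[symmetric] sum_divide_distrib right_diff_distrib diff_divide_distrib)

lemma coarsen_davg:
  assumes f: "f integrable_on {0..1}" and "d \<le> K" "j < 2^(K-d)"
  shows "coarsen (\<lambda>i. if i < 2^K then davg f K i else 0) d j = davg f (K-d) j"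
  using assms(2,3)
proof (induction d arbitrary: j)
  case (Suc d)
  then have e: "K - d = Suc (K - Suc d)" by simp
  have "2*j+1 < 2^(K-d)" "2*j < 2^(K-d)" using Suc.prems unfolding e by auto
  then show ?case using Suc.IH[of "2*j"] Suc.IH[of "2*j+1"] Suc.prems davg_split[OF f Suc.prems(2)]
    by (simp add: e)
qed simp

lemma coarsen_diff_davg:
  assumes f: "f integrable_on {0..1}" and "d < K" "j < 2^(K-1-d)"
  shows "coarsen_diff (\<lambda>i. if i < 2^K then davg f K i else 0) d j = dhalf f (K-1-d) j"
proof -
  have e: "K - d = Suc (K - 1 - d)" using assms by simp
  have "2*j+1 < 2^(K-d)" "2*j < 2^(K-d)" using assms unfolding e by auto
  then have "coarsen (\<lambda>i. if i < 2^K then davg f K i else 0) d (2*j+1) = davg f (Suc (K-1-d)) (2*j+1)"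
    "coarsen (\<lambda>i. if i < 2^K then davg f K i else 0) d (2*j) = davg f (Suc (K-1-d)) (2*j)"
    unfolding e[symmetric] using assms by (auto intro!: coarsen_davg)
  then show ?thesis by (simp add: coarsen_diff_def dhalf_def)
qed

text \<open>Parseval's identity for the Haar system stopped after L levels; each step is (x^2+y^2)/2
  = ((y-x)/2)^2 + ((x+y)/2)^2. Dropping the second sum leaves the Bessel inequality required by
  \<open>rank_inequality\<close>.\<close>

lemma coarsen_energy:
  assumes "L \<le> K"
  shows "(\<Sum>d<L. (\<Sum>j<2^(K-1-d). (coarsen_diff v d j)\<^sup>2) / 2^(K-1-d))
      + (\<Sum>j<2^(K-L). (coarsen v L j)\<^sup>2) / 2^(K-L)
    = ip (2^K) v v / 2^K"
  using assms
proof (induction L)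
  case 0
  then show ?case by (simp add: ip_def power2_eq_square)
next
  case (Suc L)
  define M where "M = K - Suc L"
  have e: "K - L = Suc M" "K - 1 - L = M" "K - Suc L = M" using Suc.prems by (auto simp: M_def)
  have sq: "(x\<^sup>2 + y\<^sup>2) / 2 = ((y - x) / 2)\<^sup>2 + ((x + y) / 2)\<^sup>2" for x y :: real
    by (simp add: power2_eq_square field_simps)
  have "(\<Sum>j<2^(K-L). (coarsen v L j)\<^sup>2) / 2^(K-L) = (\<Sum>j<2^M. ((coarsen v L (2*j))\<^sup>2
      + (coarsen v L (2*j+1))\<^sup>2) / 2) / 2^M"
    unfolding e power_Suc sum_lessThan_double by (simp add: sum_divide_distrib)
  also have "\<dots> = (\<Sum>j<2^M. (coarsen_diff v L j)\<^sup>2) / 2^M + (\<Sum>j<2^M. (coarsen v (Suc L) j)\<^sup>2) / 2^M"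
    unfolding sq by (simp add: coarsen_diff_def sum.distrib add_divide_distrib)
  finally show ?case using Suc.IH Suc.prems by (simp add: e)
qed

section \<open>Hat functions in Besov classes\<close>

definition hat :: "nat \<Rightarrow> real \<Rightarrow> real \<Rightarrow> real" where
  "hat k c t = max 0 (1 - 2^k * \<bar>t - c\<bar>)"

lemma hat_nonneg: "0 \<le> hat k c t" and hat_le_1: "hat k c t \<le> 1"
  by (simp_all add: hat_def)

lemma continuous_on_hat: "continuous_on A (hat k c)"
  unfolding hat_def by (intro continuous_intros)

lemma borel_measurable_hat [measurable]: "hat k c \<in> borel_measurable borel"
  by (rule borel_measurable_continuous_onI[OF continuous_on_hat])

lemma hat_le_indicator: "hat k c t \<le> indicator {c - 1/2^k..c + 1/2^k} t"
proof -
  have "2^k * \<bar>t - c\<bar> \<ge> 1" if "t \<notin> {c - 1/2^k..c + 1/2^k}"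
  proof -
    have "\<bar>t - c\<bar> \<ge> 1/2^k" using that by auto
    then have "2^k * \<bar>t - c\<bar> \<ge> 2^k * (1/2^k)" by (intro mult_left_mono) auto
    then show ?thesis by simp
  qed
  then show ?thesis using hat_le_1[of k c t] by (auto simp: indicator_def hat_def)
qed

lemma hat_shift: "hat k c (x + a) = hat k (c - a) x"
  by (simp add: hat_def algebra_simps)

text \<open>A hat is a multiple of a second difference of the absolute value, so its own second
  differences reduce to those of |u|, which are nonnegative and live only near the kink.\<close>

lemma hat_eq_abs:
  "hat k c x = 2^k/2 * (\<bar>(x - c) - 1/2^k\<bar> - 2 * \<bar>x - c\<bar> + \<bar>(x - c) + 1/2^k\<bar>)"
proof -
  define w where "w = (1/2^k :: real)"
  have w: "w > 0" "2^k * w = 1" by (simp_all add: w_def)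
  define u where "u = x - c"
  consider "\<bar>u\<bar> \<le> w" | "u > w" | "u < - w" by linarith
  then have "2^k/2 * (\<bar>u - w\<bar> - 2 * \<bar>u\<bar> + \<bar>u + w\<bar>) = max 0 (1 - 2^k * \<bar>u\<bar>)"
  proof cases
    case 1
    then have "\<bar>u - w\<bar> - 2 * \<bar>u\<bar> + \<bar>u + w\<bar> = 2 * (w - \<bar>u\<bar>)" by (smt (verit))
    moreover have "2^k * \<bar>u\<bar> \<le> 2^k * w" using 1 by (intro mult_left_mono) auto
    ultimately show ?thesis using w by (simp add: right_diff_distrib)
  next
    case 2
    then have "\<bar>u - w\<bar> - 2 * \<bar>u\<bar> + \<bar>u + w\<bar> = 0" using w by (smt (verit))
    moreover have "2^k * w \<le> 2^k * \<bar>u\<bar>" using 2 by (intro mult_left_mono) auto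
    ultimately show ?thesis using w by simp
  next
    case 3
    then have "\<bar>u - w\<bar> - 2 * \<bar>u\<bar> + \<bar>u + w\<bar> = 0" using w by (smt (verit))
    moreover have "2^k * w \<le> 2^k * \<bar>u\<bar>" using 3 by (intro mult_left_mono) auto
    ultimately show ?thesis using w by simp
  qed
  then show ?thesis by (simp add: hat_def u_def w_def)
qed

lemma abs_second_difference:
  fixes u :: real
  assumes "0 < h"
  shows "0 \<le> \<bar>u\<bar> - 2 * \<bar>u + h\<bar> + \<bar>u + 2*h\<bar>" "\<bar>u\<bar> - 2 * \<bar>u + h\<bar> + \<bar>u + 2*h\<bar> \<le> 2 * h * indicator {-2*h..0} u"
proof -
  show "0 \<le> \<bar>u\<bar> - 2 * \<bar>u + h\<bar> + \<bar>u + 2*h\<bar>" by (smt (verit))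
  show "\<bar>u\<bar> - 2 * \<bar>u + h\<bar> + \<bar>u + 2*h\<bar> \<le> 2 * h * indicator {-2*h..0} u"
  proof (cases "u \<in> {-2*h..0}")
    case True
    then have "\<bar>u\<bar> = - u" "\<bar>u + 2*h\<bar> = u + 2*h" by auto
    then show ?thesis using True by (simp only: indicator_simps mult_1_right) simp
  next
    case False
    then have "u < -2*h \<or> 0 < u" by auto
    then have "\<bar>u\<bar> - 2 * \<bar>u + h\<bar> + \<bar>u + 2*h\<bar> = 0" using assms by auto
    then show ?thesis using assms by (simp only:) simp
  qed
qed

lemma fwd_diff_hat_le_size:
  "\<bar>fwd_diff 2 h (hat k c) x\<bar> \<le> indicator {c - 1/2^k..c + 1/2^k} x
     + 2 * indicator {c - h - 1/2^k..c - h + 1/2^k} x + indicator {c - 2*h - 1/2^k..c - 2*h + 1/2^k} x"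
  unfolding fwd_diff_2 hat_shift
  using hat_le_indicator[of k c x] hat_le_indicator[of k "c - h" x] hat_le_indicator[of k "c - 2*h" x]
    hat_nonneg[of k c x] hat_nonneg[of k "c - h" x] hat_nonneg[of k "c - 2*h" x]
  unfolding abs_le_iff by (intro conjI) linarith+

lemma fwd_diff_hat_le_smooth:
  assumes h: "0 < h"
  shows "\<bar>fwd_diff 2 h (hat k c) x\<bar> \<le> 2^k * h * indicator {c + 1/2^k - 2*h..c + 1/2^k} x
     + 2 * (2^k * h) * indicator {c - 2*h..c} x + 2^k * h * indicator {c - 1/2^k - 2*h..c - 1/2^k} x"
proof -
  define D where "D u = \<bar>u\<bar> - 2 * \<bar>u + h\<bar> + \<bar>u + 2*h\<bar>" for u :: real
  define w where "w = (1/2^k :: real)"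
  have D: "0 \<le> D u" "D u \<le> 2 * h * indicator {-2*h..0} u" for u
    using abs_second_difference[OF h, of u] by (simp_all add: D_def)
  have "fwd_diff 2 h (hat k c) x = 2^k/2 * (D (x - c - w) - 2 * D (x - c) + D (x - c + w))"
    unfolding fwd_diff_2 hat_eq_abs D_def w_def[symmetric]
    by (simp add: algebra_simps)
  then have "\<bar>fwd_diff 2 h (hat k c) x\<bar> = 2^k/2 * \<bar>D (x - c - w) - 2 * D (x - c) + D (x - c + w)\<bar>"
    by (simp only: abs_mult) simp
  also have "\<dots> \<le> 2^k/2 * (D (x - c - w) + 2 * D (x - c) + D (x - c + w))"
    using D(1)[of "x-c-w"] D(1)[of "x-c"] D(1)[of "x-c+w"] unfolding abs_le_iff
    by (intro mult_left_mono) (auto simp: abs_le_iff)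
  also have "\<dots> \<le> 2^k/2 * (2 * h * indicator {-2*h..0} (x - c - w) + 2 * (2 * h * indicator {-2*h..0} (x
      - c)) + 2 * h * indicator {-2*h..0} (x - c + w))"
    by (intro mult_left_mono add_mono D) auto
  also have "\<dots> = 2^k * h * indicator {c + w - 2*h..c + w} x + 2 * (2^k * h) * indicator {c - 2*h..c} x
      + 2^k * h * indicator {c - w - 2*h..c - w} x"
  proof -
    have "indicator {-2*h..0} (x - c - w) = (indicator {c + w - 2*h..c + w} x :: real)"
      "indicator {-2*h..0} (x - c) = (indicator {c - 2*h..c} x :: real)"
      "indicator {-2*h..0} (x - c + w) = (indicator {c - w - 2*h..c - w} x :: real)"
      by (auto simp: indicator_def)
    then show ?thesis by (simp add: algebra_simps)
  qed
  finally show ?thesis by (simp add: w_def)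
qed

lemma nn_integral_le_indicators:
  fixes u :: "real \<Rightarrow> real"
  assumes a: "0 \<le> a1" "0 \<le> a2" "0 \<le> a3" and l: "\<And>i. l i \<le> r i"
    and u: "\<And>x. \<bar>u x\<bar> \<le> a1 * indicator {l 1..r 1} x + a2 * indicator {l 2..r 2} x
        + a3 * indicator {l (3::nat)..r 3} x"
  shows "(\<integral>\<^sup>+ x. ennreal (indicator S x * \<bar>u x\<bar>) \<partial>lebesgue)
      \<le> ennreal (a1 * (r 1 - l 1) + a2 * (r 2 - l 2) + a3 * (r 3 - l 3))"
proof -
  have [measurable]: "{a..b::real} \<in> sets lebesgue" for a b by simp
  have "(\<integral>\<^sup>+ x. ennreal (indicator S x * \<bar>u x\<bar>) \<partial>lebesgue)
      \<le> (\<integral>\<^sup>+ x. ennreal a1 * indicator {l 1..r 1} x + ennreal a2 * indicator {l 2..r 2} x + ennreal a3 * indicator {l 3..r 3} x \<partial>lebesgue)"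
  proof (rule nn_integral_mono)
    fix x
    have "indicator S x * \<bar>u x\<bar> \<le> a1 * indicator {l 1..r 1} x + a2 * indicator {l 2..r 2} x
        + a3 * indicator {l 3..r 3} x"
      using u[of x] a by (auto simp: indicator_def)
    then have "ennreal (indicator S x * \<bar>u x\<bar>) \<le> ennreal (a1 * indicator {l 1..r 1} x
        + a2 * indicator {l 2..r 2} x + a3 * indicator {l 3..r 3} x)"
      by (rule ennreal_leI)
    also have "\<dots> = ennreal a1 * indicator {l 1..r 1} x + ennreal a2 * indicator {l 2..r 2} x
        + ennreal a3 * indicator {l 3..r 3} x"
      using a by (simp add: ennreal_mult' ennreal_indicator)
    finally show "ennreal (indicator S x * \<bar>u x\<bar>) \<le> \<dots>" .
  qed
  also have "\<dots> = ennreal a1 * ennreal (r 1 - l 1) + ennreal a2 * ennreal (r 2 - l 2)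
      + ennreal a3 * ennreal (r 3 - l 3)"
    using l by (simp add: nn_integral_add nn_integral_cmult_indicator)
  also have "\<dots> = ennreal (a1 * (r 1 - l 1) + a2 * (r 2 - l 2) + a3 * (r 3 - l 3))"
    using a l by (simp add: ennreal_mult')
  finally show ?thesis .
qed

text \<open>For a large step the difference is bounded by three translates of the hat with weights
  1, 2, 1 and supports of length 2/2^k. For a small step it lives near the three kinks, with height
  at most 2^k h times 1, 2, 1 on intervals of length 2h. Both counts give the constant 8.\<close>

lemma nn_integral_fwd_diff_hat:
  assumes h: "0 < h"
  shows "(\<integral>\<^sup>+ x. ennreal (indicator S x * \<bar>fwd_diff 2 h (hat k c) x\<bar>) \<partial>lebesgue)
      \<le> ennreal (8 * min (1/2^k) (2^k * h\<^sup>2))"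
proof -
  have "(\<integral>\<^sup>+ x. ennreal (indicator S x * \<bar>fwd_diff 2 h (hat k c) x\<bar>) \<partial>lebesgue) \<le> ennreal (8 * (1/2^k))"
    using nn_integral_le_indicators[of 1 2 1 "\<lambda>i. c - (real i - 1) * h - 1/2^k" "\<lambda>i. c - (real i - 1) * h
        + 1/2^k" "fwd_diff 2 h (hat k c)" S]
      fwd_diff_hat_le_size[of h k c] by simp
  moreover have "(\<integral>\<^sup>+ x. ennreal (indicator S x * \<bar>fwd_diff 2 h (hat k c) x\<bar>) \<partial>lebesgue)
      \<le> ennreal (8 * (2^k * h\<^sup>2))"
    using nn_integral_le_indicators[of "2^k * h" "2 * (2^k * h)" "2^k * h" "\<lambda>i. c + (2 - real i) * (1/2^k)
        - 2*h" "\<lambda>i. c + (2 - real i) * (1/2^k)" "fwd_diff 2 h (hat k c)" S]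
      fwd_diff_hat_le_smooth[OF h, of k c] h by (simp add: power2_eq_square mult_ac)
  ultimately show ?thesis by (simp add: min_def)
qed

lemma modulus_hat_sum_le:
  fixes c :: "nat \<Rightarrow> real"
  assumes fin: "finite S" and \<kappa>: "0 \<le> \<kappa>"
  shows "modulus 2 1 0 1 (\<lambda>x. \<kappa> * (\<Sum>k\<in>S. hat k (c k) x)) t
      \<le> ennreal (8 * \<kappa> * (\<Sum>k\<in>S. min (1/2^k) (2^k * t\<^sup>2)))"
  unfolding modulus_def
proof (rule SUP_least)
  fix h assume "h \<in> {0<..t}"
  then have h: "0 < h" "h \<le> t" by auto
  define f where "f x = \<kappa> * (\<Sum>k\<in>S. hat k (c k) x)" for x
  define A where "A = {x::real. x \<in> {0..1} \<and> x + real 2 * h \<in> {0..1}}"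
  have A: "A = {0..1-2*h}" using h by (auto simp: A_def)
  have fd: "fwd_diff 2 h f x = \<kappa> * (\<Sum>k\<in>S. fwd_diff 2 h (hat k (c k)) x)" for x
  proof -
    have e: "(\<Sum>k\<in>S. fwd_diff 2 h (hat k (c k)) x)
        = (\<Sum>k\<in>S. hat k (c k) x) - 2 * (\<Sum>k\<in>S. hat k (c k) (x + h)) + (\<Sum>k\<in>S. hat k (c k) (x + 2 * h))"
      unfolding fwd_diff_2 by (simp only: sum.distrib sum_subtractf sum_distrib_left)
    show ?thesis unfolding e fwd_diff_2[of h f] f_def by (simp add: algebra_simps)
  qed
  have meas: "(\<lambda>x. fwd_diff 2 h (hat k (c k)) x) \<in> borel_measurable borel" for k
    unfolding fwd_diff_2 by measurable
  have fmeas: "fwd_diff 2 h f \<in> borel_measurable borel"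
    unfolding fd[abs_def] using meas by measurable
  have sm: "set_borel_measurable lebesgue A (fwd_diff 2 h f)"
    unfolding set_borel_measurable_def A using fmeas
    by (intro borel_measurable_scaleR borel_measurable_indicator) (auto simp: measurable_completion)
  have ind[measurable]: "A \<in> sets borel" by (simp add: A)
  have "(\<integral>\<^sup>+ x. ennreal (indicator A x * \<bar>fwd_diff 2 h f x\<bar> powr 1) \<partial>lebesgue)
      \<le> (\<integral>\<^sup>+ x. (\<Sum>k\<in>S. ennreal \<kappa> * ennreal (indicator A x * \<bar>fwd_diff 2 h (hat k (c k)) x\<bar>)) \<partial>lebesgue)"
  proof (rule nn_integral_mono)
    fix x
    have "indicator A x * \<bar>fwd_diff 2 h f x\<bar> \<le> indicator A x * (\<kappa> * (\<Sum>k\<in>S. \<bar>fwd_diff 2 h (hat k (c k)) x\<bar>))"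
      unfolding fd using \<kappa> by (intro mult_left_mono) (auto simp: abs_mult intro!: mult_left_mono)
    also have "\<dots> = (\<Sum>k\<in>S. \<kappa> * (indicator A x * \<bar>fwd_diff 2 h (hat k (c k)) x\<bar>))"
      by (simp add: sum_distrib_left mult_ac)
    finally have "ennreal (indicator A x * \<bar>fwd_diff 2 h f x\<bar>)
        \<le> ennreal (\<Sum>k\<in>S. \<kappa> * (indicator A x * \<bar>fwd_diff 2 h (hat k (c k)) x\<bar>))"
      by (rule ennreal_leI)
    also have "\<dots> = (\<Sum>k\<in>S. ennreal \<kappa> * ennreal (indicator A x * \<bar>fwd_diff 2 h (hat k (c k)) x\<bar>))"
      using \<kappa> by (simp add: ennreal_mult'[symmetric])
    finally show "ennreal (indicator A x * \<bar>fwd_diff 2 h f x\<bar> powr 1)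
      \<le> (\<Sum>k\<in>S. ennreal \<kappa> * ennreal (indicator A x * \<bar>fwd_diff 2 h (hat k (c k)) x\<bar>))" by simp
  qed
  also have "\<dots> = (\<Sum>k\<in>S. ennreal \<kappa> * (\<integral>\<^sup>+ x. ennreal (indicator A x * \<bar>fwd_diff 2 h (hat k
      (c k)) x\<bar>) \<partial>lebesgue))"
  proof -
    have m: "(\<lambda>x. ennreal (indicator A x * \<bar>fwd_diff 2 h (hat k (c k)) x\<bar>)) \<in> borel_measurable lebesgue" for k
    proof -
      have "(\<lambda>x. ennreal (indicator A x * \<bar>fwd_diff 2 h (hat k (c k)) x\<bar>)) \<in> borel_measurable borel"
        using meas by measurable
      then show ?thesis by (simp add: measurable_completion)
    qed
    then show ?thesis by (subst nn_integral_sum) (auto simp: nn_integral_cmult)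
  qed
  also have "\<dots> \<le> (\<Sum>k\<in>S. ennreal \<kappa> * ennreal (8 * min (1/2^k) (2^k * t\<^sup>2)))"
  proof (intro sum_mono mult_left_mono)
    fix k
    have "(\<integral>\<^sup>+ x. ennreal (indicator A x * \<bar>fwd_diff 2 h (hat k (c k)) x\<bar>) \<partial>lebesgue)
        \<le> ennreal (8 * min (1/2^k) (2^k * h\<^sup>2))"
      by (rule nn_integral_fwd_diff_hat[OF h(1)])
    also have "\<dots> \<le> ennreal (8 * min (1/2^k) (2^k * t\<^sup>2))"
      using h by (intro ennreal_leI mult_left_mono min.mono power_mono) auto
    finally show "(\<integral>\<^sup>+ x. ennreal (indicator A x * \<bar>fwd_diff 2 h (hat k (c k)) x\<bar>) \<partial>lebesgue)
        \<le> ennreal (8 * min (1/2^k) (2^k * t\<^sup>2))" .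
  qed auto
  also have "\<dots> = ennreal (8 * \<kappa> * (\<Sum>k\<in>S. min (1/2^k) (2^k * t\<^sup>2)))"
    using \<kappa> by (simp add: ennreal_mult'[symmetric] sum_distrib_left mult_ac)
  finally have "(\<integral>\<^sup>+ x. ennreal (indicator A x * \<bar>fwd_diff 2 h f x\<bar> powr 1) \<partial>lebesgue)
      \<le> ennreal ((8 * \<kappa> * (\<Sum>k\<in>S. min (1/2^k) (2^k * t\<^sup>2))) powr 1)"
    using \<kappa> by (simp add: sum_nonneg)
  then show "Lp_enorm 1 {x. x \<in> {0..1} \<and> x + real 2 * h \<in> {0..1}} (fwd_diff 2 h (\<lambda>x. \<kappa> * (\<Sum>k\<in>S. hat k
      (c k) x)))
      \<le> ennreal (8 * \<kappa> * (\<Sum>k\<in>S. min (1/2^k) (2^k * t\<^sup>2)))"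
    using Lp_enorm_leI(2)[OF sm, of 1] \<kappa> unfolding A_def f_def by (simp add: sum_nonneg)
qed

text \<open>Up to the factor 8 \<kappa> of \<open>modulus_hat_sum_le\<close>, a bound for t^(-1)
  times the modulus of a sum with one hat on each level of \<open>S\<close>. The term of level k is
  a bump with peak 1 at t = 2^(-k).\<close>

definition scale_profile :: "nat set \<Rightarrow> real \<Rightarrow> real" where
  "scale_profile S t = (\<Sum>k\<in>S. min (1/2^k / t) (2^k * t))"

lemma sum_half_powers_le: "finite B \<Longrightarrow> (\<And>k. k \<in> B \<Longrightarrow> a \<le> k) \<Longrightarrow> (\<Sum>k\<in>B. (1/2::real)^k) \<le> 2 * (1/2)^a"
proof -
  assume B: "finite B" "\<And>k. k \<in> B \<Longrightarrow> a \<le> k"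
  define M where "M = Suc (Max (insert a B))"
  have "B \<subseteq> {a..<M}" using B by (auto simp: M_def less_Suc_eq_le)
  then have "(\<Sum>k\<in>B. (1/2::real)^k) \<le> (\<Sum>k\<in>{a..<M}. (1/2)^k)" by (intro sum_mono2) auto
  also have "\<dots> \<le> (1/2)^a / (1 - 1/2)" by (rule sum_geometric_tail_le) auto
  finally show ?thesis by simp
qed

lemma scale_profile_nonneg: "0 < t \<Longrightarrow> 0 \<le> scale_profile S t"
  by (simp add: scale_profile_def sum_nonneg)

text \<open>On either side of 2^k t = 1 the terms are dominated by a geometric series whose largest
  term is at most 1, so each side sums to at most 2. This is why hats on many levels cost nothing
  for \<theta> = \<infinity>.\<close>

lemma scale_profile_le:
  assumes S: "finite S" and t: "0 < t"
  shows "scale_profile S t \<le> 4"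
proof -
  define A where "A = {k\<in>S. 2^k * t \<le> 1}"
  have "(\<Sum>k\<in>A. min (1/2^k / t) (2^k * t)) \<le> 2"
  proof (cases "A = {}")
    case False
    have fA: "finite A" using S by (simp add: A_def)
    define m where "m = Max A"
    have mA: "m \<in> A" using False fA by (simp add: m_def)
    have "(\<Sum>k\<in>A. min (1/2^k / t) (2^k * t)) \<le> (\<Sum>k\<in>A. 2^k * t)" by (intro sum_mono) simp
    also have "\<dots> \<le> (\<Sum>k<Suc m. 2^k * t)"
      using fA t by (intro sum_mono2) (auto simp: m_def less_Suc_eq_le)
    also have "\<dots> = (2^Suc m - 1) * t"
    proof -
      have "(\<Sum>k<j. (2::real)^k) = 2^j - 1" for j by (induction j) auto
      then show ?thesis by (simp only: sum_distrib_right[symmetric])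
    qed
    also have "\<dots> \<le> 2 * (2^m * t)" using t by (simp add: left_diff_distrib)
    also have "\<dots> \<le> 2" using mA by (simp add: A_def)
    finally show ?thesis .
  qed simp
  moreover have "(\<Sum>k\<in>S-A. min (1/2^k / t) (2^k * t)) \<le> 2"
  proof (cases "S - A = {}")
    case False
    have fB: "finite (S-A)" using S by simp
    define m where "m = Min (S-A)"
    have mB: "m \<in> S - A" using Min_in[OF fB False] by (simp add: m_def)
    have "(\<Sum>k\<in>S-A. min (1/2^k / t) (2^k * t)) \<le> (\<Sum>k\<in>S-A. (1/2)^k / t)"
      by (intro sum_mono) (simp add: power_divide)
    also have "\<dots> \<le> 2 * (1/2)^m / t"
      unfolding sum_divide_distrib[symmetric] using t fB
      by (intro divide_right_mono sum_half_powers_le) (auto simp: m_def simp del: DiffE)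
    also have "\<dots> \<le> 2" using mB t by (auto simp: A_def field_simps power_divide)
    finally show ?thesis .
  next
    case True
    then show ?thesis by (simp only: sum.empty)
  qed
  moreover have "scale_profile S t = (\<Sum>k\<in>A. min (1/2^k / t) (2^k * t)) + (\<Sum>k\<in>S-A. min (1/2^k / t) (2^k * t))"
    unfolding scale_profile_def using S by (subst sum.subset_diff[of A S]) (auto simp: A_def)
  ultimately show ?thesis by linarith
qed

text \<open>With respect to dt/t each bump has mass 1 on either side of its peak.\<close>

lemma nn_integral_scale_profile:
  assumes S: "finite S"
  shows "(\<integral>\<^sup>+ t. indicator {0<..} t * ennreal (scale_profile S t) * ennreal (1/t) \<partial>lborel)
      \<le> ennreal (2 * real (card S))"
proof -
  have one: "(\<integral>\<^sup>+ t. indicator {0<..} t * ennreal (min (1/2^k / t) (2^k * t)) * ennreal (1/t) \<partial>lborel)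
      \<le> ennreal 2" for k
  proof -
    define w where "w = (1/2^k :: real)"
    have w: "w > 0" "2^k = 1/w" by (simp_all add: w_def)
    have "(\<integral>\<^sup>+ t. indicator {0<..} t * ennreal (min (w / t) (1/w * t)) * ennreal (1/t) \<partial>lborel)
        \<le> (\<integral>\<^sup>+ t. ennreal (1/w) * indicator {0..w} t + ennreal (w / t\<^sup>2) * indicator {w..} t \<partial>lborel)"
    proof (rule nn_integral_mono)
      fix t :: real
      show "indicator {0<..} t * ennreal (min (w / t) (1/w * t)) * ennreal (1/t)
        \<le> ennreal (1/w) * indicator {0..w} t + ennreal (w / t\<^sup>2) * indicator {w..} t"
      proof (cases "0 < t")
        case True
        have "min (w / t) (1/w * t) * (1/t) \<le> (1/w * t) * (1/t)" using True by (intro mult_right_mono) auto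
        then have a: "min (w / t) (1/w * t) * (1/t) \<le> 1/w" using True by simp
        have "min (w / t) (1/w * t) * (1/t) \<le> (w/t) * (1/t)" using True by (intro mult_right_mono) auto
        then have b: "min (w / t) (1/w * t) * (1/t) \<le> w / t\<^sup>2" using True by (simp add: power2_eq_square)
        have e: "indicator {0<..} t * ennreal (min (w / t) (1/w * t)) * ennreal (1/t)
            = ennreal (min (w / t) (1/w * t) * (1/t))"
          using True w by (simp add: ennreal_mult'[symmetric])
        show ?thesis
        proof (cases "t \<le> w")
          case True
          then show ?thesis unfolding e using a \<open>0 < t\<close> by (intro order.trans[OF ennreal_leI[OF a]]) (simp add: add_increasing2)
        next
          case False
          then show ?thesis unfolding e using b \<open>0 < t\<close> by (intro order.trans[OF ennreal_leI[OF b]]) simp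
        qed
      qed simp
    qed
    also have "\<dots> = ennreal (1/w) * ennreal w + (\<integral>\<^sup>+ t. ennreal (w / t\<^sup>2) * indicator {w..} t \<partial>lborel)"
      using w by (subst nn_integral_add) (auto simp: nn_integral_cmult_indicator)
    also have "(\<integral>\<^sup>+ t. ennreal (w / t\<^sup>2) * indicator {w..} t \<partial>lborel) = ennreal (0 - (- w / w))"
    proof (rule nn_integral_FTC_atLeast[where F = "\<lambda>t. - w / t"])
      fix x assume x: "w \<le> x"
      show "((\<lambda>t. - w / t) has_real_derivative w / x\<^sup>2) (at x)"
        using x w by (auto intro!: derivative_eq_intros simp: power2_eq_square)
      show "0 \<le> w / x\<^sup>2" using w by simp
    next
      show "((\<lambda>t. - w / t) \<longlongrightarrow> 0) at_top"
        by (intro tendsto_divide_0[OF tendsto_const] filterlim_at_top_imp_at_infinity filterlim_ident)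
    qed measurable
    also have "ennreal (1/w) * ennreal w + ennreal (0 - (- w / w)) = ennreal 2"
      using w by (simp add: ennreal_mult'[symmetric] ennreal_plus[symmetric] del: ennreal_plus)
    finally show ?thesis unfolding w(2) w_def[symmetric] by simp
  qed
  have "(\<integral>\<^sup>+ t. indicator {0<..} t * ennreal (scale_profile S t) * ennreal (1/t) \<partial>lborel)
      = (\<integral>\<^sup>+ t. (\<Sum>k\<in>S. indicator {0<..} t * ennreal (min (1/2^k / t) (2^k * t)) * ennreal (1/t)) \<partial>lborel)"
  proof (rule nn_integral_cong)
    fix t :: real
    show "indicator {0<..} t * ennreal (scale_profile S t) * ennreal (1/t)
      = (\<Sum>k\<in>S. indicator {0<..} t * ennreal (min (1/2^k / t) (2^k * t)) * ennreal (1/t))"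
      by (cases "0 < t") (simp_all add: scale_profile_def sum_distrib_right[symmetric])
  qed
  also have "\<dots> = (\<Sum>k\<in>S. \<integral>\<^sup>+ t. indicator {0<..} t * ennreal (min (1/2^k / t) (2^k * t)) * ennreal
      (1/t) \<partial>lborel)"
    by (intro nn_integral_sum) measurable
  also have "\<dots> \<le> (\<Sum>k\<in>S. ennreal 2)" by (intro sum_mono one)
  also have "\<dots> = ennreal (2 * real (card S))" by (simp add: ennreal_of_nat_eq_real_of_nat ennreal_mult'' mult.commute)
  finally show ?thesis .
qed

lemma hat_sum_L1:
  fixes c :: "nat \<Rightarrow> real"
  assumes fin: "finite S" and \<kappa>: "0 \<le> \<kappa>"
  defines "f \<equiv> \<lambda>x. \<kappa> * (\<Sum>k\<in>S. hat k (c k) x)"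
  shows "Lp_mem 1 {0..1} f" "Lp_enorm 1 {0..1} f \<le> ennreal (4 * \<kappa>)"
proof -
  have "f \<in> borel_measurable borel" unfolding f_def by measurable
  then have sm: "set_borel_measurable lebesgue {0..1} f"
    unfolding set_borel_measurable_def
    by (intro borel_measurable_scaleR borel_measurable_indicator) (auto simp: measurable_completion)
  have f0: "f x \<ge> 0" for x unfolding f_def using \<kappa> by (intro mult_nonneg_nonneg sum_nonneg hat_nonneg)
  have [measurable]: "{a..b::real} \<in> sets lebesgue" for a b by simp
  have "(\<integral>\<^sup>+ x. ennreal (indicator {0..1} x * \<bar>f x\<bar> powr 1) \<partial>lebesgue)
      \<le> (\<integral>\<^sup>+ x. (\<Sum>k\<in>S. ennreal \<kappa> * indicator {c k - 1/2^k..c k + 1/2^k} x) \<partial>lebesgue)"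
  proof (rule nn_integral_mono)
    fix x
    have "indicator {0..1} x * \<bar>f x\<bar> \<le> f x" using f0[of x] by (simp add: indicator_def)
    also have "\<dots> \<le> (\<Sum>k\<in>S. \<kappa> * indicator {c k - 1/2^k..c k + 1/2^k} x)"
      unfolding f_def sum_distrib_left using \<kappa> by (intro sum_mono mult_left_mono hat_le_indicator)
    finally have "ennreal (indicator {0..1} x * \<bar>f x\<bar>)
        \<le> ennreal (\<Sum>k\<in>S. \<kappa> * indicator {c k - 1/2^k..c k + 1/2^k} x)"
      by (rule ennreal_leI)
    also have "\<dots> = (\<Sum>k\<in>S. ennreal (\<kappa> * indicator {c k - 1/2^k..c k + 1/2^k} x))"
      using \<kappa> by (intro sum_ennreal[symmetric]) auto
    also have "\<dots> = (\<Sum>k\<in>S. ennreal \<kappa> * indicator {c k - 1/2^k..c k + 1/2^k} x)"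
      using \<kappa> by (intro sum.cong refl) (simp add: ennreal_mult' ennreal_indicator)
    finally show "ennreal (indicator {0..1} x * \<bar>f x\<bar> powr 1)
        \<le> (\<Sum>k\<in>S. ennreal \<kappa> * indicator {c k - 1/2^k..c k + 1/2^k} x)"
      by simp
  qed
  also have "\<dots> = (\<Sum>k\<in>S. \<integral>\<^sup>+ x. ennreal \<kappa> * indicator {c k - 1/2^k..c k + 1/2^k} x \<partial>lebesgue)"
    by (rule nn_integral_sum) measurable
  also have "\<dots> = (\<Sum>k\<in>S. ennreal (\<kappa> * (2 * (1/2)^k)))"
    using \<kappa> by (intro sum.cong refl) (simp add: nn_integral_cmult_indicator ennreal_mult'[symmetric] power_divide)
  also have "\<dots> = ennreal (2 * \<kappa> * (\<Sum>k\<in>S. (1/2)^k))"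
    using \<kappa> by (subst sum_ennreal) (auto simp: sum_distrib_left mult_ac)
  also have "\<dots> \<le> ennreal ((4 * \<kappa>) powr 1)"
    using \<kappa> sum_half_powers_le[OF fin, of 0] mult_left_mono[of "\<Sum>k\<in>S. (1/2)^k" 2 "2 * \<kappa>"]
    by (intro ennreal_leI) simp
  finally show "Lp_mem 1 {0..1} f" "Lp_enorm 1 {0..1} f \<le> ennreal (4 * \<kappa>)"
    using Lp_enorm_leI[OF sm, of 1 "4 * \<kappa>"] \<kappa> by auto
qed

text \<open>The profile lies between 0 and 4, so the r-th power of a quarter of it is at most that
  quarter. The integral for finite \<theta> = r thus reduces to the linear one, which grows like
  \<open>card S\<close>. The centres are arbitrary: only the number of levels enters.\<close>

lemma hat_sum_semi:
  fixes c :: "nat \<Rightarrow> real"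
  assumes fin: "finite S" and \<theta>: "1 \<le> \<theta>" and \<kappa>: "0 \<le> \<kappa>"
  shows "besov_semi 1 1 \<theta> 0 1 (\<lambda>x. \<kappa> * (\<Sum>k\<in>S. hat k (c k) x))
      \<le> ennreal (32 * \<kappa> * real (card S) powr inv_theta \<theta>)"
proof -
  define f where "f x = \<kappa> * (\<Sum>k\<in>S. hat k (c k) x)" for x
  have mod: "ennreal (t powr (-1)) * modulus 2 1 0 1 f t
      \<le> ennreal (8 * \<kappa> * scale_profile S t)" if t: "0 < t" for t
  proof -
    have "ennreal (t powr (-1)) * modulus 2 1 0 1 f t
        \<le> ennreal (1/t) * ennreal (8 * \<kappa> * (\<Sum>k\<in>S. min (1/2^k) (2^k * t\<^sup>2)))"
      unfolding f_def using t by (intro mult_mono modulus_hat_sum_le fin \<kappa>) (auto simp: powr_minus_divide)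
    also have "\<dots> = ennreal (1/t * (8 * \<kappa> * (\<Sum>k\<in>S. min (1/2^k) (2^k * t\<^sup>2))))"
      using t by (simp add: ennreal_mult'[symmetric] del: times_divide_eq_left)
    also have "1/t * (8 * \<kappa> * (\<Sum>k\<in>S. min (1/2^k) (2^k * t\<^sup>2)))
        = 8 * \<kappa> * (\<Sum>k\<in>S. 1/t * min (1/2^k) (2^k * t\<^sup>2))"
      by (simp add: sum_distrib_left mult_ac)
    also have "(\<Sum>k\<in>S. 1/t * min (1/2^k) (2^k * t\<^sup>2)) = scale_profile S t"
      unfolding scale_profile_def using t
      by (intro sum.cong refl) (auto simp: min_def field_simps power2_eq_square)
    finally show ?thesis .
  qed
  have "besov_semi 1 1 \<theta> 0 1 f \<le> ennreal (32 * \<kappa> * real (card S) powr inv_theta \<theta>)"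
  proof (cases "S = {}")
    case True
    then have m0: "modulus 2 1 0 1 f t = 0" for t
      using modulus_hat_sum_le[OF fin \<kappa>, of c t] by (simp add: f_def[abs_def])
    show ?thesis
      by (simp add: besov_semi_def Let_def numeral_2_eq_2[symmetric] m0 enn_powr_def)
  next
    case False
    then have card: "real (card S) \<ge> 1" using fin by (simp add: Suc_le_eq card_gt_0_iff)
    show ?thesis
    proof (cases \<theta>)
      case MInf
      then show ?thesis using \<theta> by simp
    next
      case PInf
      have "ennreal (t powr (-1)) * modulus 2 1 0 1 f t \<le> ennreal (32 * \<kappa>)" if t: "0 < t" for t
      proof -
        have "8 * \<kappa> * scale_profile S t \<le> 8 * \<kappa> * 4" using \<kappa> t by (intro mult_left_mono scale_profile_le fin) auto
        then show ?thesis using order.trans[OF mod[OF t] ennreal_leI] by simp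
      qed
      then show ?thesis
        using PInf card by (auto simp: besov_semi_def Let_def numeral_2_eq_2[symmetric] inv_theta_def intro!: SUP_least)
    next
      case (real r)
      have r: "1 \<le> r" using \<theta> real by simp
      define Q where "Q = (32 * \<kappa>) powr r / 4"
      have Q0: "Q \<ge> 0" by (simp add: Q_def)
      have prof[measurable]: "scale_profile S \<in> borel_measurable borel"
        unfolding scale_profile_def[abs_def] by measurable
      have "(\<integral>\<^sup>+ t. indicator {0<..} t * enn_powr (ennreal (t powr (- 1)) * modulus 2 1 0 1 f t) r * ennreal
          (1 / t) \<partial>lborel)
          \<le> (\<integral>\<^sup>+ t. ennreal Q * (indicator {0<..} t * ennreal (scale_profile S t) * ennreal (1/t)) \<partial>lborel)"
      proof (rule nn_integral_mono)
        fix t :: real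
        show "indicator {0<..} t * enn_powr (ennreal (t powr (- 1)) * modulus 2 1 0 1 f t) r * ennreal (1 / t)
          \<le> ennreal Q * (indicator {0<..} t * ennreal (scale_profile S t) * ennreal (1/t))"
        proof (cases "0 < t")
          case True
          note sp = scale_profile_nonneg[OF True, of S] scale_profile_le[OF fin True]
          have "enn_powr (ennreal (t powr (- 1)) * modulus 2 1 0 1 f t) r
              \<le> enn_powr (ennreal (8 * \<kappa> * scale_profile S t)) r"
            using r by (intro enn_powr_mono mod True) auto
          also have "\<dots> = ennreal ((8 * \<kappa> * scale_profile S t) powr r)"
            using \<kappa> sp by (intro enn_powr_ennreal) auto
          also have "(8 * \<kappa> * scale_profile S t) powr r = ((32 * \<kappa>) * (scale_profile S t / 4)) powr r"
            by (simp add: mult_ac)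
          also have "\<dots> = (32 * \<kappa>) powr r * (scale_profile S t / 4) powr r"
            by (rule powr_mult)
          also have "ennreal \<dots> \<le> ennreal ((32 * \<kappa>) powr r * (scale_profile S t / 4))"
          proof (intro ennreal_leI mult_left_mono)
            have "(scale_profile S t / 4) powr r \<le> (scale_profile S t / 4) powr 1"
              using r sp by (intro powr_mono') auto
            then show "(scale_profile S t / 4) powr r \<le> scale_profile S t / 4" using sp by simp
          qed simp
          also have "(32 * \<kappa>) powr r * (scale_profile S t / 4) = Q * scale_profile S t" by (simp add: Q_def)
          finally have "enn_powr (ennreal (t powr (- 1)) * modulus 2 1 0 1 f t) r
              \<le> ennreal Q * ennreal (scale_profile S t)"
            using Q0 by (simp add: ennreal_mult')
          then have "enn_powr (ennreal (t powr (- 1)) * modulus 2 1 0 1 f t) r * ennreal (1/t)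
              \<le> ennreal Q * ennreal (scale_profile S t) * ennreal (1/t)"
            by (rule mult_right_mono) simp
          then show ?thesis using True by (simp add: mult.assoc)
        qed simp
      qed
      also have "\<dots> = ennreal Q * (\<integral>\<^sup>+ t. indicator {0<..} t * ennreal (scale_profile S t) * ennreal
          (1/t) \<partial>lborel)"
        by (rule nn_integral_cmult) measurable
      also have "\<dots> \<le> ennreal Q * ennreal (2 * real (card S))"
        by (intro mult_left_mono nn_integral_scale_profile fin) simp
      also have "\<dots> = ennreal (Q * (2 * real (card S)))" using Q0 by (simp add: ennreal_mult'[symmetric])
      also have "\<dots> \<le> ennreal ((32 * \<kappa>) powr r * real (card S))"
        by (intro ennreal_leI) (simp add: Q_def)
      finally have "enn_powr (\<integral>\<^sup>+ t. indicator {0<..} t * enn_powr (ennreal (t powr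
          (- 1)) * modulus 2 1 0 1 f t) r * ennreal (1 / t) \<partial>lborel) (1/r)
          \<le> enn_powr (ennreal ((32 * \<kappa>) powr r * real (card S))) (1/r)"
        using r by (intro enn_powr_mono) auto
      also have "\<dots> = ennreal (((32 * \<kappa>) powr r * real (card S)) powr (1/r))"
        by (rule enn_powr_ennreal) simp
      also have "((32 * \<kappa>) powr r * real (card S)) powr (1/r) = 32 * \<kappa> * real (card S) powr (1/r)"
        using \<kappa> r by (simp add: powr_mult powr_powr)
      finally show ?thesis
        using real by (simp add: besov_semi_def Let_def numeral_2_eq_2[symmetric] inv_theta_def)
    qed
  qed
  then show ?thesis by (simp add: f_def[abs_def])
qed

text \<open>The factor 1/64 makes the seminorm bound of \<open>hat_sum_semi\<close> equal to 1/2 and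
  leaves at most 1/16 for the L_1 norm.\<close>

lemma hat_sum_in_besov_class:
  fixes c :: "nat \<Rightarrow> real"
  assumes fin: "finite S" "S \<noteq> {}" and \<theta>: "1 \<le> \<theta>"
  defines "\<kappa> \<equiv> real (card S) powr (- inv_theta \<theta>) / 64"
  shows "(\<lambda>x. \<kappa> * (\<Sum>k\<in>S. hat k (c k) x)) \<in> besov_class 1 1 \<theta> 0 1"
proof -
  have card: "real (card S) \<ge> 1" using fin by (simp add: Suc_le_eq card_gt_0_iff)
  have i0: "inv_theta \<theta> \<ge> 0" using \<theta> by (cases \<theta>) (auto simp: inv_theta_def)
  have \<kappa>: "0 \<le> \<kappa>" by (simp add: \<kappa>_def)
  have "real (card S) powr (- inv_theta \<theta>) \<le> real (card S) powr 0"
    using card i0 by (intro powr_mono) auto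
  then have \<kappa>64: "\<kappa> \<le> 1/64" using card by (simp add: \<kappa>_def)
  have "32 * \<kappa> * real (card S) powr inv_theta \<theta> = 1/2"
    using card by (simp add: \<kappa>_def powr_minus_divide)
  then have semi: "besov_semi 1 1 \<theta> 0 1 (\<lambda>x. \<kappa> * (\<Sum>k\<in>S. hat k (c k) x)) \<le> ennreal (1/2)"
    using hat_sum_semi[OF fin(1) \<theta> \<kappa>, of c] by (simp only:)
  note L1 = hat_sum_L1[OF fin(1) \<kappa>, of c]
  have "ennreal (4 * \<kappa>) \<le> ennreal (1/2)" using \<kappa>64 by (intro ennreal_leI) simp
  then have "Lp_enorm 1 {0..1} (\<lambda>x. \<kappa> * (\<Sum>k\<in>S. hat k (c k) x))
      + besov_semi 1 1 \<theta> 0 1 (\<lambda>x. \<kappa> * (\<Sum>k\<in>S. hat k (c k) x))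
      \<le> ennreal (1/2) + ennreal (1/2)"
    using L1(2) semi by (intro add_mono) auto
  also have "\<dots> = ennreal (1/2 + 1/2)" by (rule ennreal_plus[symmetric]) auto
  also have "\<dots> = 1" by simp
  finally show ?thesis using L1(1) by (simp add: besov_class_def)
qed

section \<open>Lower bound\<close>

lemma Lp_mem_imp_integrable:
  assumes "Lp_mem q {0..1} f" "1 \<le> q"
  shows "set_integrable lebesgue {0..1} f"
proof -
  define e where "e = (LINT x:{0..1}|lebesgue. \<bar>f x\<bar> powr q) powr (1/q) + 1"
  have "Lp_enorm q {0..1} f \<le> ennreal e" using assms by (simp add: Lp_enorm_def e_def ennreal_leI)
  moreover have "e > 0" by (simp add: e_def add_nonneg_pos)
  ultimately show ?thesis using Lp_enorm_le_imp_integrable[OF assms(2)] by blast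
qed

lemma davg_lower_bound:
  assumes f: "f integrable_on {0..1}" and j: "j < 2^l" and a: "\<And>x. x \<in> {dyadic l j..dyadic l (Suc j)} \<Longrightarrow> a
      \<le> f x"
  shows "a \<le> davg f l j"
proof -
  let ?I = "{dyadic l j..dyadic l (Suc j)}"
  have "f integrable_on ?I" using j by (intro dyadic_integrable f) auto
  then have "integral ?I (\<lambda>_. a) \<le> integral ?I f" using a by (intro integral_le) auto
  then have "2^l * (1/2^l * a) \<le> 2^l * integral ?I f" by (intro mult_left_mono) (auto simp: dyadic_Suc)
  then show ?thesis by (simp add: davg_def)
qed

lemma hat_integrable: "hat k c integrable_on {a..b}"
  by (rule integrable_continuous_real[OF continuous_on_hat])

lemma integral_hat_le: "integral {0..1} (hat k c) \<le> 2/2^k"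
proof -
  have ai: "hat k c absolutely_integrable_on {0..1}"
    by (intro nonnegative_absolutely_integrable_1 hat_integrable hat_nonneg)
  have "ennreal (integral {0..1} (hat k c)) = (\<integral>\<^sup>+ x. ennreal (indicator {0..1} x * \<bar>hat k c x\<bar>) \<partial>lebesgue)"
    using ai unfolding set_lebesgue_integral_eq_integral(2)[OF ai, symmetric] set_lebesgue_integral_def set_integrable_def
    by (subst nn_integral_eq_integral) (auto simp: hat_nonneg)
  also have "\<dots> \<le> ennreal (1 * (c + 1/2^k - (c - 1/2^k)) + 0 * (c + 1/2^k - (c - 1/2^k)) + 0 * (c + 1/2^k
      - (c - 1/2^k)))"
    using hat_le_indicator[of k c] hat_nonneg[of k c]
    by (intro nn_integral_le_indicators[of 1 0 0 "\<lambda>_. c - 1/2^k" "\<lambda>_. c + 1/2^k"]) auto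
  finally show ?thesis by simp
qed

text \<open>The averages of a hat lie in [0,1], so their squares are bounded by the averages
  themselves, whose mean is the integral of the hat.\<close>

lemma dyadic_moment_hat: "dyadic_moment 1 K (davg (hat k c) K) \<le> 2/2^k"
proof -
  have bnd: "0 \<le> davg (hat k c) K i \<and> davg (hat k c) K i \<le> 1" if i: "i < 2^K" for i
  proof
    show "0 \<le> davg (hat k c) K i"
      by (rule davg_lower_bound) (auto simp: hat_nonneg hat_integrable i)
    have "integral {dyadic K i..dyadic K (Suc i)} (hat k c) \<le> integral {dyadic K i..dyadic K (Suc i)} (\<lambda>_. 1)"
      by (intro integral_le hat_integrable) (auto simp: hat_le_1)
    then have "2^K * integral {dyadic K i..dyadic K (Suc i)} (hat k c) \<le> 2^K * (1/2^K)"
      by (intro mult_left_mono) (auto simp: dyadic_Suc)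
    then show "davg (hat k c) K i \<le> 1" by (simp add: davg_def)
  qed
  have "(\<Sum>i<2^K. (davg (hat k c) K i)^(2*1)) \<le> (\<Sum>i<2^K. davg (hat k c) K i)"
  proof (intro sum_mono)
    fix i assume "i \<in> {..<(2::nat)^K}"
    then have b: "0 \<le> davg (hat k c) K i" "davg (hat k c) K i \<le> 1" using bnd[of i] by auto
    have "davg (hat k c) K i * davg (hat k c) K i \<le> davg (hat k c) K i * 1"
      using b by (intro mult_left_mono)
    then show "(davg (hat k c) K i)^(2*1) \<le> davg (hat k c) K i" by (simp add: power2_eq_square)
  qed
  also have "\<dots> = 2^K * (\<Sum>i<2^K. integral {dyadic K i..dyadic K (Suc i)} (hat k c))"
    by (simp only: davg_def sum_distrib_left)
  also have "(\<Sum>i<2^K. integral {dyadic K i..dyadic K (Suc i)} (hat k c)) = integral {0..1} (hat k c)"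
    using sum_dyadic_integrals[of "hat k c" K "2^K"] hat_integrable by (simp add: dyadic_def)
  also have "2^K * \<dots> \<le> 2^K * (2/2^k)" by (intro mult_left_mono integral_hat_le) auto
  finally have "(\<Sum>i<2^K. (davg (hat k c) K i)^(2*1)) / 2^K \<le> 2^K * (2/2^k) / 2^K"
    by (rule divide_right_mono) simp
  also have "2^K * (2/2^k) / 2^K = (2/2^k :: real)" by (rule nonzero_mult_div_cancel_left) simp
  finally show ?thesis by (simp only: dyadic_moment_def)
qed

text \<open>A strict bound on the width yields an actual subspace and an approximant f - E f for
  each f. Passing to averages of level K puts all approximants into the span of n vectors
  \<open>G t\<close>, where finite-dimensional linear algebra applies.\<close>

lemma kolmogorov_width_lessE:
  assumes less: "kolmogorov_width n F q 0 1 < ennreal \<delta>" and q: "1 \<le> q"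
    and F: "\<And>f. f \<in> F \<Longrightarrow> f integrable_on {0..1}"
  obtains G c E where "\<And>t i. 2^K \<le> i \<Longrightarrow> G t i = (0::real)"
    "\<And>f. f \<in> F \<Longrightarrow> E f integrable_on {0..1}"
    "\<And>f. f \<in> F \<Longrightarrow> Lp_enorm q {0..1} (E f) \<le> ennreal \<delta>"
    "\<And>f. f \<in> F \<Longrightarrow> (\<lambda>i. if i < 2^K then davg (\<lambda>x. f x - E f x) K i else 0) = (\<lambda>i. \<Sum>t<n. c f t * G t i)"
proof -
  obtain g :: "nat \<Rightarrow> real \<Rightarrow> real" where g': "g \<in> {g. \<forall>i<n. Lp_mem q {0..1} (g i)}"
    and sup: "(SUP f\<in>F. INF c :: nat \<Rightarrow> real. Lp_enorm q {0..1} (\<lambda>x. f x - (\<Sum>i<n. c i * g i x))) < ennreal \<delta>"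
    using less unfolding kolmogorov_width_def INF_less_iff by (rule bexE)
  have g: "Lp_mem q {0..1} (g i)" if "i < n" for i using g' that by simp
  have "\<exists>c :: nat \<Rightarrow> real. Lp_enorm q {0..1} (\<lambda>x. f x - (\<Sum>i<n. c i * g i x)) < ennreal \<delta>" if "f \<in> F" for f
  proof -
    have "(INF c :: nat \<Rightarrow> real. Lp_enorm q {0..1} (\<lambda>x. f x - (\<Sum>i<n. c i * g i x))) < ennreal \<delta>"
      by (rule le_less_trans[OF SUP_upper[OF that] sup])
    then show ?thesis by (simp only: INF_less_iff bex_UNIV)
  qed
  then have ex: "\<forall>f\<in>F. \<exists>c :: nat \<Rightarrow> real. Lp_enorm q {0..1} (\<lambda>x. f x - (\<Sum>i<n. c i * g i x)) < ennreal \<delta>"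
    by (rule ballI)
  obtain c :: "(real \<Rightarrow> real) \<Rightarrow> nat \<Rightarrow> real"
    where c': "\<forall>f\<in>F. Lp_enorm q {0..1} (\<lambda>x. f x - (\<Sum>i<n. c f i * g i x)) < ennreal \<delta>"
    using bchoice[OF ex] by (rule exE)
  note c = bspec[OF c']
  have gi: "g t integrable_on {0..1}" if "t < n" for t
    using Lp_mem_imp_integrable[OF g[OF that] q] by (rule set_lebesgue_integral_eq_integral)
  have si: "(\<lambda>x. \<Sum>t<n. c f t * g t x) integrable_on {0..1}" for f
    using gi by (intro integrable_sum integrable_on_mult_right) auto
  define E where "E f x = f x - (\<Sum>t<n. c f t * g t x)" for f x
  define G where "G t i = (if i < 2^K then davg (g t) K i else 0)" for t i
  have Ei: "E f integrable_on {0..1}" if "f \<in> F" for f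
    unfolding E_def by (intro integrable_diff F that si)
  have rep: "(\<lambda>i. if i < 2^K then davg (\<lambda>x. f x - E f x) K i else 0) = (\<lambda>i. \<Sum>t<n. c f t * G t i)" for f
  proof
    fix i
    show "(if i < 2^K then davg (\<lambda>x. f x - E f x) K i else 0) = (\<Sum>t<n. c f t * G t i)"
    proof (cases "i < 2^K")
      case True
      have "davg (\<lambda>x. f x - E f x) K i = davg (\<lambda>x. \<Sum>t<n. c f t * g t x) K i"
        by (simp add: E_def)
      also have "\<dots> = (\<Sum>t<n. c f t * davg (g t) K i)"
        using gi True by (intro davg_sum) auto
      finally show ?thesis using True by (simp add: G_def)
    qed (simp add: G_def)
  qed
  show ?thesis
  proof (rule that[of G E c])
    show "Lp_enorm q {0..1} (E f) \<le> ennreal \<delta>" if "f \<in> F" for f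
      unfolding E_def by (rule less_imp_le[OF c[OF that]])
    show "G t i = 0" if "2^K \<le> i" for t i using that by (simp add: G_def)
  qed (rule Ei rep, assumption?)+
qed

text \<open>This bounds one row of the Hilbert-Schmidt norm: the approximant f - e is small in L_2
  because both f and e are.\<close>

lemma ip_residual_le:
  assumes q: "2 \<le> q" and \<delta>: "0 < \<delta>" and E: "Lp_enorm q {0..1} e \<le> ennreal \<delta>"
    and A: "dyadic_moment 1 K (davg f K) \<le> A"
  defines "y \<equiv> \<lambda>i. if i < 2^K then davg f K i - davg e K i else 0"
  shows "ip (2^K) y y \<le> 2 * 2^K * (A + \<delta>\<^sup>2)"
proof -
  have "ip (2^K) y y = (\<Sum>i<2^K. (davg f K i - davg e K i)\<^sup>2)"
    by (simp add: ip_def y_def power2_eq_square)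
  also have "\<dots> \<le> (\<Sum>i<2^K. 2 * (davg f K i)\<^sup>2 + 2 * (davg e K i)\<^sup>2)"
  proof (intro sum_mono)
    fix i
    show "(davg f K i - davg e K i)\<^sup>2 \<le> 2 * (davg f K i)\<^sup>2 + 2 * (davg e K i)\<^sup>2"
      using zero_le_power2[of "davg f K i + davg e K i"] by (simp add: power2_eq_square algebra_simps)
  qed
  also have "\<dots> = 2 * (\<Sum>i<2^K. (davg f K i)\<^sup>2) + 2 * (\<Sum>i<2^K. (davg e K i)\<^sup>2)"
    by (simp add: sum.distrib sum_distrib_left)
  also have "\<dots> \<le> 2 * (2^K * A) + 2 * (2^K * \<delta>\<^sup>2)"
  proof (intro add_mono mult_left_mono)
    show "(\<Sum>i<2^K. (davg f K i)\<^sup>2) \<le> 2^K * A"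
      using A unfolding dyadic_moment_le_iff power_one_right .
    show "(\<Sum>i<2^K. (davg e K i)\<^sup>2) \<le> 2^K * \<delta>\<^sup>2"
      by (rule Lp_enorm_dyadic_L2[OF q \<delta> E])
  qed auto
  also have "\<dots> = 2 * 2^K * (A + \<delta>\<^sup>2)" by (simp only: distrib_left mult.assoc)
  finally show ?thesis .
qed

text \<open>The nested sums of hats are truncations of the logarithmic singularity at c.\<close>

lemma width_lower_nested:
  assumes q: "2 \<le> q" and \<delta>: "0 < \<delta>" and \<kappa>: "0 < \<kappa>" and K: "K = k0 + L" and L: "0 < L"
    and F: "\<And>c. (\<lambda>x. \<kappa> * (\<Sum>k\<in>{k0..<K}. hat k c x)) \<in> F" and Fi: "\<And>f. f \<in> F \<Longrightarrow> f integrable_on {0..1}"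
    and small: "2 powr (real K / q) * \<delta> \<le> \<kappa> * real L / 4"
    and less: "kolmogorov_width n F q 0 1 < ennreal \<delta>"
  shows "\<kappa>\<^sup>2 * (real L)\<^sup>2 / 16 \<le> 2 * real n * (32 * \<kappa>\<^sup>2 / 2^k0 + \<delta>\<^sup>2)"
proof -
  have q1: "1 \<le> q" using q by simp
  obtain G c E where G: "\<And>t i. 2^K \<le> i \<Longrightarrow> G t i = (0::real)"
    and Ei: "\<And>f. f \<in> F \<Longrightarrow> E f integrable_on {0..1}"
    and El: "\<And>f. f \<in> F \<Longrightarrow> Lp_enorm q {0..1} (E f) \<le> ennreal \<delta>"
    and rep: "\<And>f. f \<in> F \<Longrightarrow> (\<lambda>i. if i < 2^K then davg (\<lambda>x. f x - E f x) K i else 0) = (\<lambda>i. \<Sum>t<n. c f t * G t i)"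
    by (rule kolmogorov_width_lessE[where K = K, OF less q1], erule Fi, rule that)
  \<comment> \<open>The hats peak at the midpoint of cell \<omega> of level K, so those of levels k
    < K are all at least 1/2 on that cell.\<close>
  define cen where "cen \<omega> = (dyadic K \<omega> + dyadic K (Suc \<omega>)) / 2" for \<omega>
  define f where "f \<omega> x = \<kappa> * (\<Sum>k\<in>{k0..<K}. hat k (cen \<omega>) x)" for \<omega> x
  have fF: "f \<omega> \<in> F" for \<omega> using F[of "cen \<omega>"] by (simp add: f_def[abs_def])
  define y where "y \<omega> i = (if i < 2^K then davg (f \<omega>) K i - davg (E (f \<omega>)) K i else 0)" for \<omega> i
  \<comment> \<open>The rows \<open>y \<omega>\<close> form a square matrix of rank at most n.
    Testing each function against the average over its own cell reads off the diagonal, so the sum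
    is the trace, and evaluation at one coordinate per row has Bessel constant 1.\<close>
  have "(\<Sum>\<omega>\<in>{..<2^K}. 1 * (y \<omega> \<omega>))\<^sup>2 \<le> real n * 1 * (\<Sum>\<omega>\<in>{..<2^K}. 1 * ip (2^K) (y \<omega>) (y \<omega>))"
  proof (rule rank_inequality[where Z = "\<lambda>\<omega> v. v \<omega>" and g = G and c = "\<lambda>\<omega>. c (f \<omega>)"])
    show "y \<omega> = (\<lambda>i. \<Sum>t<n. c (f \<omega>) t * G t i)" for \<omega>
      unfolding rep[OF fF, symmetric] using davg_diff[OF Fi[OF fF] Ei[OF fF]] by (auto simp: y_def)
  qed (auto simp: G ip_def power2_eq_square)
  also have "\<dots> \<le> real n * 1 * (\<Sum>\<omega>\<in>{..<(2::nat)^K}. 2 * 2^K * (32 * \<kappa>\<^sup>2 / 2^k0 + \<delta>\<^sup>2))"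
  proof (intro mult_left_mono sum_mono)
    fix \<omega>
    \<comment> \<open>The L_2 norms of the hats decay with ratio r, so up to a constant the nested
      sum has only the L_2 bound of its coarsest hat, although its height is of order L. This
      mismatch is what gains the factor L^2 in the final inequality.\<close>
    define r where "r = sqrt (1/2::real)"
    have "sqrt (1/2::real) \<le> 3/4" by (rule real_le_lsqrt) (simp_all add: power2_eq_square)
    then have r: "0 \<le> r" "r \<le> 3/4" by (simp_all add: r_def)
    have r2: "(r^k)\<^sup>2 = (1/2)^k" for k
    proof -
      have "(r^k)\<^sup>2 = (r\<^sup>2)^k" by (simp only: power_mult[symmetric] mult.commute)
      then show ?thesis by (simp add: r_def)
    qed
    have "dyadic_moment 1 K (\<lambda>i. \<Sum>k\<in>{k0..<K}. davg (hat k (cen \<omega>)) K i) \<le> ((\<Sum>k\<in>{k0..<K}. sqrt 2 * r^k)\<^sup>2)^1"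
    proof (rule dyadic_moment_sum)
      fix k
      have "(sqrt 2 * r^k)\<^sup>2 = 2/2^k"
        by (simp add: power_mult_distrib r2 power_divide)
      then show "dyadic_moment 1 K (davg (hat k (cen \<omega>)) K) \<le> ((sqrt 2 * r^k)\<^sup>2)^1"
        using dyadic_moment_hat by simp
      show "0 \<le> sqrt 2 * r^k" using r by simp
    qed auto
    also have "\<dots> \<le> (sqrt 2 * (4 * r^k0))\<^sup>2"
    proof -
      have "(\<Sum>k\<in>{k0..<K}. r^k) \<le> r^k0 / (1 - r)" using r by (intro sum_geometric_tail_le) auto
      also have "\<dots> \<le> r^k0 / (1/4)" using r by (intro divide_left_mono) auto
      finally have "sqrt 2 * (\<Sum>k\<in>{k0..<K}. r^k) \<le> sqrt 2 * (4 * r^k0)"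
        by (intro mult_left_mono) auto
      then have "(\<Sum>k\<in>{k0..<K}. sqrt 2 * r^k) \<le> sqrt 2 * (4 * r^k0)"
        by (simp only: sum_distrib_left)
      then show ?thesis using r by (simp only: power_one_right) (intro power_mono sum_nonneg, auto)
    qed
    also have "\<dots> = 32 / 2^k0"
      by (simp add: power_mult_distrib r2 power_divide)
    finally have "dyadic_moment 1 K (\<lambda>i. \<Sum>k\<in>{k0..<K}. davg (hat k (cen \<omega>)) K i) \<le> 32 / 2^k0" .
    moreover have "dyadic_moment 1 K (davg (f \<omega>) K)
        = \<kappa>\<^sup>2 * dyadic_moment 1 K (\<lambda>i. \<Sum>k\<in>{k0..<K}. davg (hat k (cen \<omega>)) K i)"
    proof -
      have "davg (f \<omega>) K i = \<kappa> * (\<Sum>k\<in>{k0..<K}. davg (hat k (cen \<omega>)) K i)" if "i < 2^K" for i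
        using davg_sum[of "{k0..<K}" "\<lambda>k. hat k (cen \<omega>)" i K "\<lambda>_. \<kappa>"] that hat_integrable
        by (simp add: f_def[abs_def] sum_distrib_left)
      then have "dyadic_moment 1 K (davg (f \<omega>) K) = dyadic_moment 1 K (\<lambda>i. \<kappa> * (\<Sum>k\<in>{k0..<K}. davg (hat k
          (cen \<omega>)) K i))"
        by (rule dyadic_moment_cong)
      then show ?thesis by (simp add: dyadic_moment_scale)
    qed
    ultimately have "dyadic_moment 1 K (davg (f \<omega>) K) \<le> \<kappa>\<^sup>2 * (32 / 2^k0)"
      by (metis mult_left_mono zero_le_power2)
    then have "dyadic_moment 1 K (davg (f \<omega>) K) \<le> 32 * \<kappa>\<^sup>2 / 2^k0" by (simp add: mult.commute)
    then show "1 * ip (2^K) (y \<omega>) (y \<omega>) \<le> 2 * 2^K * (32 * \<kappa>\<^sup>2 / 2^k0 + \<delta>\<^sup>2)"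
      unfolding mult_1_left y_def by (rule ip_residual_le[OF q \<delta> El[OF fF]])
  qed auto
  also have "\<dots> = (2^K)\<^sup>2 * (2 * real n * (32 * \<kappa>\<^sup>2 / 2^k0 + \<delta>\<^sup>2))"
  proof -
    have "real n * 1 * (\<Sum>\<omega>\<in>{..<(2::nat)^K}. 2 * 2^K * W) = (2^K)\<^sup>2 * (2 * real n * W)" for W :: real
      by (simp add: power2_eq_square)
    then show ?thesis .
  qed
  finally have up: "(\<Sum>\<omega><2^K. y \<omega> \<omega>)\<^sup>2 \<le> (2^K)\<^sup>2 * (2 * real n * (32 * \<kappa>\<^sup>2 / 2^k0 + \<delta>\<^sup>2))"
    by (simp only: mult_1_left)
  have "2^K * (\<kappa> * real L / 4) \<le> (\<Sum>\<omega><2^K. y \<omega> \<omega>)"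
  proof -
    have "\<kappa> * real L / 4 \<le> y \<omega> \<omega>" if w: "\<omega> < 2^K" for \<omega>
    proof -
      have "\<kappa> * real L / 2 \<le> davg (f \<omega>) K \<omega>"
      proof (rule davg_lower_bound[OF Fi[OF fF] w])
        fix x assume x: "x \<in> {dyadic K \<omega>..dyadic K (Suc \<omega>)}"
        have "hat k (cen \<omega>) x \<ge> 1/2" if k: "k \<in> {k0..<K}" for k
        proof -
          have "\<bar>x - cen \<omega>\<bar> \<le> 1/2^Suc K"
            using x by (auto simp: cen_def dyadic_Suc abs_le_iff field_simps)
          then have "2^k * \<bar>x - cen \<omega>\<bar> \<le> 2^K * (1/2^Suc K)"
            using k by (intro mult_mono power_increasing) auto
          then show ?thesis by (simp add: hat_def)
        qed
        then have "(\<Sum>k\<in>{k0..<K}. 1/2) \<le> (\<Sum>k\<in>{k0..<K}. hat k (cen \<omega>) x)" by (intro sum_mono)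
        then have "real L / 2 \<le> (\<Sum>k\<in>{k0..<K}. hat k (cen \<omega>) x)" by (simp add: K)
        then have "\<kappa> * (real L / 2) \<le> f \<omega> x" unfolding f_def using \<kappa> by (intro mult_left_mono) auto
        then show "\<kappa> * real L / 2 \<le> f \<omega> x" by simp
      qed
      moreover have "\<bar>davg (E (f \<omega>)) K \<omega>\<bar> \<le> \<kappa> * real L / 4"
        using Lp_enorm_dyadic_average[OF q1 \<delta> El[OF fF[of \<omega>]] w] small by linarith
      ultimately show ?thesis using w by (simp add: y_def abs_le_iff)
    qed
    then have "(\<Sum>\<omega><(2::nat)^K. \<kappa> * real L / 4) \<le> (\<Sum>\<omega><2^K. y \<omega> \<omega>)" by (intro sum_mono) auto
    then show ?thesis by simp
  qed
  then have "(2^K * (\<kappa> * real L / 4))\<^sup>2 \<le> (\<Sum>\<omega><2^K. y \<omega> \<omega>)\<^sup>2"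
    using \<kappa> by (intro power_mono) auto
  with up have "(2^K)\<^sup>2 * (\<kappa> * real L / 4)\<^sup>2 \<le> (2^K)\<^sup>2 * (2 * real n * (32 * \<kappa>\<^sup>2 / 2^k0 + \<delta>\<^sup>2))"
    by (simp only: power_mult_distrib)
  then have "(\<kappa> * real L / 4)\<^sup>2 \<le> 2 * real n * (32 * \<kappa>\<^sup>2 / 2^k0 + \<delta>\<^sup>2)"
    by (simp only: mult_le_cancel_left_pos zero_less_power zero_less_numeral)
  then show ?thesis by (simp add: power_mult_distrib power_divide)
qed

text \<open>The support of the hat is exactly the right half of the dyadic interval, so the average
  over the left half is zero and nothing cancels in the Haar difference. The value 1/4 for the right
  average comes from the middle part, where the hat is at least 1/2.\<close>

lemma dhalf_hat_right:
  assumes j: "j < 2^k"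
  shows "1/8 \<le> dhalf (hat (k+2) (dyadic (Suc k) (2*j+1) + 1/2^(k+2))) k j"
proof -
  define a where "a = dyadic (Suc k) (2*j+1)"
  define w where "w = (1/2^(k+2) :: real)"
  have w: "w > 0" "2^(k+2) * w = 1" by (simp_all add: w_def)
  have b: "dyadic (Suc k) (Suc (2*j+1)) = a + 2*w" unfolding dyadic_Suc a_def w_def by simp
  have "davg (hat (k+2) (a + w)) (Suc k) (2*j) = 0"
  proof -
    have "hat (k+2) (a + w) x = 0" if "x \<in> {dyadic (Suc k) (2*j)..dyadic (Suc k) (Suc (2*j))}" for x
    proof -
      have "x \<le> a" using that by (simp add: a_def)
      then have "2^(k+2) * w \<le> 2^(k+2) * \<bar>x - (a + w)\<bar>" using w by (intro mult_left_mono) auto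
      then show ?thesis unfolding hat_def w(2) by (intro max_absorb1) linarith
    qed
    then have "integral {dyadic (Suc k) (2*j)..dyadic (Suc k) (Suc (2*j))} (hat (k+2) (a + w)) = 0"
      by (intro integral_unique has_integral_is_0) auto
    then show ?thesis by (simp add: davg_def)
  qed
  moreover have "1/4 \<le> davg (hat (k+2) (a + w)) (Suc k) (2*j+1)"
  proof -
    have "integral {a + w/2..a + 3*w/2} (\<lambda>_. 1/2) \<le> integral {a + w/2..a + 3*w/2} (hat (k+2) (a + w))"
    proof (intro integral_le hat_integrable integrable_const_ivl)
      fix x assume x: "x \<in> {a + w/2..a + 3*w/2}"
      have "\<bar>x - (a + w)\<bar> \<le> w/2" using x unfolding abs_le_iff atLeastAtMost_iff by (intro conjI) linarith+
      then have "2^(k+2) * \<bar>x - (a + w)\<bar> \<le> 2^(k+2) * (w/2)" by (intro mult_left_mono) auto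
      then have "2^(k+2) * \<bar>x - (a + w)\<bar> \<le> 1/2" unfolding times_divide_eq_right w(2) .
      then show "1/2 \<le> hat (k+2) (a + w) x" unfolding hat_def le_max_iff_disj by linarith
    qed
    also have "\<dots> \<le> integral {a..a + 2*w} (hat (k+2) (a + w))"
      using w by (intro integral_subset_le hat_integrable) (auto simp: hat_nonneg)
    finally have "w/2 \<le> integral {a..a + 2*w} (hat (k+2) (a + w))" using w by simp
    then have "2^Suc k * (w/2) \<le> 2^Suc k * integral {a..a + 2*w} (hat (k+2) (a
        + w))" by (intro mult_left_mono) auto
    moreover have "2^Suc k * (w/2) = 1/4" by (simp add: w_def)
    ultimately show ?thesis unfolding davg_def b a_def[symmetric] by (simp only:)
  qed
  ultimately show ?thesis unfolding dhalf_def a_def[symmetric] w_def[symmetric] by simp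
qed

text \<open>Each hat, tested against its own Haar functional, contributes at least \<kappa>/16 to
  the trace. The weights \<open>p\<close> give every level total weight 1, so the trace grows like
  L, while Parseval's identity keeps the Bessel constant of all levels together at 2^(-K). The
  Hilbert-Schmidt sum also grows like L, hence one factor L survives after squaring the
  trace.\<close>

lemma width_lower_levels:
  assumes q: "2 \<le> q" and \<delta>: "0 < \<delta>" and \<kappa>: "0 < \<kappa>" and K: "K = k0 + L" and L: "0 < L"
    and F: "\<And>k c. (\<lambda>x. \<kappa> * hat k c x) \<in> F" and Fi: "\<And>f. f \<in> F \<Longrightarrow> f integrable_on {0..1}"
    and small: "2 powr (real K / q) * \<delta> \<le> \<kappa> / 16"
    and less: "kolmogorov_width n F q 0 1 < ennreal \<delta>"
  shows "\<kappa>\<^sup>2 * real L / 256 \<le> 2 * real n * (\<kappa>\<^sup>2 / 2^k0 + \<delta>\<^sup>2)"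
proof -
  have q1: "1 \<le> q" using q by simp
  obtain G c E where G: "\<And>t i. 2^K \<le> i \<Longrightarrow> G t i = (0::real)"
    and Ei: "\<And>f. f \<in> F \<Longrightarrow> E f integrable_on {0..1}"
    and El: "\<And>f. f \<in> F \<Longrightarrow> Lp_enorm q {0..1} (E f) \<le> ennreal \<delta>"
    and rep: "\<And>f. f \<in> F \<Longrightarrow> (\<lambda>i. if i < 2^K then davg (\<lambda>x. f x - E f x) K i else 0) = (\<lambda>i. \<Sum>t<n. c f t * G t i)"
    by (rule kolmogorov_width_lessE[where K = K, OF less q1], erule Fi, rule that)
  define lev where "lev d = K - 1 - d" for d
  define f where "f \<omega> x = \<kappa> * hat (lev (fst \<omega>) + 2) (dyadic (Suc (lev (fst \<omega>))) (2 * snd \<omega> + 1)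
      + 1/2^(lev (fst \<omega>) + 2)) x" for \<omega> :: "nat \<times> nat" and x
  have fF: "f \<omega> \<in> F" for \<omega> unfolding f_def by (rule F)
  define y where "y \<omega> i = (if i < 2^K then davg (\<lambda>x. f \<omega> x - E (f \<omega>) x) K i else 0)" for \<omega> i
  define \<Omega> where "\<Omega> = Sigma {..<L} (\<lambda>d. {..<(2::nat)^lev d})"
  define p where "p \<omega> = (1 / 2^lev (fst \<omega>) :: real)" for \<omega> :: "nat \<times> nat"
  have sum\<Omega>: "(\<Sum>\<omega>\<in>\<Omega>. p \<omega> * u \<omega>) = (\<Sum>d<L. (\<Sum>j<2^lev d. u (d, j)) / 2^lev d)" for u
  proof -
    have "(\<Sum>\<omega>\<in>\<Omega>. p \<omega> * u \<omega>) = (\<Sum>d<L. \<Sum>j<2^lev d. p (d, j) * u (d, j))"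
      unfolding \<Omega>_def by (subst sum.Sigma) (auto simp: case_prod_beta)
    also have "\<dots> = (\<Sum>d<L. (\<Sum>j<2^lev d. u (d, j)) / 2^lev d)"
      by (simp add: p_def sum_divide_distrib)
    finally show ?thesis .
  qed
  have p\<Omega>: "(\<Sum>\<omega>\<in>\<Omega>. p \<omega> * v) = real L * v" for v
    unfolding sum\<Omega> by simp
  have "(\<Sum>\<omega>\<in>\<Omega>. p \<omega> * coarsen_diff (y \<omega>) (fst \<omega>) (snd \<omega>))\<^sup>2
      \<le> real n * (1/2^K) * (\<Sum>\<omega>\<in>\<Omega>. p \<omega> * ip (2^K) (y \<omega>) (y \<omega>))"
  proof (rule rank_inequality[where Z = "\<lambda>\<omega> v. coarsen_diff v (fst \<omega>) (snd \<omega>)" and g = G and c = "\<lambda>\<omega>. c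
      (f \<omega>)"])
    show "y \<omega> = (\<lambda>i. \<Sum>t<n. c (f \<omega>) t * G t i)" for \<omega>
    proof
      fix i
      show "y \<omega> i = (\<Sum>t<n. c (f \<omega>) t * G t i)"
        using fun_cong[OF rep[OF fF[of \<omega>]], of i] by (simp only: y_def)
    qed
    show "finite \<Omega>" by (simp add: \<Omega>_def)
    show "(\<Sum>\<omega>\<in>\<Omega>. p \<omega> * (coarsen_diff b (fst \<omega>) (snd \<omega>))\<^sup>2) \<le> 1/2^K * ip (2^K) b b" for b
    proof -
      have "L \<le> K" using K by simp
      have "(\<Sum>\<omega>\<in>\<Omega>. p \<omega> * (coarsen_diff b (fst \<omega>) (snd \<omega>))\<^sup>2) + (\<Sum>j<2^(K-L). (coarsen b L j)\<^sup>2) / 2^(K-L)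
          = ip (2^K) b b / 2^K"
        using coarsen_energy[OF \<open>L \<le> K\<close>, of b] unfolding sum\<Omega> lev_def fst_conv snd_conv .
      moreover have "0 \<le> (\<Sum>j<2^(K-L). (coarsen b L j)\<^sup>2) / 2^(K-L)" by (intro divide_nonneg_nonneg sum_nonneg) auto
      ultimately show ?thesis by simp
    qed
  qed (auto simp: G p_def coarsen_diff_sum)
  also have "\<dots> \<le> real n * (1/2^K) * (\<Sum>\<omega>\<in>\<Omega>. p \<omega> * (2 * 2^K * (\<kappa>\<^sup>2 / 2^k0 + \<delta>\<^sup>2)))"
  proof (intro mult_left_mono sum_mono)
    fix \<omega> assume w: "\<omega> \<in> \<Omega>"
    let ?h = "hat (lev (fst \<omega>) + 2) (dyadic (Suc (lev (fst \<omega>))) (2 * snd \<omega> + 1) + 1/2^(lev (fst \<omega>) + 2))"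
    have lk: "k0 \<le> lev (fst \<omega>)" using w K by (auto simp: \<Omega>_def lev_def)
    have "davg (f \<omega>) K = (\<lambda>i. \<kappa> * davg ?h K i)"
      unfolding davg_def f_def[abs_def] by (rule ext) simp
    then have "dyadic_moment 1 K (davg (f \<omega>) K) = \<kappa>\<^sup>2 * dyadic_moment 1 K (davg ?h K)"
      by (simp only: dyadic_moment_scale power_one_right)
    also have "\<dots> \<le> \<kappa>\<^sup>2 * (1/2^k0)"
    proof (rule mult_left_mono)
      have "dyadic_moment 1 K (davg ?h K) \<le> 2/2^(lev (fst \<omega>) + 2)" by (rule dyadic_moment_hat)
      also have "\<dots> \<le> 1/2^lev (fst \<omega>)" by (simp add: field_simps)
      also have "\<dots> \<le> 1/2^k0" using lk by (intro divide_left_mono power_increasing) auto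
      finally show "dyadic_moment 1 K (davg ?h K) \<le> 1/2^k0" .
    qed simp
    finally have "dyadic_moment 1 K (davg (f \<omega>) K) \<le> \<kappa>\<^sup>2 / 2^k0" by simp
    note ip_residual_le[OF q \<delta> El[OF fF[of \<omega>]] this]
    moreover have "(\<lambda>i. if i < 2^K then davg (f \<omega>) K i - davg (E (f \<omega>)) K i else 0) = y \<omega>"
      using davg_diff[OF Fi[OF fF[of \<omega>]] Ei[OF fF[of \<omega>]]] by (auto simp: y_def)
    ultimately show "ip (2^K) (y \<omega>) (y \<omega>) \<le> 2 * 2^K * (\<kappa>\<^sup>2 / 2^k0 + \<delta>\<^sup>2)" by simp
  qed (auto simp: p_def)
  also have "\<dots> = real L * (2 * real n * (\<kappa>\<^sup>2 / 2^k0 + \<delta>\<^sup>2))"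
    unfolding p\<Omega> by simp
  finally have up: "(\<Sum>\<omega>\<in>\<Omega>. p \<omega> * coarsen_diff (y \<omega>) (fst \<omega>) (snd \<omega>))\<^sup>2
      \<le> real L * (2 * real n * (\<kappa>\<^sup>2 / 2^k0 + \<delta>\<^sup>2))" .
  have "real L * (\<kappa> / 16) \<le> (\<Sum>\<omega>\<in>\<Omega>. p \<omega> * coarsen_diff (y \<omega>) (fst \<omega>) (snd \<omega>))"
    unfolding p\<Omega>[symmetric]
  proof (intro sum_mono mult_left_mono)
    fix \<omega> assume w: "\<omega> \<in> \<Omega>"
    obtain d j where dj: "\<omega> = (d, j)" by (cases \<omega>)
    have d: "d < L" and j: "j < 2^lev d" using w by (auto simp: \<Omega>_def dj)
    have dK: "d < K" using d K by simp
    let ?e = "E (f \<omega>)"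
    let ?h = "hat (lev d + 2) (dyadic (Suc (lev d)) (2 * j + 1) + 1/2^(lev d + 2))"
    have fi: "f \<omega> integrable_on {0..1}" "?e integrable_on {0..1}" using Fi[OF fF] Ei[OF fF] by auto
    have "coarsen_diff (y \<omega>) d j = dhalf (\<lambda>x. f \<omega> x - ?e x) (lev d) j"
      unfolding y_def lev_def
      by (rule coarsen_diff_davg) (use fi dK j in \<open>auto simp: lev_def intro!: integrable_diff\<close>)
    also have "\<dots> = dhalf (f \<omega>) (lev d) j - dhalf ?e (lev d) j" by (rule dhalf_diff[OF fi j])
    also have "dhalf (f \<omega>) (lev d) j = \<kappa> * dhalf ?h (lev d) j"
      unfolding dhalf_def davg_def f_def[abs_def] dj by (simp add: right_diff_distrib)
    finally have eq: "coarsen_diff (y \<omega>) d j = \<kappa> * dhalf ?h (lev d) j - dhalf ?e (lev d) j" .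
    have "\<kappa> * (1/8) \<le> \<kappa> * dhalf ?h (lev d) j"
      using \<kappa> by (intro mult_left_mono dhalf_hat_right j) auto
    moreover have "\<bar>dhalf ?e (lev d) j\<bar> \<le> \<kappa> / 16"
    proof -
      have jj: "2*j+1 < 2^Suc (lev d)" "2*j < 2^Suc (lev d)" using j by auto
      have sl: "2 powr (real (Suc (lev d)) / q) * \<delta> \<le> \<kappa> / 16"
      proof -
        have "Suc (lev d) \<le> K" using dK by (simp add: lev_def)
        then have "2 powr (real (Suc (lev d)) / q) * \<delta> \<le> 2 powr (real K / q) * \<delta>"
          using \<delta> q by (intro mult_right_mono powr_mono divide_right_mono) auto
        then show ?thesis using small by simp
      qed
      have "\<bar>davg ?e (Suc (lev d)) (2*j+1)\<bar> \<le> \<kappa> / 16" "\<bar>davg ?e (Suc (lev d)) (2*j)\<bar> \<le> \<kappa> / 16"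
        using order.trans[OF Lp_enorm_dyadic_average[OF q1 \<delta> El[OF fF[of \<omega>]] jj(1)] sl]
          order.trans[OF Lp_enorm_dyadic_average[OF q1 \<delta> El[OF fF[of \<omega>]] jj(2)] sl] by auto
      then have "\<bar>davg ?e (Suc (lev d)) (2*j+1) - davg ?e (Suc (lev d)) (2*j)\<bar> \<le> \<kappa> / 16 + \<kappa> / 16"
        by (rule order.trans[OF abs_triangle_ineq4 add_mono])
      then show ?thesis unfolding dhalf_def abs_divide abs_numeral by simp
    qed
    ultimately show "\<kappa> / 16 \<le> coarsen_diff (y \<omega>) (fst \<omega>) (snd \<omega>)"
      unfolding dj fst_conv snd_conv using eq by (auto simp: dj abs_le_iff)
  qed (simp add: p_def)
  then have "(real L * (\<kappa> / 16))\<^sup>2 \<le> (\<Sum>\<omega>\<in>\<Omega>. p \<omega> * coarsen_diff (y \<omega>) (fst \<omega>) (snd \<omega>))\<^sup>2"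
    using \<kappa> by (intro power_mono) auto
  also note up
  also have "(real L * (\<kappa> / 16))\<^sup>2 = real L * (\<kappa>\<^sup>2 * real L / 256)"
    by (simp add: power2_eq_square)
  finally have "real L * (\<kappa>\<^sup>2 * real L / 256) \<le> real L * (2 * real n * (\<kappa>\<^sup>2 / 2^k0 + \<delta>\<^sup>2))" .
  then show ?thesis using L by (simp only: mult_le_cancel_left_pos of_nat_0_less_iff)
qed

section \<open>Choice of scales and lower bounds for Besov classes\<close>

text \<open>The levels start where 2^k0 \<ge> 4096 n makes the L_2 mass of the hats harmless and end
  near (1+\<eta>) log_2 n = ((q+2)/4) log_2 n, midway between log_2 n and (q/2) log_2 n. Stopping
  there gives (1+\<eta>)/q = 1/2 - \<beta>, a spare factor n^(-\<beta>) in the price 2^(K/q) of a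
  cell average. The constant is 16384 = 2^14, with 12 from 4096 and 2 from rounding up.\<close>

lemma scale_choice:
  fixes q :: real and n :: nat
  assumes q: "2 < q" and n: "2 \<le> n"
  defines "\<eta> \<equiv> (q - 2) / 4" and "\<beta> \<equiv> 1/4 - 1/(2*q)"
  obtains k0 L :: nat where "1 \<le> L" "\<eta> * ln (real n) \<le> real L" "real L \<le> 1 + 2 * \<eta> * ln (real n)"
    "4096 * real n \<le> 2^k0" "2 powr (real (k0 + L) / q) \<le> 16384 * real n powr (1/2 - \<beta>)"
proof -
  have \<eta>: "\<eta> > 0" using q by (simp add: \<eta>_def)
  have lg: "log 2 (real n) \<ge> 1" using n by (simp add: le_log_iff)
  have ln0: "ln (real n) > 0" using n by simp
  have lg1: "ln (real n) \<le> log 2 (real n)"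
    using n ln_2_less_1 ln0 by (simp add: log_def field_simps)
  have lg2: "log 2 (real n) \<le> 2 * ln (real n)"
    using ln2_ge_two_thirds ln0 by (simp add: log_def field_simps)
  define L where "L = nat \<lceil>\<eta> * log 2 (real n)\<rceil>"
  define k0 where "k0 = nat \<lceil>log 2 (4096 * real n)\<rceil>"
  have pos: "\<eta> * log 2 (real n) > 0" using \<eta> lg by simp
  have Lr: "real L = of_int \<lceil>\<eta> * log 2 (real n)\<rceil>" using pos by (simp add: L_def)
  have L: "\<eta> * log 2 (real n) \<le> real L" "real L \<le> 1 + \<eta> * log 2 (real n)" unfolding Lr by linarith+
  have pos2: "log 2 (4096 * real n) > 0" using n by simp
  have kr: "real k0 = of_int \<lceil>log 2 (4096 * real n)\<rceil>" using pos2 by (simp add: k0_def)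
  have k: "log 2 (4096 * real n) \<le> real k0" "real k0 \<le> 1 + log 2 (4096 * real n)" unfolding kr by linarith+
  have "1 \<le> L" using L(1) pos by linarith
  moreover have "\<eta> * ln (real n) \<le> real L"
    using mult_left_mono[OF lg1, of \<eta>] \<eta> L(1) by linarith
  moreover have "real L \<le> 1 + 2 * \<eta> * ln (real n)"
  proof -
    have "\<eta> * log 2 (real n) \<le> \<eta> * (2 * ln (real n))" using \<eta> by (intro mult_left_mono lg2) auto
    also have "\<dots> = 2 * \<eta> * ln (real n)" by simp
    finally show ?thesis using L(2) by linarith
  qed
  moreover have "4096 * real n \<le> 2^k0"
  proof -
    have "4096 * real n = 2 powr (log 2 (4096 * real n))" using n by (subst powr_log_cancel) auto
    also have "\<dots> \<le> 2 powr real k0" using k by (intro powr_mono) auto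
    finally show ?thesis by (simp add: powr_realpow)
  qed
  moreover have "2 powr (real (k0 + L) / q) \<le> 16384 * real n powr (1/2 - \<beta>)"
  proof -
    have "2 powr (real (k0 + L) / q) \<le> 2 powr ((2 + log 2 (4096 * real n) + \<eta> * log 2 (real n)) / q)"
      using k(2) L(2) q by (intro powr_mono divide_right_mono) auto
    also have "2 + log 2 (4096 * real n) + \<eta> * log 2 (real n) = 14 + (1 + \<eta>) * log 2 (real n)"
    proof -
      have "log 2 (4096 * real n) = log 2 4096 + log 2 (real n)" using n by (simp add: log_mult)
      moreover have "log 2 (4096::real) = 12" using log_pow_cancel[of "2::real" 12] by simp
      ultimately show ?thesis by (simp add: algebra_simps)
    qed
    also have "(14 + (1 + \<eta>) * log 2 (real n)) / q = 14 / q + log 2 (real n) * ((1 + \<eta>) / q)"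
      by (simp add: add_divide_distrib algebra_simps)
    also have "2 powr (14 / q + log 2 (real n) * ((1 + \<eta>) / q)) = 2 powr (14 / q) * real n powr ((1 + \<eta>) / q)"
      unfolding powr_add powr_powr[symmetric] using n by (subst powr_log_cancel) auto
    also have "(1 + \<eta>) / q = 1/2 - \<beta>" using q by (simp add: \<eta>_def \<beta>_def field_simps)
    also have "2 powr (14 / q) * real n powr (1/2 - \<beta>) \<le> 2 powr 14 * real n powr (1/2 - \<beta>)"
      using q by (intro mult_right_mono powr_mono) (auto simp: field_simps)
    also have "(2::real) powr 14 = 16384" by (subst powr_numeral) auto
    finally show ?thesis .
  qed
  ultimately show ?thesis using that by blast
qed

text \<open>A contradiction for a width below \<delta> of order L^(1 - 1/\<theta>) n^(-1/2):
  membership in the unit ball sets \<kappa> to order L^(-1/\<theta>), and the nested hats then reach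
  a height of order \<kappa> L.\<close>

lemma besov_width_lower_nested:
  assumes q: "2 < q"
  shows "\<exists>c>0. \<forall>\<theta> n. 1 \<le> \<theta> \<longrightarrow> 2 \<le> n \<longrightarrow>
    ennreal (c * real n powr (-1/2) * ln (real n) powr (1 - inv_theta \<theta>))
      \<le> besov_width q \<theta> n"
proof -
  define \<eta> where "\<eta> = (q - 2) / 4"
  define \<beta> where "\<beta> = 1/4 - 1/(2*q)"
  have \<eta>: "\<eta> > 0" using q by (simp add: \<eta>_def)
  have \<beta>: "\<beta> > 0" using q by (simp add: \<beta>_def field_simps)
  \<comment> \<open>Chosen so that 16384 \<tau> = 1/4: the error of a cell average is then at most
    \<kappa> L / 4, half of the lower bound \<kappa> L / 2 for the test function.\<close>
  define \<tau> where "\<tau> = (1/65536 :: real)"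
  define c where "c = \<tau> / 64 * min 1 \<eta>"
  have "c > 0" using \<eta> by (simp add: c_def \<tau>_def)
  moreover have "ennreal (c * real n powr (-1/2) * ln (real n) powr (1 - inv_theta \<theta>))
      \<le> besov_width q \<theta> n" if \<theta>: "1 \<le> \<theta>" and n: "2 \<le> n" for \<theta> n
  proof -
    obtain k0 L :: nat where L1: "1 \<le> L" and L\<eta>: "\<eta> * ln (real n) \<le> real L"
      and k0: "4096 * real n \<le> 2^k0" and K: "2 powr (real (k0 + L) / q) \<le> 16384 * real n powr (1/2 - \<beta>)"
      using scale_choice[OF q n] unfolding \<eta>_def \<beta>_def by blast
    have n0: "real n > 0" using n by simp
    define \<alpha> where "\<alpha> = 1 - inv_theta \<theta>"
    have \<alpha>: "0 \<le> \<alpha>" "\<alpha> \<le> 1" using \<theta> by (cases \<theta>; auto simp: \<alpha>_def inv_theta_def)+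
    define \<kappa> where "\<kappa> = real L powr (- inv_theta \<theta>) / 64"
    have \<kappa>: "\<kappa> > 0" using L1 by (simp add: \<kappa>_def)
    define \<delta> where "\<delta> = \<tau> * \<kappa> * real L * real n powr (-1/2)"
    have \<delta>: "\<delta> > 0" using \<kappa> L1 n by (simp add: \<delta>_def \<tau>_def)
    have n12: "(real n powr (-1/2))\<^sup>2 = 1 / real n"
      using n0 by (simp add: power2_eq_square powr_add[symmetric] powr_minus_divide)
    have "\<not> besov_width q \<theta> n < ennreal \<delta>"
    proof
      assume less: "besov_width q \<theta> n < ennreal \<delta>"
      have "\<kappa>\<^sup>2 * (real L)\<^sup>2 / 16 \<le> 2 * real n * (32 * \<kappa>\<^sup>2 / 2^k0 + \<delta>\<^sup>2)"
      proof (rule width_lower_nested[OF _ \<delta> \<kappa> refl _ _ _ _ less])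
        show "2 \<le> q" "0 < L" using q L1 by auto
        show "(\<lambda>x. \<kappa> * (\<Sum>k\<in>{k0..<k0 + L}. hat k c x)) \<in> besov_class 1 1 \<theta> 0 1" for c
          using hat_sum_in_besov_class[of "{k0..<k0 + L}" \<theta> "\<lambda>_. c"] L1 \<theta> by (simp add: \<kappa>_def)
        show "f integrable_on {0..1}" if "f \<in> besov_class 1 1 \<theta> 0 1" for f
          using besov_class_1_1D(1)[OF that] by (rule set_lebesgue_integral_eq_integral)
        have "2 powr (real (k0 + L) / q) * \<delta> \<le> 16384 * real n powr (1/2 - \<beta>) * \<delta>"
          using \<delta> by (intro mult_right_mono K) auto
        also have "\<dots> \<le> 16384 * real n powr (1/2) * \<delta>"
          using \<delta> \<beta> n by (intro mult_right_mono mult_left_mono powr_mono) auto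
        also have "\<dots> = 16384 * \<tau> * \<kappa> * real L * (real n powr (1/2) * real n powr (-1/2))"
          by (simp add: \<delta>_def)
        also have "real n powr (1/2) * real n powr (-1/2) = 1"
          using n0 by (simp add: powr_add[symmetric])
        finally show "2 powr (real (k0 + L) / q) * \<delta> \<le> \<kappa> * real L / 4" by (simp add: \<tau>_def)
      qed
      also have "\<dots> = 2 * real n * (32 * \<kappa>\<^sup>2 / 2^k0) + 2 * real n * \<delta>\<^sup>2" by (rule distrib_left)
      also have "2 * real n * (32 * \<kappa>\<^sup>2 / 2^k0) \<le> 2 * real n * (32 * \<kappa>\<^sup>2 / (4096 * real n))"
        using k0 n0 by (intro mult_left_mono divide_left_mono) auto
      also have "2 * real n * (32 * \<kappa>\<^sup>2 / (4096 * real n)) = \<kappa>\<^sup>2 / 64" using n0 by simp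
      also have "2 * real n * \<delta>\<^sup>2 = 2 * \<tau>\<^sup>2 * (\<kappa>\<^sup>2 * (real L)\<^sup>2)"
        unfolding \<delta>_def power_mult_distrib n12 using n0 by simp
      also have "\<kappa>\<^sup>2 / 64 \<le> \<kappa>\<^sup>2 * (real L)\<^sup>2 / 64"
        using \<kappa> L1 by (simp add: divide_right_mono)
      finally have "\<kappa>\<^sup>2 * (real L)\<^sup>2 / 16 \<le> \<kappa>\<^sup>2 * (real L)\<^sup>2 / 64 + 2 * \<tau>\<^sup>2 * (\<kappa>\<^sup>2 * (real L)\<^sup>2)" by simp
      moreover have "\<kappa>\<^sup>2 * (real L)\<^sup>2 > 0" using \<kappa> L1 by simp
      ultimately show False by (simp add: \<tau>_def power2_eq_square)
    qed
    then have "ennreal \<delta> \<le> besov_width q \<theta> n" by simp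
    moreover have "c * real n powr (-1/2) * ln (real n) powr \<alpha> \<le> \<delta>"
    proof -
      have "min 1 \<eta> powr 1 \<le> min 1 \<eta> powr \<alpha>" using \<alpha> \<eta> by (intro powr_mono') auto
      then have "min 1 \<eta> * ln (real n) powr \<alpha> \<le> min 1 \<eta> powr \<alpha> * ln (real n) powr \<alpha>"
        using \<eta> by (intro mult_right_mono) auto
      also have "\<dots> = (min 1 \<eta> * ln (real n)) powr \<alpha>" by (rule powr_mult[symmetric])
      also have "\<dots> \<le> real L powr \<alpha>"
      proof (rule powr_mono2)
        have "min 1 \<eta> * ln (real n) \<le> \<eta> * ln (real n)" using n by (intro mult_right_mono) auto
        then show "min 1 \<eta> * ln (real n) \<le> real L" using L\<eta> by linarith
      qed (use \<alpha> \<eta> n in auto)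
      finally have "\<tau> / 64 * real n powr (-1/2) * (min 1 \<eta> * ln (real n) powr \<alpha>)
          \<le> \<tau> / 64 * real n powr (-1/2) * real L powr \<alpha>"
        by (intro mult_left_mono) (auto simp: \<tau>_def)
      also have "real L powr \<alpha> = real L powr (- inv_theta \<theta>) * real L"
        using L1 by (simp add: \<alpha>_def powr_diff powr_minus_divide)
      finally show ?thesis by (simp add: c_def \<delta>_def \<kappa>_def mult_ac)
    qed
    ultimately show ?thesis unfolding \<alpha>_def by (meson ennreal_leI order_trans)
  qed
  ultimately show ?thesis by blast
qed

text \<open>Here the test functions have height \<kappa> independent of L, while \<delta> is of
  order L^(1/2) n^(-1/2). The price of a Haar functional stays affordable because the spare factor
  n^(-\<beta>) of \<open>scale_choice\<close> absorbs L^(1/2); \<open>D\<close> is the constant of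
  that comparison.\<close>

lemma besov_width_lower_levels:
  assumes q: "2 < q"
  shows "\<exists>c>0. \<forall>\<theta> n. 1 \<le> \<theta> \<longrightarrow> 2 \<le> n \<longrightarrow>
    ennreal (c * real n powr (-1/2) * ln (real n) powr (1/2))
      \<le> besov_width q \<theta> n"
proof -
  define \<eta> where "\<eta> = (q - 2) / 4"
  define \<beta> where "\<beta> = 1/4 - 1/(2*q)"
  have \<eta>: "\<eta> > 0" using q by (simp add: \<eta>_def)
  have \<beta>: "\<beta> > 0" using q by (simp add: \<beta>_def field_simps)
  define D where "D = sqrt (1 + \<eta> / \<beta>)"
  have D: "D \<ge> 1" using \<eta> \<beta> by (simp add: D_def)
  \<comment> \<open>262144 is 16 times 16384, which matches the smallness condition \<kappa>/16 of
    \<open>width_lower_levels\<close>.\<close>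
  define \<tau> where "\<tau> = 1 / (262144 * D)"
  have \<tau>: "0 < \<tau>" "\<tau> \<le> 1/262144" using D by (auto simp: \<tau>_def field_simps)
  define \<kappa> where "\<kappa> = (1/64 :: real)"
  have \<kappa>: "\<kappa> > 0" by (simp add: \<kappa>_def)
  define c where "c = \<tau> * \<kappa> * sqrt \<eta>"
  have "c > 0" using \<eta> \<tau> \<kappa> by (simp add: c_def)
  moreover have "ennreal (c * real n powr (-1/2) * ln (real n) powr (1/2))
      \<le> besov_width q \<theta> n" if \<theta>: "1 \<le> \<theta>" and n: "2 \<le> n" for \<theta> n
  proof -
    obtain k0 L :: nat where L1: "1 \<le> L" and L\<eta>: "\<eta> * ln (real n) \<le> real L" and Lup: "real L
        \<le> 1 + 2 * \<eta> * ln (real n)"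
      and k0: "4096 * real n \<le> 2^k0" and K: "2 powr (real (k0 + L) / q) \<le> 16384 * real n powr (1/2 - \<beta>)"
      using scale_choice[OF q n] unfolding \<eta>_def \<beta>_def by blast
    have n0: "real n > 0" "real n \<ge> 1" using n by simp_all
    define \<delta> where "\<delta> = \<tau> * \<kappa> * sqrt (real L) * real n powr (-1/2)"
    have \<delta>: "\<delta> > 0" using \<kappa> \<tau> L1 n by (simp add: \<delta>_def)
    have n12: "(real n powr (-1/2))\<^sup>2 = 1 / real n"
      using n0 by (simp add: power2_eq_square powr_add[symmetric] powr_minus_divide)
    have sqL: "sqrt (real L) \<le> D * real n powr \<beta>"
    proof -
      have "ln (real n) \<le> real n powr (2 * \<beta>) / (2 * \<beta>)"
        using ln_powr_bound[of "real n" "2 * \<beta>"] n0 \<beta> by simp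
      then have "2 * \<eta> * ln (real n) \<le> 2 * \<eta> * (real n powr (2 * \<beta>) / (2 * \<beta>))"
        using \<eta> by (intro mult_left_mono) auto
      moreover have "1 \<le> real n powr (2 * \<beta>)" using n0 \<beta> by (intro ge_one_powr_ge_zero) auto
      ultimately have "real L \<le> (1 + \<eta> / \<beta>) * real n powr (2 * \<beta>)"
        using Lup by (simp add: distrib_right)
      then have "sqrt (real L) \<le> sqrt ((1 + \<eta> / \<beta>) * real n powr (2 * \<beta>))" by (rule real_sqrt_le_mono)
      also have "\<dots> = D * real n powr \<beta>"
        by (simp add: D_def real_sqrt_mult powr_half_sqrt[symmetric] powr_powr)
      finally show ?thesis .
    qed
    have "\<not> besov_width q \<theta> n < ennreal \<delta>"
    proof
      assume less: "besov_width q \<theta> n < ennreal \<delta>"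
      have "\<kappa>\<^sup>2 * real L / 256 \<le> 2 * real n * (\<kappa>\<^sup>2 / 2^k0 + \<delta>\<^sup>2)"
      proof (rule width_lower_levels[OF _ \<delta> \<kappa> refl _ _ _ _ less])
        show "2 \<le> q" "0 < L" using q L1 by auto
        show "(\<lambda>x. \<kappa> * hat k c x) \<in> besov_class 1 1 \<theta> 0 1" for k c
          using hat_sum_in_besov_class[of "{k}" \<theta> "\<lambda>_. c"] \<theta> by (simp add: \<kappa>_def)
        show "f integrable_on {0..1}" if "f \<in> besov_class 1 1 \<theta> 0 1" for f
          using besov_class_1_1D(1)[OF that] by (rule set_lebesgue_integral_eq_integral)
        have "2 powr (real (k0 + L) / q) * \<delta> \<le> 16384 * real n powr (1/2 - \<beta>) * \<delta>"
          using \<delta> by (intro mult_right_mono K) auto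
        also have "\<dots> = 16384 * \<tau> * \<kappa> * (real n powr (1/2 - \<beta>) * real n powr (-1/2)) * sqrt (real L)"
          by (simp add: \<delta>_def)
        also have "\<dots> \<le> 16384 * \<tau> * \<kappa> * (real n powr (1/2 - \<beta>) * real n powr (-1/2)) * (D * real n powr \<beta>)"
          using \<tau> \<kappa> by (intro mult_left_mono sqL) auto
        also have "\<dots> = 16384 * \<tau> * \<kappa> * D * (real n powr (1/2
            - \<beta>) * real n powr (-1/2) * real n powr \<beta>)" by simp
        also have "real n powr (1/2 - \<beta>) * real n powr (-1/2) * real n powr \<beta> = 1"
          using n0 by (simp add: powr_add[symmetric])
        finally show "2 powr (real (k0 + L) / q) * \<delta> \<le> \<kappa> / 16" using D by (simp add: \<tau>_def)
      qed
      also have "\<dots> = 2 * real n * (\<kappa>\<^sup>2 / 2^k0) + 2 * real n * \<delta>\<^sup>2" by (rule distrib_left)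
      also have "2 * real n * (\<kappa>\<^sup>2 / 2^k0) \<le> 2 * real n * (\<kappa>\<^sup>2 / (4096 * real n))"
        using k0 n0 by (intro mult_left_mono divide_left_mono) auto
      also have "2 * real n * (\<kappa>\<^sup>2 / (4096 * real n)) = \<kappa>\<^sup>2 / 2048" using n0 by simp
      also have "2 * real n * \<delta>\<^sup>2 = 2 * \<tau>\<^sup>2 * (\<kappa>\<^sup>2 * real L)"
        unfolding \<delta>_def power_mult_distrib n12 using n0 by simp
      also have "\<kappa>\<^sup>2 / 2048 \<le> \<kappa>\<^sup>2 * real L / 2048"
        using \<kappa> L1 by (simp add: divide_right_mono)
      also have "2 * \<tau>\<^sup>2 * (\<kappa>\<^sup>2 * real L) \<le> 2 * (1/262144)\<^sup>2 * (\<kappa>\<^sup>2 * real L)"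
        using \<tau> by (intro mult_right_mono mult_left_mono power_mono) auto
      finally have "\<kappa>\<^sup>2 * real L / 256 \<le> \<kappa>\<^sup>2 * real L / 2048 + 2 * (1/262144)\<^sup>2 * (\<kappa>\<^sup>2 * real L)" by simp
      moreover have "\<kappa>\<^sup>2 * real L > 0" using \<kappa> L1 by simp
      ultimately show False by (simp add: power2_eq_square)
    qed
    then have "ennreal \<delta> \<le> besov_width q \<theta> n" by simp
    moreover have "c * real n powr (-1/2) * ln (real n) powr (1/2) \<le> \<delta>"
    proof -
      have "sqrt \<eta> * sqrt (ln (real n)) \<le> sqrt (real L)"
        using L\<eta> by (simp add: real_sqrt_mult[symmetric])
      then have "\<tau> * \<kappa> * real n powr (-1/2) * (sqrt \<eta> * sqrt (ln (real n)))
          \<le> \<tau> * \<kappa> * real n powr (-1/2) * sqrt (real L)"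
        using \<tau> \<kappa> by (intro mult_left_mono) auto
      moreover have "ln (real n) powr (1/2) = sqrt (ln (real n))" using n by (intro powr_half_sqrt) auto
      ultimately show ?thesis by (simp add: c_def \<delta>_def mult_ac)
    qed
    ultimately show ?thesis by (meson ennreal_leI order_trans)
  qed
  ultimately show ?thesis by blast
qed

theorem theorem1:
  fixes q :: real
  assumes "2 < q"
  shows "\<exists>c C. c > 0 \<and> C > 0 \<and>
    (\<forall>(\<theta>::ereal) (n::nat). 1 \<le> \<theta> \<longrightarrow> 2 \<le> n \<longrightarrow>
       (\<theta> \<le> 2 \<longrightarrow>
          ennreal (c * real n powr (-1/2) * ln (real n) powr (1/2))
            \<le> kolmogorov_width n (besov_class 1 1 \<theta> 0 1) q 0 1 \<and>
          kolmogorov_width n (besov_class 1 1 \<theta> 0 1) q 0 1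
            \<le> ennreal (C * real n powr (-1/2) * ln (real n) powr (1/2))) \<and>
       (2 \<le> \<theta> \<longrightarrow>
          ennreal (c * real n powr (-1/2) * ln (real n) powr (1 - inv_theta \<theta>))
            \<le> kolmogorov_width n (besov_class 1 1 \<theta> 0 1) q 0 1 \<and>
          kolmogorov_width n (besov_class 1 1 \<theta> 0 1) q 0 1
            \<le> ennreal (C * real n powr (-1/2) * ln (real n) powr (1 - inv_theta \<theta>))))"
proof -
  obtain C where C: "C > 0" "\<And>\<theta> n. 1 \<le> \<theta> \<Longrightarrow> 2 \<le> n \<Longrightarrow> besov_width q \<theta> n
      \<le> ennreal (C * real n powr (-1/2) * ln (real n) powr log_exponent \<theta>)"
    using besov_width_upper[OF assms] by blast
  \<comment> \<open>Both lower bounds hold for every \<theta> \<ge> 1; each is used in the range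
    where its logarithm has the larger exponent.\<close>
  obtain c1 where c1: "c1 > 0" "\<And>\<theta> n. 1 \<le> \<theta> \<Longrightarrow> 2 \<le> n \<Longrightarrow>
      ennreal (c1 * real n powr (-1/2) * ln (real n) powr (1/2)) \<le> besov_width q \<theta> n"
    using besov_width_lower_levels[OF assms] by blast
  obtain c2 where c2: "c2 > 0" "\<And>\<theta> n. 1 \<le> \<theta> \<Longrightarrow> 2 \<le> n \<Longrightarrow>
      ennreal (c2 * real n powr (-1/2) * ln (real n) powr (1 - inv_theta \<theta>)) \<le> besov_width q \<theta> n"
    using besov_width_lower_nested[OF assms] by blast
  define c where "c = min c1 c2"
  have c: "c > 0" "c \<le> c1" "c \<le> c2" using c1(1) c2(1) by (auto simp: c_def)
  have le: "ennreal (c * x * y) \<le> ennreal (c' * x * y)" if "c \<le> c'" "0 \<le> x" "0 \<le> y" for c' x y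
    using that by (intro ennreal_leI mult_right_mono) auto
  have e2: "log_exponent \<theta> = 1 - inv_theta \<theta>" if "2 \<le> \<theta>" for \<theta>
  proof (cases "\<theta> = 2")
    case True
    then show ?thesis by (simp add: log_exponent_def inv_theta_def)
  next
    case False
    then have "\<not> \<theta> \<le> 2" using that by (metis antisym)
    then show ?thesis by (simp add: log_exponent_def)
  qed
  show ?thesis
  proof (intro exI conjI allI impI)
    show "c > 0" "C > 0" by (fact c(1), fact C(1))
    fix \<theta> :: ereal and n :: nat
    assume \<theta>: "1 \<le> \<theta>" and n: "2 \<le> n"
    show "ennreal (c * real n powr (-1/2) * ln (real n) powr (1/2)) \<le> besov_width q \<theta> n"
      by (rule order.trans[OF le[OF c(2)] c1(2)[OF \<theta> n]]) auto
    show "ennreal (c * real n powr (-1/2) * ln (real n) powr (1 - inv_theta \<theta>)) \<le> besov_width q \<theta> n"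
      by (rule order.trans[OF le[OF c(3)] c2(2)[OF \<theta> n]]) auto
    show "besov_width q \<theta> n \<le> ennreal (C * real n powr (-1/2) * ln (real n) powr (1/2))" if "\<theta> \<le> 2"
      using C(2)[OF \<theta> n] that by (simp add: log_exponent_def)
    show "besov_width q \<theta> n \<le> ennreal (C * real n powr (-1/2) * ln (real n) powr (1 - inv_theta \<theta>))" if "2
        \<le> \<theta>"
      using C(2)[OF \<theta> n] e2[OF that] by simp
  qed
qed

end
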